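(* Suppose there is an algorithm ApproxPack that, for any bin $i$ and any non-negative item weights $(w_j)_{j\in[n]}$, returns in time $p(n,\alpha)$ an $\alpha$-approximation to $\max\{\sum_{j\in T}w_j : T\in\mathcal{F}_i\}$. Then for every $\varepsilon>0$ there exists a $(1-\varepsilon)(1-e^{-\alpha})$-approximation algorithm for the Separable Assignment Problem with $n$ items and $m$ bins that runs in time $\tilde{O}((n/\varepsilon+p(n,\alpha))\cdot m)$.
   Context: Separable Assignment Problem (SAP): there are $n$ items and $m$ bins; each bin $i$ has a down-closed collection $\mathcal{F}_i\subseteq 2^{[n]}$ of feasible sets ($A\in\mathcal{F}_i$ and $B\subseteq A$ imply $B\in\mathcal{F}_i$); each item $j$ and bin $i$ have a value $v_{ij}\ge 0$. The goal is to choose pairwise disjoint sets $S_i\in\mathcal{F}_i$ maximizing $\sum_{i=1}^m\sum_{j\in S_i}v_{ij}$. A (possibly randomized) $\rho$-approximation algorithm returns a feasible solution whose (expected) value is at least $\rho$ times the optimum. $\tilde{O}$ hides polylogarithmic factors. *)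

theory Defs
  imports "HOL-Probability.SPMF"
begin

section \<open>The Separable Assignment Problem\<close>

text \<open>Items are \<open>0, \<dots>, items I - 1\<close> and bins are \<open>0, \<dots>, bins I - 1\<close>;
  \<open>worth I i j\<close> is the value \<open>v\<^sub>i\<^sub>j\<close> of item \<open>j\<close> in bin \<open>i\<close>.\<close>

record sap =
  items :: nat
  bins :: nat
  feas :: "nat \<Rightarrow> nat set set"
  worth :: "nat \<Rightarrow> nat \<Rightarrow> real"

text \<open>The collections \<open>feas I i\<close> are non-empty (equivalently, contain the empty set):
  otherwise there would be no feasible solution at all.\<close>

definition sap_instance :: "sap \<Rightarrow> bool" where
  "sap_instance I \<longleftrightarrow>
     0 < bins I \<and>
     (\<forall>i<bins I. feas I i \<noteq> {} \<and> feas I i \<subseteq> Pow {..<items I} \<and>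
        (\<forall>A B. A \<in> feas I i \<and> B \<subseteq> A \<longrightarrow> B \<in> feas I i)) \<and>
     (\<forall>i<bins I. \<forall>j<items I. 0 \<le> worth I i j)"

definition feasible_solution :: "sap \<Rightarrow> (nat \<Rightarrow> nat set) \<Rightarrow> bool" where
  "feasible_solution I S \<longleftrightarrow>
     (\<forall>i<bins I. S i \<in> feas I i) \<and>
     (\<forall>i<bins I. \<forall>i'<bins I. i \<noteq> i' \<longrightarrow> S i \<inter> S i' = {})"

definition solution_worth :: "sap \<Rightarrow> (nat \<Rightarrow> nat set) \<Rightarrow> real" where
  "solution_worth I S = (\<Sum>i<bins I. \<Sum>j\<in>S i. worth I i j)"

definition opt :: "sap \<Rightarrow> real" where
  "opt I = Max (solution_worth I ` {S. feasible_solution I S})"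

section \<open>The subroutine ApproxPack\<close>

text \<open>Given a bin and item weights, a (possibly randomized) packer returns a set of items
  together with the time that this execution took.\<close>

type_synonym packer = "nat \<Rightarrow> (nat \<Rightarrow> real) \<Rightarrow> (nat set \<times> nat) pmf"

definition approx_pack :: "sap \<Rightarrow> real \<Rightarrow> real \<Rightarrow> packer \<Rightarrow> bool" where
  "approx_pack I \<alpha> \<tau> A \<longleftrightarrow>
     (\<forall>i<bins I. \<forall>w. (\<forall>j<items I. 0 \<le> w j) \<longrightarrow>
        (\<forall>(T, t) \<in> set_pmf (A i w). T \<in> feas I i \<and> 1 \<le> t \<and> real t \<le> \<tau>) \<and>
        \<alpha> * Max ((\<lambda>T. \<Sum>j\<in>T. w j) ` feas I i)
          \<le> measure_pmf.expectation (A i w) (\<lambda>(T, t). \<Sum>j\<in>T. w j))"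

section \<open>The machine model\<close>

text \<open>Algorithms are programs of a randomized real RAM with a packing oracle, presented as a
  structured language. The memory consists of finitely many (per program) named unbounded arrays
  of natural numbers and of real numbers; a scalar is cell 0 of an array. Natural numbers support
  only addition, truncated subtraction and comparison, reals support the field operations and
  comparison. There is no rounding from reals to naturals, and the only literals are naturals,
  so that nothing can be encoded in a single real constant. Every node of an expression, every
  command other than \<open>Seq\<close>, and every test of a loop guard costs one time unit.\<close>

type_synonym name = string

record memory =
  nats :: "name \<Rightarrow> nat \<Rightarrow> nat"
  reals :: "name \<Rightarrow> nat \<Rightarrow> real"

datatype nexp = Lit nat | NCell name nexp | NAdd nexp nexp | NSub nexp nexp

datatype rexp = OfNat nexp | RCell name nexp
  | RAdd rexp rexp | RSub rexp rexp | RMul rexp rexp | RDiv rexp rexp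

datatype bexp = NLess nexp nexp | RLess rexp rexp | Neg bexp | Conj bexp bexp

primrec nval :: "nexp \<Rightarrow> memory \<Rightarrow> nat" where
  "nval (Lit c) s = c"
| "nval (NCell a e) s = nats s a (nval e s)"
| "nval (NAdd e f) s = nval e s + nval f s"
| "nval (NSub e f) s = nval e s - nval f s"

primrec rval :: "rexp \<Rightarrow> memory \<Rightarrow> real" where
  "rval (OfNat e) s = real (nval e s)"
| "rval (RCell a e) s = reals s a (nval e s)"
| "rval (RAdd e f) s = rval e s + rval f s"
| "rval (RSub e f) s = rval e s - rval f s"
| "rval (RMul e f) s = rval e s * rval f s"
| "rval (RDiv e f) s = rval e s / rval f s"

primrec bval :: "bexp \<Rightarrow> memory \<Rightarrow> bool" where
  "bval (NLess e f) s \<longleftrightarrow> nval e s < nval f s"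
| "bval (RLess e f) s \<longleftrightarrow> rval e s < rval f s"
| "bval (Neg b) s \<longleftrightarrow> \<not> bval b s"
| "bval (Conj b c) s \<longleftrightarrow> bval b s \<and> bval c s"

primrec ncost :: "nexp \<Rightarrow> nat" where
  "ncost (Lit c) = 1"
| "ncost (NCell a e) = 1 + ncost e"
| "ncost (NAdd e f) = 1 + ncost e + ncost f"
| "ncost (NSub e f) = 1 + ncost e + ncost f"

primrec rcost :: "rexp \<Rightarrow> nat" where
  "rcost (OfNat e) = 1 + ncost e"
| "rcost (RCell a e) = 1 + ncost e"
| "rcost (RAdd e f) = 1 + rcost e + rcost f"
| "rcost (RSub e f) = 1 + rcost e + rcost f"
| "rcost (RMul e f) = 1 + rcost e + rcost f"
| "rcost (RDiv e f) = 1 + rcost e + rcost f"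

primrec bcost :: "bexp \<Rightarrow> nat" where
  "bcost (NLess e f) = 1 + ncost e + ncost f"
| "bcost (RLess e f) = 1 + rcost e + rcost f"
| "bcost (Neg b) = 1 + bcost b"
| "bcost (Conj b c) = 1 + bcost b + bcost c"

text \<open>\<open>Random a e f\<close> stores a uniformly random element of \<open>{0..<f}\<close> in \<open>a[e]\<close>
  (and 0 if \<open>f = 0\<close>). \<open>CallPack e a b\<close> calls the oracle for bin \<open>e\<close> with the
  weights held in the real array \<open>a\<close>, and stores the characteristic vector of the
  returned set in the array \<open>b\<close>.\<close>

datatype com =
    Skip
  | NStore name nexp nexp
  | RStore name nexp rexp
  | Random name nexp nexp
  | CallPack nexp name name
  | Seq com com
  | Cond bexp com com
  | While bexp com

definition write_nat :: "name \<Rightarrow> nat \<Rightarrow> nat \<Rightarrow> memory \<Rightarrow> memory" where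
  "write_nat a k x s = s\<lparr>nats := (nats s)(a := (nats s a)(k := x))\<rparr>"

definition write_real :: "name \<Rightarrow> nat \<Rightarrow> real \<Rightarrow> memory \<Rightarrow> memory" where
  "write_real a k x s = s\<lparr>reals := (reals s)(a := (reals s a)(k := x))\<rparr>"

definition write_set :: "nat \<Rightarrow> name \<Rightarrow> nat set \<Rightarrow> memory \<Rightarrow> memory" where
  "write_set n a T s =
     s\<lparr>nats := (nats s)(a := (\<lambda>j. if j < n then of_bool (j \<in> T) else nats s a j))\<rparr>"

definition add_cost :: "nat \<Rightarrow> (memory \<times> nat) spmf \<Rightarrow> (memory \<times> nat) spmf" where
  "add_cost c p = map_spmf (\<lambda>(s, t). (s, c + t)) p"

text \<open>Executions are subprobability distributions over final memories and running times;
  the missing mass is the probability of divergence. A loop is the least fixed point of its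
  unfolding.\<close>

partial_function (spmf) loop ::
  "(memory \<Rightarrow> bool) \<Rightarrow> nat \<Rightarrow> (memory \<Rightarrow> (memory \<times> nat) spmf) \<Rightarrow> memory \<Rightarrow> (memory \<times> nat) spmf"
where
  "loop b c body s =
     (if b s
      then bind_spmf (body s) (\<lambda>(s', t).
             map_spmf (\<lambda>(s'', t'). (s'', c + t + t')) (loop b c body s'))
      else return_spmf (s, c))"

text \<open>Besides the time reported by the oracle, an oracle call is charged \<open>n\<close> (the number of
  items) for passing the weights and storing the answer.\<close>

primrec exec :: "nat \<Rightarrow> packer \<Rightarrow> com \<Rightarrow> memory \<Rightarrow> (memory \<times> nat) spmf" where
  "exec n A Skip s = return_spmf (s, 1)"
| "exec n A (NStore a e f) s =
     return_spmf (write_nat a (nval e s) (nval f s) s, 1 + ncost e + ncost f)"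
| "exec n A (RStore a e f) s =
     return_spmf (write_real a (nval e s) (rval f s) s, 1 + ncost e + rcost f)"
| "exec n A (Random a e f) s =
     map_spmf (\<lambda>x. (write_nat a (nval e s) x s, 1 + ncost e + ncost f))
       (spmf_of_pmf (pmf_of_set {..<max 1 (nval f s)}))"
| "exec n A (CallPack e a b) s =
     map_spmf (\<lambda>(T, t). (write_set n b T s, 1 + ncost e + n + t))
       (spmf_of_pmf (A (nval e s) (\<lambda>j. if j < n then reals s a j else 0)))"
| "exec n A (Seq P Q) s = bind_spmf (exec n A P s) (\<lambda>(s', t). add_cost t (exec n A Q s'))"
| "exec n A (Cond b P Q) s =
     add_cost (1 + bcost b) (if bval b s then exec n A P s else exec n A Q s)"
| "exec n A (While b P) s = loop (bval b) (1 + bcost b) (exec n A P) s"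

section \<open>Algorithms for the Separable Assignment Problem\<close>

text \<open>The values \<open>v\<^sub>i\<^sub>j\<close> are passed row by row. The feasible sets are not part of the
  input: they are accessible only through the oracle.\<close>

definition initial :: "sap \<Rightarrow> real \<Rightarrow> memory" where
  "initial I \<epsilon> =
     \<lparr>nats = (\<lambda>a k.
        if a = ''n'' \<and> k = 0 then items I
        else if a = ''m'' \<and> k = 0 then bins I
        else 0),
      reals = (\<lambda>a k.
        if a = ''eps'' \<and> k = 0 then \<epsilon>
        else if a = ''v'' \<and> k < bins I * items I
          then worth I (k div items I) (k mod items I)
        else 0)\<rparr>"

text \<open>Cell \<open>j\<close> of \<open>out\<close> is \<open>i + 1\<close> if item \<open>j\<close> is put into bin \<open>i\<close>, and 0 if item \<open>j\<close>
  is left unassigned.\<close>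

definition assigned :: "sap \<Rightarrow> memory \<Rightarrow> nat \<Rightarrow> nat set" where
  "assigned I s i = {j. j < items I \<and> nats s ''out'' j = i + 1}"

definition run :: "com \<Rightarrow> packer \<Rightarrow> sap \<Rightarrow> real \<Rightarrow> (memory \<times> nat) spmf" where
  "run P A I \<epsilon> = exec (items I) A P (initial I \<epsilon>)"

definition approximates :: "real \<Rightarrow> sap \<Rightarrow> (memory \<times> nat) spmf \<Rightarrow> bool" where
  "approximates \<rho> I r \<longleftrightarrow>
     lossless_spmf r \<and>
     (\<forall>(s, t) \<in> set_spmf r. feasible_solution I (assigned I s)) \<and>
     \<rho> * opt I \<le> (LINT st|measure_spmf r. solution_worth I (assigned I (fst st)))"

definition runs_within :: "real \<Rightarrow> (memory \<times> nat) spmf \<Rightarrow> bool" where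
  "runs_within \<tau> r \<longleftrightarrow> lossless_spmf r \<and> (\<forall>(s, t) \<in> set_spmf r. real t \<le> \<tau>)"

end

(* Continuous greedy would let every bin play, at time t in [0,1], an approximately optimal set for the
   marginal values at time t; in the end every bin keeps the set of a uniformly random time. To save
   oracle calls, every bin stores a single set S_i and is active with probability t at time t; when t grows
   from y = (k-1)/L to y' = k/L, the set is recomputed with probability 1 - y/y' = 1/k only. Then S_i always
   stems from a uniformly random earlier time, and a bin is refreshed O(log L) times in expectation.

   The active bins are kept in a priority list: an item goes to the last active bin whose set contains it,
   and a refreshed bin moves to the end of the list. Let z_j be the expected value x_j of item j without
   bin i. The oracle is called with the weights max 0 (v_ij - z_j). The expected value is affine in the
   activation probability of bin i, hence processing bin i increases it by (y' - y) * (weight of the new set)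
   >= (alpha/L) * (sum of v_ij - x_j over the optimal set of bin i) in expectation. Since the expectation of
   x_j never decreases, a round increases the total X by at least (alpha/L) * (OPT - X), where X is the value
   at the end of the round, and after L rounds X >= (1 - (1 + alpha/L)^(-L)) * OPT. At time 1 all bins are
   active and X is the value of the solution.

   A hard bound on the total number of refreshments costs little because their number has a bounded
   exponential moment. The values x_j are maintained without sorting: in every round the bins are processed
   in the order of the list, and the part of the list behind the current bin acts on the expected value of
   an item as an affine map that is updated in constant time. *)

theory Submission
  imports Defs
begin

section \<open>Averaging over finitely supported distributions\<close>

text \<open>The time bound leaves room for only polylogarithmically many oracle calls per bin,
  whereas plain continuous greedy makes one per bin and time step, about m/\<epsilon> in all. Lazy
  refreshing loses nothing in expectation: in round k an old set survives with probability k/(k+1)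
  while its activation probability rises from k/L to (k+1)/L, so its mean contribution stays the
  same; a new set enters with probability 1/(k+1) at activation (k+1)/L, hence with mean weight 1/L.

  The time bound must hold in every outcome, which forces the cap on the number c of refreshments.
  One bin step multiplies the mean of 2^c by at most 1 + 1/(k+1). Over all rounds and bins this
  telescopes to (L+1)^m, so a cap of m*b with 2^b of order L^2 costs at most a fraction \<alpha>/L
  of the optimum.

  A further obstacle is that the gain of a bin is relative to the values at the moment it is
  processed, while the recursion needs the values at the end of the round. Item weights that depend
  on the optimal solution, and occur in the analysis only, bridge this gap.\<close>

lemma expectation_bind_ge:
  fixes f :: "'a \<Rightarrow> real" and g :: "'b \<Rightarrow> real"
  assumes "finite (set_pmf M)" "\<And>x. x \<in> set_pmf M \<Longrightarrow> finite (set_pmf (N x))"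
    and step: "\<And>x. x \<in> set_pmf M \<Longrightarrow> f x \<le> measure_pmf.expectation (N x) g"
    and "b \<le> measure_pmf.expectation M f"
  shows "b \<le> measure_pmf.expectation (M \<bind> N) g"
proof -
  have "measure_pmf.expectation (M \<bind> N) g
      = (\<Sum>x\<in>set_pmf M. pmf M x *\<^sub>R measure_pmf.expectation (N x) g)"
    using assms by (intro pmf_expectation_bind) auto
  moreover have "measure_pmf.expectation M f = (\<Sum>x\<in>set_pmf M. pmf M x *\<^sub>R f x)"
    using assms by (intro integral_measure_pmf) auto
  moreover have "\<dots> \<le> (\<Sum>x\<in>set_pmf M. pmf M x *\<^sub>R measure_pmf.expectation (N x) g)"
    by (intro sum_mono) (auto intro!: mult_left_mono step)
  ultimately show ?thesis using assms by linarith
qed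

lemma expectation_mono_finite:
  fixes f g :: "'a \<Rightarrow> real"
  assumes "finite (set_pmf M)" "\<And>x. x \<in> set_pmf M \<Longrightarrow> f x \<le> g x"
  shows "measure_pmf.expectation M f \<le> measure_pmf.expectation M g"
  using assms by (intro integral_mono_AE) (auto simp: AE_measure_pmf_iff integrable_measure_pmf_finite)

lemma expectation_bind_uniform:
  fixes g :: "'b \<Rightarrow> real"
  assumes "0 < k" "\<And>x. x < k \<Longrightarrow> finite (set_pmf (N x))"
  shows "measure_pmf.expectation (pmf_of_set {..<k} \<bind> N) g
    = (\<Sum>x<k. measure_pmf.expectation (N x) g) / real k"
proof -
  have ne: "{..<k} \<noteq> {}" using assms by auto
  have "measure_pmf.expectation (pmf_of_set {..<k} \<bind> N) g
    = (\<Sum>x<k. pmf (pmf_of_set {..<k}) x *\<^sub>R measure_pmf.expectation (N x) g)"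
    using assms ne by (intro pmf_expectation_bind) auto
  also have "\<dots> = (\<Sum>x<k. measure_pmf.expectation (N x) g / real k)"
    using ne by (intro sum.cong) auto
  finally show ?thesis by (simp add: sum_divide_distrib)
qed

section \<open>The expected value of an item\<close>

text \<open>Suppose that the bins of a list are active independently with probability \<open>y\<close>, that an item
  goes to the last active bin whose set contains it, and that its value is \<open>x\<close> if there is none.\<close>

primrec mean_worth ::
  "(nat \<Rightarrow> nat \<Rightarrow> real) \<Rightarrow> (nat \<Rightarrow> nat set) \<Rightarrow> nat \<Rightarrow> real \<Rightarrow> nat list \<Rightarrow> real \<Rightarrow> real" where
  "mean_worth v S j y [] x = x"
| "mean_worth v S j y (i # is) x =
     mean_worth v S j y is (if j \<in> S i then (1 - y) * x + y * v i j else x)"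

primrec miss_prob :: "(nat \<Rightarrow> nat set) \<Rightarrow> nat \<Rightarrow> real \<Rightarrow> nat list \<Rightarrow> real" where
  "miss_prob S j y [] = 1"
| "miss_prob S j y (i # is) = (if j \<in> S i then 1 - y else 1) * miss_prob S j y is"

lemma mean_worth_append [simp]:
  "mean_worth v S j y (is @ is') x = mean_worth v S j y is' (mean_worth v S j y is x)"
  by (induction "is" arbitrary: x) auto

lemma miss_prob_append [simp]:
  "miss_prob S j y (is @ is') = miss_prob S j y is * miss_prob S j y is'"
  by (induction "is") auto

text \<open>Each bin acts by an affine map of slope \<open>1 - y\<close> or 1, so a whole list does
  too, with slope \<open>miss_prob\<close>. One bin can therefore be isolated in the analysis, and
  the program can store a list as two numbers per item.\<close>

lemma mean_worth_affine:
  "mean_worth v S j y is x = mean_worth v S j y is 0 + miss_prob S j y is * x"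
proof (induction "is" arbitrary: x)
  case (Cons i "is")
  show ?case
    unfolding mean_worth.simps miss_prob.simps
    by (subst Cons.IH, subst (2) Cons.IH) (auto simp: algebra_simps)
qed simp

lemma mean_worth_shift:
  "mean_worth v S j y is (x + d) = mean_worth v S j y is x + miss_prob S j y is * d"
  by (subst (1 2) mean_worth_affine) (simp add: algebra_simps)

lemma miss_prob_bounds: "0 \<le> y \<Longrightarrow> y \<le> 1 \<Longrightarrow> 0 \<le> miss_prob S j y is \<and> miss_prob S j y is \<le> 1"
  by (induction "is") (auto intro: mult_le_one)

lemma mean_worth_nonneg:
  "0 \<le> y \<Longrightarrow> y \<le> 1 \<Longrightarrow> 0 \<le> x \<Longrightarrow> (\<And>i. i \<in> set is \<Longrightarrow> 0 \<le> v i j) \<Longrightarrow> 0 \<le> mean_worth v S j y is x"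
  by (induction "is" arbitrary: x) auto

lemma mean_worth_upd [simp]:
  "i \<notin> set is \<Longrightarrow> mean_worth v (S(i := U)) j y is x = mean_worth v S j y is x"
  by (induction "is" arbitrary: x) auto

lemma miss_prob_upd [simp]: "i \<notin> set is \<Longrightarrow> miss_prob (S(i := U)) j y is = miss_prob S j y is"
  by (induction "is") auto

lemma mean_worth_0 [simp]: "mean_worth v S j 0 is x = x"
  by (induction "is" arbitrary: x) auto

section \<open>Optimal solutions\<close>

lemma sap_instanceD:
  assumes "sap_instance I"
  shows "0 < bins I" "i < bins I \<Longrightarrow> feas I i \<noteq> {}" "i < bins I \<Longrightarrow> feas I i \<subseteq> Pow {..<items I}"
    "i < bins I \<Longrightarrow> X \<in> feas I i \<Longrightarrow> Y \<subseteq> X \<Longrightarrow> Y \<in> feas I i"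
    "i < bins I \<Longrightarrow> j < items I \<Longrightarrow> 0 \<le> worth I i j"
    "i < bins I \<Longrightarrow> finite (feas I i)" "i < bins I \<Longrightarrow> {} \<in> feas I i"
proof -
  show "0 < bins I" "i < bins I \<Longrightarrow> feas I i \<noteq> {}"
    and *: "i < bins I \<Longrightarrow> feas I i \<subseteq> Pow {..<items I}"
    and "i < bins I \<Longrightarrow> X \<in> feas I i \<Longrightarrow> Y \<subseteq> X \<Longrightarrow> Y \<in> feas I i"
    and "i < bins I \<Longrightarrow> j < items I \<Longrightarrow> 0 \<le> worth I i j"
    using assms unfolding sap_instance_def by blast+
  show "i < bins I \<Longrightarrow> finite (feas I i)" using * by (auto intro: finite_subset)
  show "i < bins I \<Longrightarrow> {} \<in> feas I i"
    using assms unfolding sap_instance_def by (metis empty_subsetI equals0I)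
qed

lemma solution_worth_nonneg:
  assumes "sap_instance I" "feasible_solution I S"
  shows "0 \<le> solution_worth I S"
  unfolding solution_worth_def
proof (intro sum_nonneg)
  fix i j assume "i \<in> {..<bins I}" "j \<in> S i"
  moreover from this have "S i \<subseteq> {..<items I}"
    using sap_instanceD(3)[OF assms(1), of i] assms(2) by (auto simp: feasible_solution_def)
  ultimately show "0 \<le> worth I i j" using sap_instanceD(5)[OF assms(1)] by auto
qed

text \<open>The sets at indices beyond the bins are arbitrary, so there are infinitely many feasible
  solutions. Restriction to extensional functions keeps the values and leaves finitely many.\<close>

lemma finite_solution_worths:
  assumes "sap_instance I"
  shows "finite (solution_worth I ` {S. feasible_solution I S})"
proof -
  have "solution_worth I ` {S. feasible_solution I S}
      \<subseteq> solution_worth I ` (PiE {..<bins I} (feas I))"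
  proof
    fix x assume "x \<in> solution_worth I ` {S. feasible_solution I S}"
    then obtain S where S: "feasible_solution I S" "x = solution_worth I S" by auto
    have "x = solution_worth I (restrict S {..<bins I})"
      using S by (auto simp: solution_worth_def)
    moreover have "restrict S {..<bins I} \<in> PiE {..<bins I} (feas I)"
      using S by (auto simp: feasible_solution_def)
    ultimately show "x \<in> solution_worth I ` (PiE {..<bins I} (feas I))" by blast
  qed
  moreover have "finite (PiE {..<bins I} (feas I))"
    using sap_instanceD(6)[OF assms] by (intro finite_PiE) auto
  ultimately show ?thesis by (meson finite_imageI finite_subset)
qed

lemma opt_attained:
  assumes "sap_instance I"
  obtains S where "feasible_solution I S" "solution_worth I S = opt I"
proof -
  have "feasible_solution I (\<lambda>_. {})"
    using sap_instanceD(7)[OF assms] by (auto simp: feasible_solution_def)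
  then have "opt I \<in> solution_worth I ` {S. feasible_solution I S}"
    unfolding opt_def using finite_solution_worths[OF assms] by (intro Max_in) auto
  then show ?thesis using that by auto
qed

section \<open>The lazy continuous greedy process\<close>

locale lazy_greedy =
  fixes I :: sap and \<alpha> \<tau> :: real and pack :: packer and L cap :: nat
  assumes inst: "sap_instance I"
    and pack: "approx_pack I \<alpha> \<tau> pack"
    and alpha: "0 < \<alpha>" "\<alpha> \<le> 1"
    and L_pos: "0 < L"
begin

definition level :: "nat \<Rightarrow> real" where
  "level k = real k / real L"

text \<open>The expected value of an item in the middle of a round: the bins of \<open>A\<close> and
  \<open>B\<close> already have the new activation probability, those of \<open>Q\<close> still the
  old one. In \<open>gain\<close> the bin being processed is in none of the three lists.\<close>

definition mixed :: "nat \<Rightarrow> nat list \<Rightarrow> nat list \<Rightarrow> nat list \<Rightarrow> (nat \<Rightarrow> nat set) \<Rightarrow> nat \<Rightarrow> real" where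
  "mixed k A Q B S j =
     mean_worth (worth I) S j (level (Suc k)) B
       (mean_worth (worth I) S j (level k) Q
         (mean_worth (worth I) S j (level (Suc k)) A 0))"

definition gain ::
  "nat \<Rightarrow> nat list \<Rightarrow> nat list \<Rightarrow> nat list \<Rightarrow> (nat \<Rightarrow> nat set) \<Rightarrow> nat \<Rightarrow> nat \<Rightarrow> real" where
  "gain k A Q B S i j = max 0 (worth I i j - mixed k A Q B S j)"

text \<open>Without pruning, the value of an item could be larger without bin \<open>i\<close> than with it, and the
  gains could not be compared with the values at the end of the round.\<close>

definition pruned :: "nat \<Rightarrow> nat list \<Rightarrow> (nat \<Rightarrow> nat set) \<Rightarrow> nat \<Rightarrow> nat set" where
  "pruned k A S i =
     {j \<in> S i. mean_worth (worth I) S j (level (Suc k)) A 0 \<le> worth I i j}"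

text \<open>The answer of the oracle is thinned to items of positive gain: it may contain items of
  weight 0 whose worth lies below their current value, and these would do harm.\<close>

definition refresh ::
  "nat \<Rightarrow> nat \<Rightarrow> nat list \<Rightarrow> nat list \<times> nat list \<times> (nat \<Rightarrow> nat set) \<times> nat
     \<Rightarrow> (nat list \<times> nat list \<times> (nat \<Rightarrow> nat set) \<times> nat) pmf" where
  "refresh k i Q = (\<lambda>(A, B, S, c).
     map_pmf (\<lambda>T. (A, B @ [i], S(i := {j \<in> T. 0 < gain k A Q B S i j}), Suc c))
       (map_pmf fst (pack i (\<lambda>j. if j < items I then gain k A Q B S i j else 0))))"

definition keep ::
  "nat \<Rightarrow> nat \<Rightarrow> nat list \<times> nat list \<times> (nat \<Rightarrow> nat set) \<times> nat
     \<Rightarrow> nat list \<times> nat list \<times> (nat \<Rightarrow> nat set) \<times> nat" where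
  "keep k i = (\<lambda>(A, B, S, c). (A @ [i], B, S(i := pruned k A S i), c))"

definition bin_step ::
  "nat \<Rightarrow> nat \<Rightarrow> nat list \<Rightarrow> nat list \<times> nat list \<times> (nat \<Rightarrow> nat set) \<times> nat
     \<Rightarrow> (nat list \<times> nat list \<times> (nat \<Rightarrow> nat set) \<times> nat) pmf" where
  "bin_step k i Q st = pmf_of_set {..<Suc k} \<bind>
     (\<lambda>x. if x = 0 \<and> snd (snd (snd st)) < cap then refresh k i Q st else return_pmf (keep k i st))"

text \<open>During a round the priority list is \<open>A @ Q @ B\<close>: the bins of \<open>Q\<close> still have to be processed
  and are active with the old probability, those of \<open>B\<close> have been refreshed in this round.\<close>

primrec pass ::
  "nat \<Rightarrow> nat list \<Rightarrow> nat list \<times> nat list \<times> (nat \<Rightarrow> nat set) \<times> nat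
     \<Rightarrow> (nat list \<times> nat list \<times> (nat \<Rightarrow> nat set) \<times> nat) pmf" where
  "pass k [] st = return_pmf st"
| "pass k (i # Q) st = bin_step k i Q st \<bind> pass k Q"

definition round ::
  "nat \<Rightarrow> nat list \<times> (nat \<Rightarrow> nat set) \<times> nat \<Rightarrow> (nat list \<times> (nat \<Rightarrow> nat set) \<times> nat) pmf" where
  "round k = (\<lambda>(R, S, c). map_pmf (\<lambda>(A, B, S, c). (A @ B, S, c)) (pass k R ([], [], S, c)))"

primrec rounds :: "nat \<Rightarrow> (nat list \<times> (nat \<Rightarrow> nat set) \<times> nat) pmf" where
  "rounds 0 = return_pmf ([0..<bins I], (\<lambda>_. {}), 0)"
| "rounds (Suc k) = rounds k \<bind> round k"

definition ok :: "nat list \<Rightarrow> nat list \<times> nat list \<times> (nat \<Rightarrow> nat set) \<times> nat \<Rightarrow> bool" where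
  "ok Q = (\<lambda>(A, B, S, c). distinct (A @ Q @ B) \<and> set (A @ Q @ B) = {..<bins I} \<and>
     (\<forall>i<bins I. S i \<in> feas I i) \<and> c \<le> cap)"

section \<open>Finite supports and invariants of the process\<close>

lemma pack_support:
  assumes "i < bins I" "\<And>j. j < items I \<Longrightarrow> 0 \<le> w j"
  shows "finite (set_pmf (pack i w))"
    and "(T, t) \<in> set_pmf (pack i w) \<Longrightarrow> T \<in> feas I i \<and> 1 \<le> t \<and> real t \<le> \<tau>"
proof -
  have *: "\<forall>(T, t) \<in> set_pmf (pack i w). T \<in> feas I i \<and> 1 \<le> t \<and> real t \<le> \<tau>"
    using pack assms unfolding approx_pack_def by blast
  then show "(T, t) \<in> set_pmf (pack i w) \<Longrightarrow> T \<in> feas I i \<and> 1 \<le> t \<and> real t \<le> \<tau>" by auto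
  \<comment> \<open>The time bound leaves finitely many reported times. With a finite support, all
    expectations are finite sums and integrability is immediate.\<close>
  have "set_pmf (pack i w) \<subseteq> feas I i \<times> {..nat \<lfloor>\<tau>\<rfloor>}"
    using * by (auto simp: le_nat_iff le_floor_iff)
  then show "finite (set_pmf (pack i w))"
    using sap_instanceD(6)[OF inst assms(1)] by (meson finite_SigmaI finite_atMost finite_subset)
qed

lemma gain_nonneg: "0 \<le> gain k A Q B S i j"
  by (simp add: gain_def)

lemma refresh_support:
  assumes "ok (i # Q) (A, B, S, c)" "c < cap"
  shows "finite (set_pmf (refresh k i Q (A, B, S, c)))"
    and "st \<in> set_pmf (refresh k i Q (A, B, S, c)) \<Longrightarrow> ok Q st"
proof -
  let ?w = "\<lambda>j. if j < items I then gain k A Q B S i j else 0"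
  have i: "i < bins I" using assms by (auto simp: ok_def)
  note ps = pack_support[OF i, of ?w]
  show "finite (set_pmf (refresh k i Q (A, B, S, c)))"
    using ps(1) by (auto simp: refresh_def gain_nonneg)
  assume "st \<in> set_pmf (refresh k i Q (A, B, S, c))"
  then obtain T t where T: "(T, t) \<in> set_pmf (pack i ?w)"
    and st: "st = (A, B @ [i], S(i := {j \<in> T. 0 < gain k A Q B S i j}), Suc c)"
    by (auto simp: refresh_def)
  have "T \<in> feas I i" using ps(2) T by (auto simp: gain_nonneg)
  then have "{j \<in> T. 0 < gain k A Q B S i j} \<in> feas I i"
    using sap_instanceD(4)[OF inst i] by auto
  then show "ok Q st" using assms st by (auto simp: ok_def)
qed

lemma keep_ok:
  assumes "ok (i # Q) (A, B, S, c)"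
  shows "ok Q (keep k i (A, B, S, c))"
proof -
  have i: "i < bins I" "S i \<in> feas I i" using assms by (auto simp: ok_def)
  then have "pruned k A S i \<in> feas I i"
    using sap_instanceD(4)[OF inst] by (auto simp: pruned_def)
  then show ?thesis using assms by (auto simp: ok_def keep_def)
qed

lemma bin_step_support:
  assumes "ok (i # Q) st"
  shows "finite (set_pmf (bin_step k i Q st))" and "st' \<in> set_pmf (bin_step k i Q st) \<Longrightarrow> ok Q st'"
proof -
  obtain A B S c where st: "st = (A, B, S, c)" by (cases st) auto
  have "set_pmf (pmf_of_set {..<Suc k}) = {..<Suc k}" by (intro set_pmf_of_set) auto
  then show "finite (set_pmf (bin_step k i Q st))"
    using refresh_support(1)[of i Q A B S c k] assms st by (auto simp: bin_step_def)
  show "st' \<in> set_pmf (bin_step k i Q st) \<Longrightarrow> ok Q st'"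
    using refresh_support(2)[of i Q A B S c st' k] keep_ok[of i Q A B S c k] assms st
    by (auto simp: bin_step_def split: if_splits)
qed

lemma pass_support:
  assumes "ok Q st"
  shows "finite (set_pmf (pass k Q st)) \<and> (\<forall>st'\<in>set_pmf (pass k Q st). ok [] st')"
  using assms
proof (induction Q arbitrary: st)
  case (Cons i Q)
  then show ?case using bin_step_support[of i Q st] by fastforce
qed simp

lemma round_support:
  assumes "ok [] (R, [], S, c)"
  shows "finite (set_pmf (round k (R, S, c)))"
    and "(R', S', c') \<in> set_pmf (round k (R, S, c)) \<Longrightarrow> ok [] (R', [], S', c')"
  using pass_support[of R "([], [], S, c)" k] assms by (fastforce simp: round_def ok_def)+

lemma rounds_support:
  "finite (set_pmf (rounds k)) \<and> (\<forall>(R, S, c)\<in>set_pmf (rounds k). ok [] (R, [], S, c))"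
proof (induction k)
  case 0
  then show ?case using sap_instanceD(7)[OF inst] by (auto simp: ok_def)
next
  case (Suc k)
  then show ?case using round_support by fastforce
qed


section \<open>Expected change of the value in one bin step\<close>

lemma level_simps [simp]:
  "level 0 = 0" "level L = 1" "0 \<le> level k" "k \<le> L \<Longrightarrow> level k \<le> 1" "k < L \<Longrightarrow> level k < 1"
  using L_pos by (auto simp: level_def)

text \<open>For an item in its set, the contribution of bin \<open>i\<close> is linear in its own
  activation probability. A kept bin has the same coefficient with \<open>level (Suc k)\<close> for
  \<open>level k\<close>, as long as pruning leaves the item in the set.\<close>

lemma mixed_Cons:
  "mixed k A (i # Q) B S j = mixed k A Q B S j +
     (if j \<in> S i then miss_prob S j (level k) Q * miss_prob S j (level (Suc k)) B * level k
        * (worth I i j - mean_worth (worth I) S j (level (Suc k)) A 0) else 0)"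
proof -
  have "(1 - y) * p + y * w = p + y * (w - p)" for y p w :: real by (simp add: algebra_simps)
  then show ?thesis by (simp add: mixed_def mean_worth_shift)
qed

lemma mixed_kept:
  "i \<notin> set (A @ Q @ B) \<Longrightarrow> mixed k (A @ [i]) Q B (S(i := pruned k A S i)) j = mixed k A Q B S j +
     (if j \<in> pruned k A S i then miss_prob S j (level k) Q * miss_prob S j (level (Suc k)) B
        * level (Suc k) * (worth I i j - mean_worth (worth I) S j (level (Suc k)) A 0) else 0)"
proof -
  assume "i \<notin> set (A @ Q @ B)"
  moreover have "(1 - y) * p + y * w = p + y * (w - p)" for y p w :: real by (simp add: algebra_simps)
  ultimately show ?thesis by (simp add: mixed_def mean_worth_shift)
qed

text \<open>At the end of the list nothing overrides the bin, so the increment is the full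
  activation probability times the gain. This is why refreshed bins move to the end.\<close>

lemma mixed_refreshed:
  "i \<notin> set (A @ Q @ B) \<Longrightarrow> mixed k A Q (B @ [i]) (S(i := U)) j = mixed k A Q B S j +
     (if j \<in> U then level (Suc k) * (worth I i j - mixed k A Q B S j) else 0)"
  unfolding mixed_def by (auto simp: algebra_simps)

lemma mixed_nonneg:
  assumes "Suc k \<le> L" "set (A @ Q @ B) \<subseteq> {..<bins I}" "j < items I"
  shows "0 \<le> mixed k A Q B S j"
  unfolding mixed_def
  using assms sap_instanceD(5)[OF inst] by (intro mean_worth_nonneg) auto

lemma pack_expectation:
  assumes "i < bins I" "\<And>j. j < items I \<Longrightarrow> 0 \<le> w j" "X \<in> feas I i"
  shows "\<alpha> * (\<Sum>j\<in>X. w j) \<le> measure_pmf.expectation (pack i w) (\<lambda>(T, t). \<Sum>j\<in>T. w j)"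
proof -
  have "(\<Sum>j\<in>X. w j) \<le> Max ((\<lambda>T. \<Sum>j\<in>T. w j) ` feas I i)"
    using sap_instanceD(6)[OF inst assms(1)] assms(3) by (intro Max_ge) auto
  then have "\<alpha> * (\<Sum>j\<in>X. w j) \<le> \<alpha> * Max ((\<lambda>T. \<Sum>j\<in>T. w j) ` feas I i)"
    using alpha by auto
  also have "\<dots> \<le> measure_pmf.expectation (pack i w) (\<lambda>(T, t). \<Sum>j\<in>T. w j)"
    using pack assms(1,2) unfolding approx_pack_def by blast
  finally show ?thesis .
qed

text \<open>The weights \<open>u\<close> come from the unknown optimal solution and cannot be passed
  to the oracle, which maximizes the unweighted gain. As every inserted item only gains value,
  \<open>1 \<le> u j\<close> suffices to pass to the weighted sum.\<close>

lemma refresh_expectation: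
  assumes ok: "ok (i # Q) (A, B, S, c)" and "c < cap" and k: "Suc k \<le> L"
    and u: "\<And>j. 1 \<le> u j" and X: "X \<in> feas I i"
  shows "(\<Sum>j<items I. u j * mixed k A Q B S j) + level (Suc k) * (\<alpha> * (\<Sum>j\<in>X. gain k A Q B S i j))
       - g * 2 ^ Suc c
    \<le> measure_pmf.expectation (refresh k i Q (A, B, S, c))
        (\<lambda>(A, B, S, c). (\<Sum>j<items I. u j * mixed k A Q B S j) - g * 2 ^ c)"
    (is "?b \<le> measure_pmf.expectation _ ?f")
proof -
  let ?w = "\<lambda>j. if j < items I then gain k A Q B S i j else 0"
  let ?z = "mixed k A Q B S"
  have i: "i < bins I" and i': "i \<notin> set (A @ Q @ B)" using ok by (auto simp: ok_def)
  note ps = pack_support[OF i, of ?w]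
  have sub: "T \<subseteq> {..<items I}" if "T \<in> feas I i" for T
    using sap_instanceD(3)[OF inst i] that by auto
  have "(\<Sum>j\<in>X. gain k A Q B S i j) = (\<Sum>j\<in>X. ?w j)"
    using sub[OF X] by (intro sum.cong) auto
  then have "\<alpha> * (\<Sum>j\<in>X. gain k A Q B S i j)
      \<le> measure_pmf.expectation (pack i ?w) (\<lambda>(T, t). \<Sum>j\<in>T. ?w j)"
    using pack_expectation[OF i _ X, of ?w] by (auto simp: gain_nonneg)
  then have "?b \<le> (\<Sum>j<items I. u j * ?z j)
      + level (Suc k) * measure_pmf.expectation (pack i ?w) (\<lambda>(T, t). \<Sum>j\<in>T. ?w j) - g * 2 ^ Suc c"
    using k by (auto intro!: mult_left_mono)
  also have "\<dots> = measure_pmf.expectation (pack i ?w) (\<lambda>(T, t). (\<Sum>j<items I. u j * ?z j)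
      + level (Suc k) * (\<Sum>j\<in>T. ?w j) - g * 2 ^ Suc c)"
    using ps(1) by (simp add: case_prod_unfold gain_nonneg integrable_measure_pmf_finite)
  also have "\<dots> \<le> measure_pmf.expectation (pack i ?w)
      (\<lambda>(T, t). ?f (A, B @ [i], S(i := {j \<in> T. 0 < gain k A Q B S i j}), Suc c))"
  proof (intro expectation_mono_finite, goal_cases)
    case 1
    then show ?case using ps(1) by (auto simp: gain_nonneg)
  next
    case (2 Tt)
    obtain T t where Tt: "Tt = (T, t)" by (cases Tt)
    have T: "T \<in> feas I i" using 2 Tt ps(2) by (auto simp: gain_nonneg)
    let ?U = "{j \<in> T. 0 < gain k A Q B S i j}"
    have "level (Suc k) * (\<Sum>j\<in>T. ?w j) = level (Suc k) * (\<Sum>j<items I. if j \<in> T then gain k A Q B S i j else 0)"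
      using sub[OF T]
      by (subst sum.inter_restrict[symmetric]) (auto simp: Int_absorb1 intro!: sum.cong)
    also have "\<dots> = (\<Sum>j<items I. level (Suc k) * (if j \<in> T then gain k A Q B S i j else 0))"
      by (simp add: sum_distrib_left)
    finally have "(\<Sum>j<items I. u j * ?z j) + level (Suc k) * (\<Sum>j\<in>T. ?w j)
      = (\<Sum>j<items I. u j * ?z j + level (Suc k) * (if j \<in> T then gain k A Q B S i j else 0))"
      by (simp add: sum.distrib)
    also have "\<dots> \<le> (\<Sum>j<items I. u j * mixed k A Q (B @ [i]) (S(i := ?U)) j)"
    proof (rule sum_mono)
      fix j
      have "level (Suc k) * (if j \<in> T then gain k A Q B S i j else 0)
          = (if j \<in> ?U then level (Suc k) * (worth I i j - ?z j) else 0)" (is "?l = ?r")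
        by (auto simp: gain_def max_def)
      moreover have "0 \<le> ?l" by (auto simp: gain_nonneg)
      then have "?l \<le> u j * ?l" using u[of j] by (metis mult_right_mono mult_1)
      ultimately show "u j * ?z j + ?l \<le> u j * mixed k A Q (B @ [i]) (S(i := ?U)) j"
        unfolding mixed_refreshed[OF i'] by (simp add: distrib_left)
    qed
    finally show ?case using Tt by simp
  qed
  also have "\<dots> = measure_pmf.expectation (refresh k i Q (A, B, S, c)) ?f"
    unfolding refresh_def prod.case by (simp add: case_prod_unfold)
  finally show ?thesis .
qed

text \<open>The gains are measured against the present values, but the round needs the values at its
  end. So \<open>\<alpha> / L\<close> times the values on \<open>X\<close> moves to the other side
  by raising the weights from \<open>u\<close> to \<open>u'\<close>; as expected values never fall,
  the comparison can wait until the end of the round. The term with \<open>g\<close> follows the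
  mean of \<open>2 ^ c\<close>, and \<open>h\<close> pays for refreshments that the cap
  forbids.\<close>

lemma bin_step_expectation:
  assumes ok: "ok (i # Q) (A, B, S, c)" and k: "Suc k \<le> L"
    and u: "\<And>j. 1 \<le> u j" and X: "X \<in> feas I i" "(\<Sum>j\<in>X. worth I i j) \<le> V"
    and u': "\<And>j. u' j = u j + \<alpha> / L * of_bool (j \<in> X)" and "0 \<le> g"
    and h: "\<alpha> / L * V \<le> h * 2 ^ cap" "0 \<le> h"
  shows "(\<Sum>j<items I. u j * mixed k A (i # Q) B S j) + \<alpha> / L * (\<Sum>j\<in>X. worth I i j)
       - (g * (1 + 1 / Suc k) + h) * 2 ^ c
    \<le> measure_pmf.expectation (bin_step k i Q (A, B, S, c))
        (\<lambda>(A, B, S, c). (\<Sum>j<items I. u' j * mixed k A Q B S j) - g * 2 ^ c)"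
    (is "?b \<le> measure_pmf.expectation _ ?f")
proof -
  have i: "i < bins I" and i': "i \<notin> set (A @ Q @ B)" using ok by (auto simp: ok_def)
  define z where "z = mixed k A Q B S"
  \<comment> \<open>The coefficient of the activation probability of bin \<open>i\<close> after
    pruning. It is nonnegative, and dropping the negative contributions makes \<open>x j\<close> an
    upper bound of the old value.\<close>
  define d where "d j = (if j \<in> pruned k A S i then miss_prob S j (level k) Q * miss_prob S j (level (Suc k)) B
        * (worth I i j - mean_worth (worth I) S j (level (Suc k)) A 0) else 0)" for j
  define x where "x j = z j + level k * d j" for j
  have P: "0 \<le> miss_prob S j (level k) Q * miss_prob S j (level (Suc k)) B" for j
    using k miss_prob_bounds[of "level k" S j Q] miss_prob_bounds[of "level (Suc k)" S j B] by simp
  have d: "0 \<le> d j" for j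
    using P[of j] by (auto simp: d_def pruned_def)
  have z0: "0 \<le> z j" if "j < items I" for j
    using mixed_nonneg[OF k _ that, of A Q B S] ok by (auto simp: z_def ok_def)
  have zx: "z j \<le> x j" for j using d[of j] by (simp add: x_def)
  have "miss_prob S j (level k) Q * miss_prob S j (level (Suc k)) B * level k
        * (worth I i j - mean_worth (worth I) S j (level (Suc k)) A 0) \<le> 0"
    if "worth I i j < mean_worth (worth I) S j (level (Suc k)) A 0" for j
    using that P[of j] by (intro mult_nonneg_nonpos) auto
  then have old: "mixed k A (i # Q) B S j \<le> x j" for j
    unfolding mixed_Cons x_def z_def d_def pruned_def by auto
  have kept: "mixed k (A @ [i]) Q B (S(i := pruned k A S i)) j = z j + level (Suc k) * d j" for j
    unfolding mixed_kept[OF i'] z_def d_def by auto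
  have keep: "measure_pmf.expectation (return_pmf (keep k i (A, B, S, c))) ?f
      = (\<Sum>j<items I. u' j * (z j + level (Suc k) * d j)) - g * 2 ^ c"
    by (simp add: keep_def kept)
  have u1: "1 \<le> u' j" for j
    using u[of j] alpha L_pos unfolding u' by (simp add: add_increasing2)
  have fin: "X \<subseteq> {..<items I}" using sap_instanceD(3)[OF inst i] X by auto
  have split: "(\<Sum>j<items I. u' j * y j) = (\<Sum>j<items I. u j * y j) + \<alpha> / L * (\<Sum>j\<in>X. y j)" for y
  proof -
    have "(\<Sum>j<items I. of_bool (j \<in> X) * y j) = (\<Sum>j\<in>X. y j)"
      using fin by (subst sum.mono_neutral_cong_right[of "{..<items I}" X]) auto
    moreover have "(\<Sum>j<items I. \<alpha> / L * (of_bool (j \<in> X) * y j))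
        = \<alpha> / L * (\<Sum>j<items I. of_bool (j \<in> X) * y j)"
      by (rule sum_distrib_left[symmetric])
    ultimately show ?thesis
      unfolding u' by (simp only: distrib_right sum.distrib mult.assoc)
  qed
  have uold: "(\<Sum>j<items I. u j * mixed k A (i # Q) B S j) \<le> (\<Sum>j<items I. u j * x j)"
    by (intro sum_mono mult_left_mono old) (use u in \<open>auto intro: order_trans[OF zero_le_one]\<close>)
  show ?thesis
  proof (cases "c < cap")
    \<comment> \<open>The cap is reached and the bin is certainly kept. The value does not fall, and
      the missed gain of at most \<open>\<alpha> / L * V\<close> is covered by
      \<open>h * 2 ^ c\<close>, since \<open>cap \<le> c\<close>.\<close>
    case False
    have "\<alpha> / L * (\<Sum>j\<in>X. worth I i j) \<le> \<alpha> / L * V"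
      using X alpha L_pos by (intro mult_left_mono) auto
    also have "\<dots> \<le> h * 2 ^ c"
      using h False by (meson linorder_not_less mult_left_mono one_le_numeral order_trans power_increasing)
    finally have a: "\<alpha> / L * (\<Sum>j\<in>X. worth I i j) \<le> h * 2 ^ c" .
    have xs: "x j \<le> z j + level (Suc k) * d j" for j
      using d[of j] unfolding x_def level_def by (auto intro!: mult_right_mono divide_right_mono)
    have x0: "0 \<le> x j" if "j < items I" for j using z0[OF that] zx[of j] by simp
    have "(\<Sum>j<items I. u j * x j) \<le> (\<Sum>j<items I. u' j * x j)"
      using x0 alpha by (intro sum_mono mult_right_mono) (auto simp: u')
    also have "\<dots> \<le> (\<Sum>j<items I. u' j * (z j + level (Suc k) * d j))"
      by (intro sum_mono mult_left_mono xs) (use u1 in \<open>auto intro: order_trans[OF zero_le_one]\<close>)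
    finally have b: "(\<Sum>j<items I. u j * x j) \<le> \<dots>" .
    have "g * 2 ^ c \<le> g * (1 + 1 / Suc k) * 2 ^ c"
      using \<open>0 \<le> g\<close> by (simp add: distrib_left distrib_right)
    then have "?b \<le> measure_pmf.expectation (return_pmf (keep k i (A, B, S, c))) ?f"
      unfolding keep using a b uold by (simp add: distrib_right)
    moreover have "bin_step k i Q (A, B, S, c) = return_pmf (keep k i (A, B, S, c))"
      using False by (simp add: bin_step_def)
    ultimately show ?thesis by simp
  next
    case True
    define r where "r = measure_pmf.expectation (refresh k i Q (A, B, S, c)) ?f"
    define q where "q = (\<Sum>j<items I. u' j * (z j + level (Suc k) * d j)) - g * 2 ^ c"
    have fin': "finite (set_pmf (refresh k i Q (A, B, S, c)))"
      by (rule refresh_support(1)[OF ok True])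
    have "measure_pmf.expectation (bin_step k i Q (A, B, S, c)) ?f
      = (\<Sum>y<Suc k. measure_pmf.expectation (if y = 0 \<and> c < cap
          then refresh k i Q (A, B, S, c) else return_pmf (keep k i (A, B, S, c))) ?f) / Suc k"
      unfolding bin_step_def using fin' by (subst expectation_bind_uniform) auto
    also have "\<dots> = (r + real k * q) / Suc k"
      unfolding sum.lessThan_Suc_shift using True by (simp add: r_def q_def keep_def kept)
    finally have E: "measure_pmf.expectation (bin_step k i Q (A, B, S, c)) ?f = (r + real k * q) / Suc k" .
    have r: "(\<Sum>j<items I. u' j * z j) + level (Suc k) * (\<alpha> * (\<Sum>j\<in>X. gain k A Q B S i j)) - g * 2 ^ Suc c \<le> r"
      unfolding r_def z_def by (rule refresh_expectation[OF ok True k u1 X(1)])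
    have q: "q = (\<Sum>j<items I. u' j * z j) + level (Suc k) * (\<Sum>j<items I. u' j * d j) - g * 2 ^ c"
      unfolding q_def by (simp add: distrib_left sum.distrib sum_distrib_left mult_ac)
    have lv: "level (Suc k) = Suc k / L" "level k = k / L" by (auto simp: level_def)
    \<comment> \<open>With \<open>s = k + 1\<close> and \<open>l = L\<close> this mixes a refresh of
      weight \<open>1 / s\<close> with a keep of weight \<open>(s - 1) / s\<close>. The growth of
      the activation probability cancels against the survival probability, and \<open>2 ^ c\<close>
      acquires the factor \<open>1 + 1 / s\<close>.\<close>
    have identity: "Z + (s - 1) / l * D + \<alpha> / l * G - g * (1 + 1 / s) * 2 ^ c
        = (Z + s / l * (\<alpha> * G) - g * 2 ^ Suc c + (s - 1) * (Z + s / l * D - g * 2 ^ c)) / s"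
      if "0 < l" "0 < s" for l s Z D G :: real
      using that by (simp add: field_simps)
    have "(\<Sum>j<items I. u' j * x j) = (\<Sum>j<items I. u' j * z j) + level k * (\<Sum>j<items I. u' j * d j)"
      unfolding x_def by (simp add: distrib_left sum.distrib sum_distrib_left mult_ac)
    then have "(\<Sum>j<items I. u' j * x j) + \<alpha> / L * (\<Sum>j\<in>X. gain k A Q B S i j) - g * (1 + 1 / Suc k) * 2 ^ c
      = ((\<Sum>j<items I. u' j * z j) + level (Suc k) * (\<alpha> * (\<Sum>j\<in>X. gain k A Q B S i j)) - g * 2 ^ Suc c
         + real k * q) / Suc k"
      unfolding q lv using identity[of "real L" "real (Suc k)"] L_pos by simp
    also have "\<dots> \<le> (r + real k * q) / Suc k"
      using r by (intro divide_right_mono) auto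
    finally have main: "(\<Sum>j<items I. u' j * x j) + \<alpha> / L * (\<Sum>j\<in>X. gain k A Q B S i j)
        - g * (1 + 1 / Suc k) * 2 ^ c \<le> measure_pmf.expectation (bin_step k i Q (A, B, S, c)) ?f"
      unfolding E .
    have "(\<Sum>j\<in>X. worth I i j) \<le> (\<Sum>j\<in>X. x j + gain k A Q B S i j)"
    proof (rule sum_mono)
      fix j
      show "worth I i j \<le> x j + gain k A Q B S i j"
        using zx[of j] by (auto simp: gain_def z_def)
    qed
    then have "\<alpha> / L * (\<Sum>j\<in>X. worth I i j) \<le> \<alpha> / L * ((\<Sum>j\<in>X. x j) + (\<Sum>j\<in>X. gain k A Q B S i j))"
      using alpha L_pos by (intro mult_left_mono) (auto simp: sum.distrib)
    moreover have hc: "0 \<le> h * 2 ^ c" using h(2) by simp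
    ultimately have "?b \<le> (\<Sum>j<items I. u' j * x j) + \<alpha> / L * (\<Sum>j\<in>X. gain k A Q B S i j)
        - g * (1 + 1 / Suc k) * 2 ^ c"
      unfolding split using uold hc by (simp add: distrib_left distrib_right)
    with main show ?thesis by linarith
  qed
qed


section \<open>Drift over whole rounds and the cost of the cap\<close>

definition total :: "nat \<Rightarrow> nat list \<Rightarrow> (nat \<Rightarrow> nat set) \<Rightarrow> real" where
  "total k R S = (\<Sum>j<items I. mean_worth (worth I) S j (level k) R 0)"

text \<open>The bound on the number of refreshments is enforced through an exponential moment: the
  process loses at most \<open>\<alpha> / L * opt I\<close> in each step after the bound has been reached.\<close>

definition penalty :: "nat \<Rightarrow> real \<Rightarrow> nat \<Rightarrow> real" where
  "penalty k g r = (1 + 1 / Suc k) ^ r * (g + real r * (\<alpha> / L * opt I / 2 ^ cap))"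

lemma opt_nonneg: "0 \<le> opt I"
  by (metis inst opt_attained solution_worth_nonneg)

text \<open>\<open>penalty\<close> dominates the recursion that multiplies by
  \<open>1 + 1 / Suc k\<close> and adds a fixed loss for each bin, because it applies the full power
  to every summand.\<close>

lemma penalty_Suc:
  "penalty k g r * (1 + 1 / Suc k) + \<alpha> / L * opt I / 2 ^ cap \<le> penalty k g (Suc r)"
proof -
  define h where "h = \<alpha> / L * opt I / 2 ^ cap"
  have "0 \<le> h" using alpha opt_nonneg by (simp add: h_def)
  moreover have "1 \<le> (1 + 1 / real (Suc k)) ^ Suc r" by (rule one_le_power) auto
  ultimately have "h \<le> (1 + 1 / real (Suc k)) ^ Suc r * h" by (simp add: mult_right_mono mult_le_cancel_right1)
  moreover have "w * (g + real r * h) * f + h \<le> f * w * (g + real (Suc r) * h)" if "h \<le> f * w * h" for w f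
    using that by (simp add: algebra_simps)
  ultimately show ?thesis unfolding penalty_def h_def[symmetric] power_Suc by blast
qed

lemma penalty_nonneg: "0 \<le> g \<Longrightarrow> 0 \<le> penalty k g r"
  using alpha opt_nonneg by (simp add: penalty_def)

lemma feasible_bin_le_opt:
  assumes "feasible_solution I Opt" "solution_worth I Opt = opt I" "i < bins I"
  shows "(\<Sum>j\<in>Opt i. worth I i j) \<le> opt I"
proof -
  have "0 \<le> (\<Sum>j\<in>Opt i. worth I i j)" if "i < bins I" for i
  proof (rule sum_nonneg)
    fix j assume "j \<in> Opt i"
    moreover have "Opt i \<subseteq> {..<items I}"
      using assms(1) that sap_instanceD(3)[OF inst that] by (auto simp: feasible_solution_def)
    ultimately show "0 \<le> worth I i j" using sap_instanceD(5)[OF inst that] by auto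
  qed
  then show ?thesis
    unfolding assms(2)[symmetric] solution_worth_def using assms(3)
    by (intro member_le_sum) auto
qed

text \<open>Iterating the bin step raises the weight of an item when its bin in \<open>Opt\<close>
  is processed. As the sets of \<open>Opt\<close> are disjoint, this happens at most once per item,
  so no weight exceeds \<open>1 + \<alpha> / L\<close>.\<close>

lemma pass_expectation:
  assumes Opt: "feasible_solution I Opt" "solution_worth I Opt = opt I"
    and k: "Suc k \<le> L" and "0 \<le> g" and "ok Q (A, B, S, c)"
  defines "u \<equiv> \<lambda>Q j. 1 + \<alpha> / L * of_bool (\<exists>i\<in>{..<bins I} - set Q. j \<in> Opt i)"
  shows "(\<Sum>j<items I. u Q j * mixed k A Q B S j) + \<alpha> / L * (\<Sum>i\<in>set Q. \<Sum>j\<in>Opt i. worth I i j)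
       - penalty k g (length Q) * 2 ^ c
    \<le> measure_pmf.expectation (pass k Q (A, B, S, c))
        (\<lambda>(A, B, S, c). (\<Sum>j<items I. u [] j * mixed k A [] B S j) - g * 2 ^ c)"
  using \<open>ok Q (A, B, S, c)\<close>
proof (induction Q arbitrary: A B S c)
  case Nil
  then show ?case by (simp add: penalty_def)
next
  case (Cons i Q)
  have i: "i < bins I" "i \<notin> set Q" using Cons.prems by (auto simp: ok_def)
  define C where "C = \<alpha> / L * (\<Sum>i\<in>set Q. \<Sum>j\<in>Opt i. worth I i j)"
  define f where "f = (\<lambda>(A, B, S, c). (\<Sum>j<items I. u Q j * mixed k A Q B S j)
    - penalty k g (length Q) * 2 ^ c)"
  have u': "u Q j = u (i # Q) j + \<alpha> / L * of_bool (j \<in> Opt i)" for j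
  proof -
    have "Opt i' \<inter> Opt i = {}" if "i' < bins I" "i' \<noteq> i" for i'
      using Opt(1) that i(1) unfolding feasible_solution_def by blast
    then have "of_bool (\<exists>i\<in>{..<bins I} - set Q. j \<in> Opt i)
      = (of_bool (\<exists>i\<in>{..<bins I} - set (i # Q). j \<in> Opt i) + of_bool (j \<in> Opt i) :: real)"
      using i by (cases "j \<in> Opt i") fastforce+
    then show ?thesis unfolding u_def by (simp add: distrib_left)
  qed
  have u1: "1 \<le> u (i # Q) j" for j using alpha by (simp add: u_def)
  have Oi: "Opt i \<in> feas I i" using Opt i by (auto simp: feasible_solution_def)
  have "(\<Sum>j<items I. u (i # Q) j * mixed k A (i # Q) B S j) + \<alpha> / L * (\<Sum>j\<in>Opt i. worth I i j)
      - (penalty k g (length Q) * (1 + 1 / Suc k) + \<alpha> / L * opt I / 2 ^ cap) * 2 ^ c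
      \<le> measure_pmf.expectation (bin_step k i Q (A, B, S, c)) f"
    unfolding f_def
    by (rule bin_step_expectation[OF Cons.prems k u1 Oi feasible_bin_le_opt[OF Opt i(1)] u'
          penalty_nonneg[OF \<open>0 \<le> g\<close>]]) (use alpha opt_nonneg in auto)
  moreover have "(penalty k g (length Q) * (1 + 1 / Suc k) + \<alpha> / L * opt I / 2 ^ cap) * 2 ^ c
      \<le> penalty k g (length (i # Q)) * 2 ^ c"
    using penalty_Suc by (intro mult_right_mono) auto
  moreover have "\<alpha> / L * (\<Sum>i\<in>set (i # Q). \<Sum>j\<in>Opt i. worth I i j)
      = \<alpha> / L * (\<Sum>j\<in>Opt i. worth I i j) + C"
    using i by (simp add: C_def distrib_left)
  moreover have "measure_pmf.expectation (bin_step k i Q (A, B, S, c)) (\<lambda>x. f x + C)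
      = measure_pmf.expectation (bin_step k i Q (A, B, S, c)) f + C"
    using bin_step_support(1)[OF Cons.prems] by (simp add: integrable_measure_pmf_finite)
  ultimately have "(\<Sum>j<items I. u (i # Q) j * mixed k A (i # Q) B S j)
      + \<alpha> / L * (\<Sum>i\<in>set (i # Q). \<Sum>j\<in>Opt i. worth I i j) - penalty k g (length (i # Q)) * 2 ^ c
      \<le> measure_pmf.expectation (bin_step k i Q (A, B, S, c)) (\<lambda>x. f x + C)"
    by linarith
  then show ?case unfolding pass.simps
  proof (rule expectation_bind_ge[rotated 3])
    show "finite (set_pmf (bin_step k i Q (A, B, S, c)))"
      by (rule bin_step_support(1)[OF Cons.prems])
    fix st assume "st \<in> set_pmf (bin_step k i Q (A, B, S, c))"
    then have ok: "ok Q st" by (rule bin_step_support(2)[OF Cons.prems])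
    then show "finite (set_pmf (pass k Q st))" using pass_support by blast
    show "f st + C \<le> measure_pmf.expectation (pass k Q st)
      (\<lambda>(A, B, S, c). (\<Sum>j<items I. u [] j * mixed k A [] B S j) - g * 2 ^ c)"
    proof (cases st)
      case (fields A' B' S' c')
      show ?thesis using Cons.IH[of A' B' S' c'] ok unfolding fields by (simp add: f_def C_def)
    qed
  qed
qed

text \<open>All weights are 1 at the start and at most \<open>1 + \<alpha> / L\<close> at the end,
  so the factor falls on the new value: an implicit Euler step for the equation X' = \<alpha> (OPT -
  X).\<close>

lemma round_expectation:
  assumes k: "Suc k \<le> L" and "0 \<le> g" and ok: "ok [] (R, [], S, c)"
  shows "total k R S + \<alpha> / L * opt I - penalty k g (bins I) * 2 ^ c
    \<le> measure_pmf.expectation (round k (R, S, c))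
        (\<lambda>(R, S, c). (1 + \<alpha> / L) * total (Suc k) R S - g * 2 ^ c)"
proof -
  obtain Opt where Opt: "feasible_solution I Opt" "solution_worth I Opt = opt I"
    using opt_attained[OF inst] .
  let ?u = "\<lambda>Q j. 1 + \<alpha> / L * of_bool (\<exists>i\<in>{..<bins I} - set Q. j \<in> Opt i)"
  have ok': "ok R ([], [], S, c)" and R: "set R = {..<bins I}" "distinct R"
    using ok by (auto simp: ok_def)
  have "length R = bins I" using R by (metis card_lessThan distinct_card)
  then have "total k R S + \<alpha> / L * opt I - penalty k g (bins I) * 2 ^ c
      = (\<Sum>j<items I. ?u R j * mixed k [] R [] S j)
        + \<alpha> / L * (\<Sum>i\<in>set R. \<Sum>j\<in>Opt i. worth I i j) - penalty k g (length R) * 2 ^ c"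
    using R Opt(2) by (simp add: total_def mixed_def solution_worth_def)
  also have "\<dots> \<le> measure_pmf.expectation (pass k R ([], [], S, c))
        (\<lambda>(A, B, S, c). (\<Sum>j<items I. ?u [] j * mixed k A [] B S j) - g * 2 ^ c)"
    by (rule pass_expectation[OF Opt k \<open>0 \<le> g\<close> ok'])
  also have "\<dots> \<le> measure_pmf.expectation (pass k R ([], [], S, c))
        (\<lambda>(A, B, S, c). (1 + \<alpha> / L) * total (Suc k) (A @ B) S - g * 2 ^ c)"
  proof (rule expectation_mono_finite)
    show "finite (set_pmf (pass k R ([], [], S, c)))" using pass_support[OF ok'] by blast
    fix st assume "st \<in> set_pmf (pass k R ([], [], S, c))"
    then have st: "ok [] st" using pass_support[OF ok'] by blast
    show "(case st of (A, B, S, c) \<Rightarrow> (\<Sum>j<items I. ?u [] j * mixed k A [] B S j) - g * 2 ^ c)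
      \<le> (case st of (A, B, S, c) \<Rightarrow> (1 + \<alpha> / L) * total (Suc k) (A @ B) S - g * 2 ^ c)"
    proof (cases st)
      case (fields A B S c)
      have "(\<Sum>j<items I. ?u [] j * mixed k A [] B S j) \<le> (\<Sum>j<items I. (1 + \<alpha> / L) * mixed k A [] B S j)"
        using mixed_nonneg[OF k, of A "[]" B] st alpha
        by (intro sum_mono mult_right_mono) (auto simp: ok_def fields)
      then show ?thesis unfolding fields by (simp add: total_def mixed_def sum_distrib_left)
    qed
  qed
  also have "\<dots> = measure_pmf.expectation (round k (R, S, c))
        (\<lambda>(R, S, c). (1 + \<alpha> / L) * total (Suc k) R S - g * 2 ^ c)"
    unfolding round_def prod.case by (simp add: case_prod_unfold)
  finally show ?thesis .
qed

text \<open>Multiplication by \<open>\<beta> ^ k\<close> turns the recursion into a submartingale.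
  \<open>G\<close> is solved backwards from \<open>G L = 0\<close>: the factors (k+2)/(k+1), one per
  bin, telescope to (L+1)/(k+1), and each of the \<open>L - k\<close> remaining rounds adds the loss
  of its \<open>bins I\<close> steps, with \<open>\<beta> ^ k\<close> enlarged to
  \<open>\<beta> ^ L\<close>.\<close>

lemma rounds_potential:
  defines "\<beta> \<equiv> 1 + \<alpha> / L"
  defines "G \<equiv> \<lambda>k. (real (L + 1) / Suc k) ^ bins I * ((real L - k) * (\<beta> ^ L * (bins I * (\<alpha> / L * opt I / 2 ^ cap))))"
  assumes "k \<le> L"
  shows "- opt I - G 0 \<le> measure_pmf.expectation (rounds k)
    (\<lambda>(R, S, c). \<beta> ^ k * (total k R S - opt I) - G k * 2 ^ c)"
  using \<open>k \<le> L\<close>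
proof (induction k)
  case 0
  then show ?case by (simp add: total_def)
next
  case (Suc k)
  define h where "h = bins I * (\<alpha> / L * opt I / 2 ^ cap)"
  have h: "0 \<le> h" using alpha opt_nonneg by (simp add: h_def)
  have \<beta>: "1 \<le> \<beta>" using alpha by (simp add: \<beta>_def)
  have G0: "0 \<le> G (Suc k)"
    unfolding G_def h_def[symmetric] using Suc.prems h \<beta> by (auto intro!: mult_nonneg_nonneg)
  have "(1 + 1 / Suc k) ^ bins I * (G (Suc k) + \<beta> ^ k * h) \<le> G k"
  proof -
    have e: "1 + 1 / real (Suc k) = real (k + 2) / Suc k" by (simp add: field_simps)
    have "(real (k + 2) / Suc k) ^ bins I * (\<beta> ^ k * h) \<le> (real (L + 1) / Suc k) ^ bins I * (\<beta> ^ L * h)"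
      using Suc.prems h \<beta> by (intro mult_mono power_mono divide_right_mono power_increasing) auto
    moreover have "(real (k + 2) / Suc k) ^ bins I * G (Suc k)
        = (real (L + 1) / Suc k) ^ bins I * ((real L - Suc k) * (\<beta> ^ L * h))"
      unfolding G_def h_def[symmetric]
      by (simp add: mult.assoc[symmetric] power_mult_distrib[symmetric] add.commute)
    moreover have "G k = (real (L + 1) / Suc k) ^ bins I * ((real L - Suc k) * (\<beta> ^ L * h))
        + (real (L + 1) / Suc k) ^ bins I * (\<beta> ^ L * h)"
      unfolding G_def h_def[symmetric] by (simp add: algebra_simps)
    ultimately show ?thesis unfolding e by (simp add: distrib_left)
  qed
  moreover have "\<beta> ^ k * penalty k (G (Suc k) / \<beta> ^ k) (bins I)
      = (1 + 1 / Suc k) ^ bins I * (G (Suc k) + \<beta> ^ k * h)"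
    using \<beta> unfolding penalty_def h_def by (simp add: field_simps)
  ultimately have pen: "\<beta> ^ k * penalty k (G (Suc k) / \<beta> ^ k) (bins I) \<le> G k" by simp
  show ?case
    unfolding rounds.simps
  proof (rule expectation_bind_ge)
    show "- opt I - G 0 \<le> measure_pmf.expectation (rounds k)
        (\<lambda>(R, S, c). \<beta> ^ k * (total k R S - opt I) - G k * 2 ^ c)"
      using Suc by simp
    show "finite (set_pmf (rounds k))" using rounds_support by blast
    fix st assume st: "st \<in> set_pmf (rounds k)"
    obtain R S c where [simp]: "st = (R, S, c)" by (cases st)
    have ok: "ok [] (R, [], S, c)" using st rounds_support by fastforce
    show fin: "finite (set_pmf (round k st))" using round_support(1)[OF ok] by simp
    have "\<beta> ^ k * (total k R S - opt I) - G k * 2 ^ c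
        \<le> \<beta> ^ k * (total k R S - opt I) - \<beta> ^ k * penalty k (G (Suc k) / \<beta> ^ k) (bins I) * 2 ^ c"
      using pen by simp
    also have "\<dots> = \<beta> ^ k * (total k R S + \<alpha> / L * opt I
        - penalty k (G (Suc k) / \<beta> ^ k) (bins I) * 2 ^ c) - \<beta> ^ Suc k * opt I"
      by (simp add: \<beta>_def algebra_simps)
    also have "\<dots> \<le> \<beta> ^ k * measure_pmf.expectation (round k (R, S, c))
        (\<lambda>(R, S, c). \<beta> * total (Suc k) R S - G (Suc k) / \<beta> ^ k * 2 ^ c) - \<beta> ^ Suc k * opt I"
      using round_expectation[OF Suc.prems _ ok, of "G (Suc k) / \<beta> ^ k"] G0 \<beta>
      by (auto simp: \<beta>_def[symmetric] intro!: mult_left_mono)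
    also have "\<dots> = measure_pmf.expectation (round k (R, S, c))
        (\<lambda>x. \<beta> ^ k * (case x of (R, S, c) \<Rightarrow> \<beta> * total (Suc k) R S - G (Suc k) / \<beta> ^ k * 2 ^ c)
          - \<beta> ^ Suc k * opt I)"
      using fin by (simp add: integrable_measure_pmf_finite)
    also have "\<dots> = measure_pmf.expectation (round k (R, S, c))
        (\<lambda>(R, S, c). \<beta> ^ Suc k * (total (Suc k) R S - opt I) - G (Suc k) * 2 ^ c)"
      using \<beta> by (intro Bochner_Integration.integral_cong) (auto simp: field_simps)
    finally show "(case st of (R, S, c) \<Rightarrow> \<beta> ^ k * (total k R S - opt I) - G k * 2 ^ c)
      \<le> measure_pmf.expectation (round k st)
          (\<lambda>(R, S, c). \<beta> ^ Suc k * (total (Suc k) R S - opt I) - G (Suc k) * 2 ^ c)"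
      by simp
  qed
qed

text \<open>The left side is the shortfall as a fraction of the optimum: the power is left by the
  recursion, \<open>\<alpha> / L\<close> is the cost of the cap. The bound x - x^2 \<le> ln (1 + x)
  contributes 2/L to the error and \<alpha> \<le> e (1 - e^(-\<alpha>)) contributes 3/L. The error
  must be a multiple of \<open>1 - exp (- \<alpha>)\<close>, since the guarantee is relative even
  for small \<open>\<alpha>\<close>.\<close>

lemma discretization_loss:
  shows "(1 / (1 + \<alpha> / L)) ^ L + \<alpha> / L \<le> exp (- \<alpha>) + 5 / L * (1 - exp (- \<alpha>))"
proof -
  define x where "x = \<alpha> / L"
  have x: "0 < x" "x \<le> 1" and Lx: "L * x = \<alpha>"
    using alpha L_pos by (auto simp: x_def field_simps)
  have "x - x\<^sup>2 \<le> ln (1 + x)" using x by (intro ln_one_plus_pos_lower_bound) auto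
  then have "L * (x - x\<^sup>2) \<le> L * ln (1 + x)" by (intro mult_left_mono) auto
  moreover have "L * (x - x\<^sup>2) = \<alpha> - \<alpha> * x"
    using Lx by (simp add: algebra_simps power2_eq_square)
  ultimately have "exp (- (L * ln (1 + x))) \<le> exp (- \<alpha>) * exp (\<alpha> * x)"
    unfolding exp_add[symmetric] by simp
  moreover have "exp (- (L * ln (1 + x))) = (1 / (1 + x)) ^ L"
    using x by (simp add: exp_minus exp_of_nat_mult power_divide inverse_eq_divide)
  moreover have "exp (\<alpha> * x) \<le> 1 + 2 * (\<alpha> * x)"
  proof -
    have "0 \<le> \<alpha> * x" "\<alpha> * x \<le> 1" using x alpha by (auto intro: mult_le_one)
    then have "exp (\<alpha> * x) \<le> 1 + \<alpha> * x + (\<alpha> * x)\<^sup>2" "(\<alpha> * x)\<^sup>2 \<le> \<alpha> * x"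
      using exp_bound[of "\<alpha> * x"] by (auto simp: power2_eq_square mult_left_le)
    then show ?thesis by simp
  qed
  then have "exp (- \<alpha>) * exp (\<alpha> * x) \<le> exp (- \<alpha>) * (1 + 2 * (\<alpha> * x))"
    by (intro mult_left_mono) auto
  ultimately have "(1 / (1 + x)) ^ L \<le> exp (- \<alpha>) + 2 * x * (exp (- \<alpha>) * \<alpha>)"
    by (simp add: algebra_simps)
  moreover have e: "exp (- \<alpha>) * \<alpha> \<le> 1 - exp (- \<alpha>)"
  proof -
    have "exp (- \<alpha>) * (1 + \<alpha>) \<le> exp (- \<alpha>) * exp \<alpha>" by (intro mult_left_mono) auto
    then show ?thesis by (simp add: algebra_simps exp_minus)
  qed
  moreover have "2 * x * (exp (- \<alpha>) * \<alpha>) \<le> 2 / L * (1 - exp (- \<alpha>))"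
    using e alpha L_pos by (intro mult_mono) (auto simp: x_def divide_right_mono)
  moreover have "x \<le> 3 / L * (1 - exp (- \<alpha>))"
  proof -
    have "\<alpha> = exp \<alpha> * (exp (- \<alpha>) * \<alpha>)" by (simp add: exp_minus)
    also have "\<dots> \<le> exp 1 * (1 - exp (- \<alpha>))" using e alpha by (intro mult_mono) auto
    also have "\<dots> \<le> 3 * (1 - exp (- \<alpha>))" using exp_le alpha by (intro mult_right_mono) auto
    finally show ?thesis using L_pos by (simp add: x_def divide_right_mono)
  qed
  moreover have "5 / L * w = 2 / L * w + 3 / L * w" for w :: real by (simp add: add_divide_distrib[symmetric])
  ultimately show ?thesis unfolding x_def[symmetric] by linarith
qed

lemma rounds_expectation:
  assumes cap: "cap = bins I * b" "2 * (L + 1) \<le> 2 ^ b" "2 * (L + 1) * L \<le> 2 ^ b"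
  shows "(1 - 5 / L) * (1 - exp (- \<alpha>)) * opt I
    \<le> measure_pmf.expectation (rounds L) (\<lambda>(R, S, c). total L R S)"
proof -
  define \<beta> where "\<beta> = 1 + \<alpha> / L"
  define E where "E = measure_pmf.expectation (rounds L) (\<lambda>(R, S, c). total L R S)"
  define D where "D = real (L + 1) ^ bins I * (bins I * (\<alpha> * opt I / 2 ^ cap))"
  have \<beta>: "1 \<le> \<beta>" using alpha by (simp add: \<beta>_def)
  have "- opt I - real (L + 1) ^ bins I * (real L * (\<beta> ^ L * (bins I * (\<alpha> / L * opt I / 2 ^ cap))))
    \<le> measure_pmf.expectation (rounds L) (\<lambda>(R, S, c). \<beta> ^ L * (total L R S - opt I))"
    using rounds_potential[of L] by (simp add: \<beta>_def)
  also have "\<dots> = measure_pmf.expectation (rounds L) (\<lambda>x. \<beta> ^ L * ((case x of (R, S, c) \<Rightarrow> total L R S) - opt I))"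
    by (intro Bochner_Integration.integral_cong) auto
  also have "\<dots> = \<beta> ^ L * (E - opt I)"
    using rounds_support by (simp add: integrable_measure_pmf_finite E_def)
  also have "real (L + 1) ^ bins I * (real L * (\<beta> ^ L * (bins I * (\<alpha> / L * opt I / 2 ^ cap)))) = \<beta> ^ L * D"
    using L_pos by (simp add: D_def)
  finally have "- (opt I / \<beta> ^ L) - D \<le> E - opt I"
    using \<beta> by (simp add: field_simps)
  moreover have "D \<le> \<alpha> / L * opt I"
  proof -
    have m: "0 < bins I" using sap_instanceD(1)[OF inst] .
    \<comment> \<open>With \<open>bins I\<close> below \<open>2 ^ bins I\<close>, the product fits
      into \<open>bins I\<close> factors \<open>2 * (L + 1)\<close>, one of which also absorbs the
      extra \<open>L\<close>. This explains the condition on \<open>2 * (L + 1) * L\<close>.\<close>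
    have "L * (bins I * (L + 1) ^ bins I) \<le> L * (2 ^ bins I * (L + 1) ^ bins I)"
      by (intro mult_le_mono) (auto simp: less_imp_le[OF less_exp])
    also have "\<dots> = (2 * (L + 1)) ^ (bins I - 1) * (2 * (L + 1) * L)"
      using m by (cases "bins I") (simp_all only: power_mult_distrib power_Suc diff_Suc_1 mult_ac)
    also have "\<dots> \<le> (2 ^ b) ^ (bins I - 1) * 2 ^ b"
      using cap by (intro mult_le_mono power_mono) auto
    also have "\<dots> = 2 ^ cap"
      using m unfolding cap(1) by (cases "bins I") (auto simp: power_mult[symmetric] power_add[symmetric] algebra_simps)
    finally have "real (L * (bins I * (L + 1) ^ bins I)) \<le> 2 ^ cap"
      by (metis of_nat_le_iff of_nat_numeral of_nat_power)
    then have "real (bins I * (L + 1) ^ bins I) / 2 ^ cap \<le> 1 / L"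
      using L_pos by (simp add: field_simps)
    then have "real (bins I * (L + 1) ^ bins I) / 2 ^ cap * (\<alpha> * opt I) \<le> 1 / L * (\<alpha> * opt I)"
      using alpha opt_nonneg by (intro mult_right_mono) auto
    then show ?thesis by (simp add: D_def mult_ac)
  qed
  moreover have "((1 / \<beta>) ^ L + \<alpha> / L) * opt I \<le> (exp (- \<alpha>) + 5 / L * (1 - exp (- \<alpha>))) * opt I"
    using discretization_loss opt_nonneg unfolding \<beta>_def by (intro mult_right_mono) auto
  moreover have "(1 / \<beta>) ^ L * opt I = opt I / \<beta> ^ L" by (simp add: power_divide)
  ultimately have "opt I - (exp (- \<alpha>) + 5 / L * (1 - exp (- \<alpha>))) * opt I \<le> E"
    by (simp add: distrib_right)
  then show ?thesis by (simp add: E_def algebra_simps)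
qed

end

section \<open>Reasoning about programs\<close>

definition steps :: "nat \<Rightarrow> packer \<Rightarrow> com \<Rightarrow> memory \<Rightarrow> memory \<Rightarrow> nat \<Rightarrow> bool" where
  "steps n A P s s' c \<longleftrightarrow> (\<exists>t\<le>c. exec n A P s = return_spmf (s', t))"

primrec straight :: "com \<Rightarrow> bool" where
  "straight Skip \<longleftrightarrow> True"
| "straight (NStore a e f) \<longleftrightarrow> True"
| "straight (RStore a e f) \<longleftrightarrow> True"
| "straight (Random a e f) \<longleftrightarrow> False"
| "straight (CallPack e a b) \<longleftrightarrow> False"
| "straight (Seq P Q) \<longleftrightarrow> straight P \<and> straight Q"
| "straight (Cond b P Q) \<longleftrightarrow> straight P \<and> straight Q"
| "straight (While b P) \<longleftrightarrow> False"

text \<open>The values on programs that are not straight-line are irrelevant.\<close>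

primrec eff :: "com \<Rightarrow> memory \<Rightarrow> memory" where
  "eff Skip s = s"
| "eff (NStore a e f) s = write_nat a (nval e s) (nval f s) s"
| "eff (RStore a e f) s = write_real a (nval e s) (rval f s) s"
| "eff (Random a e f) s = s"
| "eff (CallPack e a b) s = s"
| "eff (Seq P Q) s = eff Q (eff P s)"
| "eff (Cond b P Q) s = (if bval b s then eff P s else eff Q s)"
| "eff (While b P) s = s"

text \<open>A conditional is charged for both branches, which keeps the bound a plain sum.\<close>

primrec wc :: "com \<Rightarrow> nat" where
  "wc Skip = 1"
| "wc (NStore a e f) = 1 + ncost e + ncost f"
| "wc (RStore a e f) = 1 + ncost e + rcost f"
| "wc (Random a e f) = 0"
| "wc (CallPack e a b) = 0"
| "wc (Seq P Q) = wc P + wc Q"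
| "wc (Cond b P Q) = 1 + bcost b + (wc P + wc Q)"
| "wc (While b P) = 0"

lemma steps_straight: "straight P \<Longrightarrow> steps n A P s (eff P s) (wc P)"
proof (induction P arbitrary: s)
  case (Seq P Q)
  from Seq.prems have PQ: "straight P" "straight Q" by auto
  obtain t where "t \<le> wc P" "exec n A P s = return_spmf (eff P s, t)"
    using Seq.IH(1)[OF PQ(1)] unfolding steps_def by blast
  moreover obtain t' where "t' \<le> wc Q" "exec n A Q (eff P s) = return_spmf (eff Q (eff P s), t')"
    using Seq.IH(2)[OF PQ(2)] unfolding steps_def by blast
  ultimately show ?case
    by (auto simp: steps_def add_cost_def intro!: exI[of _ "t + t'"])
next
  case (Cond b P Q)
  from Cond.prems have PQ: "straight P" "straight Q" by auto
  obtain t where "t \<le> wc P" "exec n A P s = return_spmf (eff P s, t)"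
    using Cond.IH(1)[OF PQ(1)] unfolding steps_def by blast
  moreover obtain t' where "t' \<le> wc Q" "exec n A Q s = return_spmf (eff Q s, t')"
    using Cond.IH(2)[OF PQ(2)] unfolding steps_def by blast
  ultimately show ?case
    by (auto simp: steps_def add_cost_def intro!: exI[of _ "1 + bcost b + (if bval b s then t else t')"])
qed (auto simp: steps_def)

lemma steps_weaken: "steps n A P s s' c \<Longrightarrow> c \<le> c' \<Longrightarrow> steps n A P s s' c'"
  unfolding steps_def by (meson order_trans)

lemma steps_Seq: "steps n A P s s1 c \<Longrightarrow> steps n A Q s1 s2 c' \<Longrightarrow> steps n A (Seq P Q) s s2 (c + c')"
  unfolding steps_def by (fastforce simp: add_cost_def intro: add_mono)

lemma steps_While_False: "\<not> bval b s \<Longrightarrow> steps n A (While b P) s s (1 + bcost b)"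
  unfolding steps_def exec.simps by (subst loop.simps) auto

lemma steps_While_True:
  assumes "bval b s" "steps n A P s s1 c" "steps n A (While b P) s1 s2 c'"
  shows "steps n A (While b P) s s2 (1 + bcost b + c + c')"
proof -
  obtain t t' where "t \<le> c" "exec n A P s = return_spmf (s1, t)"
    "t' \<le> c'" "loop (bval b) (1 + bcost b) (exec n A P) s1 = return_spmf (s2, t')"
    using assms by (auto simp: steps_def)
  then show ?thesis
    using assms(1) unfolding steps_def exec.simps
    by (subst loop.simps) (auto intro!: exI[of _ "1 + bcost b + t + t'"])
qed

abbreviation var :: "name \<Rightarrow> nexp" where "var x \<equiv> NCell x (Lit 0)"

definition For :: "name \<Rightarrow> name \<Rightarrow> com \<Rightarrow> com" where
  "For x b P = Seq (NStore x (Lit 0) (Lit 0))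
     (While (NLess (var x) (var b)) (Seq P (NStore x (Lit 0) (NAdd (var x) (Lit 1)))))"

text \<open>An iteration costs 6 for the guard and 6 for the increment besides the body; the final 9
  pay for the initialization (3) and the failing guard (6).\<close>

lemma steps_For:
  assumes start: "Inv 0 (write_nat x 0 0 s)"
    and counter: "\<And>i s. i \<le> N \<Longrightarrow> Inv i s \<Longrightarrow> nats s x 0 = i \<and> nats s b 0 = N"
    and step: "\<And>i s. i < N \<Longrightarrow> Inv i s \<Longrightarrow>
      \<exists>s'. steps n A P s s' c \<and> nats s' x 0 = i \<and> Inv (Suc i) (write_nat x 0 (Suc i) s')"
  shows "\<exists>s'. steps n A (For x b P) s s' ((c + 12) * N + 9) \<and> Inv N s'"
proof -
  let ?Q = "Seq P (NStore x (Lit 0) (NAdd (var x) (Lit 1)))"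
  have "\<exists>s'. steps n A (While (NLess (var x) (var b)) ?Q) s s' ((c + 12) * (N - i) + 6) \<and> Inv N s'"
    if "i \<le> N" "Inv i s" for i s
    using that
  proof (induction i arbitrary: s rule: inc_induct)
    case base
    then show ?case
      using counter[of N s] steps_While_False[of "NLess (var x) (var b)" s n A ?Q]
      by (auto intro!: exI[of _ s] elim: steps_weaken)
  next
    case (step i)
    obtain s1 where s1: "steps n A P s s1 c" "nats s1 x 0 = i" "Inv (Suc i) (write_nat x 0 (Suc i) s1)"
      using assms(3) step by blast
    obtain s' where s': "Inv N s'" "steps n A (While (NLess (var x) (var b)) ?Q)
        (write_nat x 0 (Suc i) s1) s' ((c + 12) * (N - Suc i) + 6)"
      using step.IH[OF s1(3)] by blast
    have "steps n A ?Q s (write_nat x 0 (Suc i) s1) (c + 6)"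
      using steps_Seq[OF s1(1) steps_straight[of "NStore x (Lit 0) (NAdd (var x) (Lit 1))" n A s1]] s1(2)
      by (simp add: numeral_eq_Suc)
    then have "steps n A (While (NLess (var x) (var b)) ?Q) s s'
        (1 + bcost (NLess (var x) (var b)) + (c + 6) + ((c + 12) * (N - Suc i) + 6))"
      using s' counter[of i s] step by (intro steps_While_True) auto
    moreover have "1 + bcost (NLess (var x) (var b)) + (c + 6) + ((c + 12) * (N - Suc i) + 6)
        = (c + 12) * (N - i) + 6"
    proof -
      have "N - i = Suc (N - Suc i)" using step by auto
      then show ?thesis by simp
    qed
    ultimately show ?case using s'(1) by metis
  qed
  from this[of 0, OF _ start] obtain s' where
    "steps n A (While (NLess (var x) (var b)) ?Q) (write_nat x 0 0 s) s' ((c + 12) * N + 6)" "Inv N s'"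
    by auto
  moreover have "steps n A (NStore x (Lit 0) (Lit 0)) s (write_nat x 0 0 s) 3"
    using steps_straight[of "NStore x (Lit 0) (Lit 0)" n A s] by (simp add: numeral_eq_Suc)
  ultimately have "steps n A (For x b P) s s' (3 + ((c + 12) * N + 6))"
    unfolding For_def using steps_Seq by blast
  then have "steps n A (For x b P) s s' ((c + 12) * N + 9)" by (rule steps_weaken) simp
  then show ?thesis using \<open>Inv N s'\<close> by blast
qed

lemma steps_For_straight:
  assumes "straight P" "G 0 = write_nat x 0 0 s"
    and "\<And>i. i \<le> N \<Longrightarrow> nats (G i) x 0 = i \<and> nats (G i) b 0 = N"
    and "\<And>i. i < N \<Longrightarrow> nats (eff P (G i)) x 0 = i \<and> write_nat x 0 (Suc i) (eff P (G i)) = G (Suc i)"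
  shows "steps n A (For x b P) s (G N) ((wc P + 12) * N + 9)"
proof -
  have "\<exists>s'. steps n A (For x b P) s s' ((wc P + 12) * N + 9) \<and> s' = G N"
  proof (rule steps_For[where Inv = "\<lambda>i s. s = G i"])
    fix i s assume "i < N" "s = G i"
    then show "\<exists>s'. steps n A P s s' (wc P) \<and> nats s' x 0 = i \<and> write_nat x 0 (Suc i) s' = G (Suc i)"
      using assms(4) steps_straight[OF assms(1)] by blast
  qed (use assms in auto)
  then show ?thesis by blast
qed

text \<open>An execution that is the image of a proper pmf terminates with probability 1. The
  coupling makes \<open>R\<close> hold in every outcome, so that feasibility and time are certain,
  while the value carries over in expectation.\<close>

definition sim ::
  "nat \<Rightarrow> packer \<Rightarrow> com \<Rightarrow> memory \<Rightarrow> 'a pmf \<Rightarrow> (memory \<Rightarrow> nat \<Rightarrow> 'a \<Rightarrow> bool) \<Rightarrow> bool" where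
  "sim n A P s M R \<longleftrightarrow>
     (\<exists>r. exec n A P s = spmf_of_pmf r \<and> rel_pmf (\<lambda>(s', t) a. R s' t a) r M)"

lemma sim_mono: "sim n A P s M R \<Longrightarrow> (\<And>s' t a. R s' t a \<Longrightarrow> R' s' t a) \<Longrightarrow> sim n A P s M R'"
  unfolding sim_def by (auto elim!: pmf.rel_mono_strong)

lemma sim_map: "sim n A P s M (\<lambda>s' t a. R s' t (f a)) \<Longrightarrow> sim n A P s (map_pmf f M) R"
  unfolding sim_def by (auto simp: pmf.rel_map case_prod_unfold)

lemma sim_steps: "steps n A P s s' c \<Longrightarrow> (\<And>t. t \<le> c \<Longrightarrow> R s' t a) \<Longrightarrow> sim n A P s (return_pmf a) R"
proof -
  assume "steps n A P s s' c" and R: "\<And>t. t \<le> c \<Longrightarrow> R s' t a"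
  then obtain t where "t \<le> c" "exec n A P s = spmf_of_pmf (return_pmf (s', t))"
    by (auto simp: steps_def)
  with R show ?thesis unfolding sim_def by (intro exI[of _ "return_pmf (s', t)"]) auto
qed

lemma sim_bind:
  assumes "sim n A P s M R1"
    and "\<And>s' t a. R1 s' t a \<Longrightarrow> sim n A Q s' (N a) (\<lambda>s'' t'. R s'' (t + t'))"
  shows "sim n A (Seq P Q) s (M \<bind> N) R"
proof -
  obtain r where r: "exec n A P s = spmf_of_pmf r" "rel_pmf (\<lambda>(s', t) a. R1 s' t a) r M"
    using assms(1) by (auto simp: sim_def)
  \<comment> \<open>The continuation obtained from \<open>assms(2)\<close> may depend on the coupled
    value \<open>a\<close>. As \<open>spmf_of_pmf\<close> is injective, \<open>exec n A Q s'\<close>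
    determines it, so a choice depending on the memory alone fits every \<open>a\<close>.\<close>
  define q where "q = (\<lambda>(s', t::nat). SOME q. exec n A Q s' = spmf_of_pmf q)"
  have q: "exec n A Q s' = spmf_of_pmf (q (s', t)) \<and>
      rel_pmf (\<lambda>(s'', t') b. R s'' (t + t') b) (q (s', t)) (N a)" if R1: "R1 s' t a" for s' t a
  proof -
    obtain q' where q': "exec n A Q s' = spmf_of_pmf q'"
      "rel_pmf (\<lambda>(s'', t') b. R s'' (t + t') b) q' (N a)"
      using assms(2)[OF R1] by (auto simp: sim_def)
    then have "exec n A Q s' = spmf_of_pmf (q (s', t))"
      unfolding q_def by (auto intro: someI)
    moreover from this q'(1) have "q (s', t) = q'"
      unfolding spmf_of_pmf_def by (metis injD inj_Some pmf.inj_map)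
    ultimately show ?thesis using q' by simp
  qed
  define r' where "r' = r \<bind> (\<lambda>(s', t). map_pmf (\<lambda>(s'', t'). (s'', t + t')) (q (s', t)))"
  have supp: "exec n A Q s' = spmf_of_pmf (q (s', t))" if "(s', t) \<in> set_pmf r" for s' t
    using rel_pmf_imp_rel_set[OF r(2)] that q unfolding rel_set_def by fastforce
  have "exec n A (Seq P Q) s = spmf_of_pmf r \<bind> (\<lambda>(s', t). add_cost t (exec n A Q s'))"
    by (simp add: r)
  also have "\<dots> = spmf_of_pmf r \<bind> (\<lambda>(s', t). add_cost t (spmf_of_pmf (q (s', t))))"
    using supp by (intro bind_spmf_cong) auto
  also have "\<dots> = spmf_of_pmf r'"
    by (simp add: r'_def add_cost_def map_spmf_of_pmf spmf_of_pmf_bind case_prod_unfold)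
  finally have "exec n A (Seq P Q) s = spmf_of_pmf r'" .
  moreover have "rel_pmf (\<lambda>(s', t) a. R s' t a) r' (M \<bind> N)"
    unfolding r'_def
    by (rule rel_pmf_bindI[OF r(2)]) (auto simp: pmf.rel_map case_prod_unfold dest: q)
  ultimately show ?thesis unfolding sim_def by blast
qed

lemma sim_steps_Seq:
  assumes "steps n A P s s' c" "\<And>t. t \<le> c \<Longrightarrow> sim n A Q s' N (\<lambda>s'' t'. R s'' (t + t'))"
  shows "sim n A (Seq P Q) s N R"
proof -
  have "sim n A P s (return_pmf ()) (\<lambda>s1 t _. s1 = s' \<and> t \<le> c)"
    using assms(1) by (rule sim_steps) auto
  from sim_bind[OF this, of Q "\<lambda>_. N" R] show ?thesis using assms(2) by (auto simp: bind_return_pmf)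
qed

lemma sim_Seq_steps:
  assumes "sim n A P s M R1"
    and "\<And>s' t a. R1 s' t a \<Longrightarrow> \<exists>s'' c. steps n A Q s' s'' c \<and> (\<forall>t'\<le>c. R s'' (t + t') a)"
  shows "sim n A (Seq P Q) s M R"
proof -
  have "sim n A (Seq P Q) s (M \<bind> return_pmf) R"
  proof (rule sim_bind[OF assms(1)])
    fix s' t a assume "R1 s' t a"
    then obtain s'' c where "steps n A Q s' s'' c" "\<forall>t'\<le>c. R s'' (t + t') a" using assms(2) by blast
    then show "sim n A Q s' (return_pmf a) (\<lambda>s'' t'. R s'' (t + t'))" by (auto intro: sim_steps)
  qed
  then show ?thesis by (simp add: bind_return_pmf')
qed

lemma sim_Cond:
  assumes "sim n A (if bval b s then P else Q) s M (\<lambda>s' t. R s' (1 + bcost b + t))"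
  shows "sim n A (Cond b P Q) s M R"
proof -
  obtain r where r: "exec n A (if bval b s then P else Q) s = spmf_of_pmf r"
    "rel_pmf (\<lambda>(s', t) a. R s' (1 + bcost b + t) a) r M"
    using assms by (auto simp: sim_def)
  have "exec n A (Cond b P Q) s = spmf_of_pmf (map_pmf (\<lambda>(s', t). (s', 1 + bcost b + t)) r)"
    using r(1) by (auto simp: add_cost_def map_spmf_of_pmf split: if_splits)
  moreover have "rel_pmf (\<lambda>(s', t) a. R s' t a) (map_pmf (\<lambda>(s', t). (s', 1 + bcost b + t)) r) M"
    using r(2) by (simp add: pmf.rel_map case_prod_unfold)
  ultimately show ?thesis unfolding sim_def by blast
qed

lemma sim_Random:
  assumes "\<And>x. x < max 1 (nval f s) \<Longrightarrow> R (write_nat a (nval e s) x s) (1 + ncost e + ncost f) x"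
  shows "sim n A (Random a e f) s (pmf_of_set {..<max 1 (nval f s)}) R"
  unfolding sim_def exec.simps map_spmf_of_pmf
proof (intro exI conjI refl)
  have "set_pmf (pmf_of_set {..<max 1 (nval f s)}) = {..<max 1 (nval f s)}"
    by (intro set_pmf_of_set) (auto simp: lessThan_empty_iff)
  then show "rel_pmf (\<lambda>(s', t). R s' t)
      (map_pmf (\<lambda>x. (write_nat a (nval e s) x s, 1 + ncost e + ncost f))
        (pmf_of_set {..<max 1 (nval f s)}))
      (pmf_of_set {..<max 1 (nval f s)})"
    unfolding pmf.rel_map using assms by (intro rel_pmf_reflI) auto
qed (rule refl)

lemma sim_CallPack:
  assumes "\<And>T t. (T, t) \<in> set_pmf (A (nval e s) (\<lambda>j. if j < n then reals s a j else 0)) \<Longrightarrow>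
    R (write_set n b T s) (1 + ncost e + n + t) T"
  shows "sim n A (CallPack e a b) s
    (map_pmf fst (A (nval e s) (\<lambda>j. if j < n then reals s a j else 0))) R"
  unfolding sim_def exec.simps map_spmf_of_pmf
proof (intro exI conjI refl)
  show "rel_pmf (\<lambda>(s', t). R s' t)
      (map_pmf (\<lambda>(T, t). (write_set n b T s, 1 + ncost e + n + t))
        (A (nval e s) (\<lambda>j. if j < n then reals s a j else 0)))
      (map_pmf fst (A (nval e s) (\<lambda>j. if j < n then reals s a j else 0)))"
    unfolding pmf.rel_map using assms by (intro rel_pmf_reflI) auto
qed (rule refl)

lemma sim_While_False:
  assumes "\<not> bval b s" "R s (1 + bcost b) a"
  shows "sim n A (While b P) s (return_pmf a) R"
  using assms unfolding sim_def exec.simps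
  by (subst loop.simps) (auto intro!: exI[of _ "return_pmf _"] simp: spmf_of_pmf_return_pmf)

lemma sim_While_True:
  assumes "bval b s" "sim n A (Seq P (While b P)) s M (\<lambda>s' t. R s' (1 + bcost b + t))"
  shows "sim n A (While b P) s M R"
proof -
  have "exec n A (While b P) s = add_cost (1 + bcost b) (exec n A (Seq P (While b P)) s)"
    using assms(1) unfolding exec.simps
    by (subst loop.simps) (simp add: add_cost_def map_spmf_bind_spmf o_def case_prod_unfold spmf.map_comp add.assoc)
  moreover obtain r where r: "exec n A (Seq P (While b P)) s = spmf_of_pmf r"
    "rel_pmf (\<lambda>(s', t) a. R s' (1 + bcost b + t) a) r M"
    using assms(2) unfolding sim_def by blast
  ultimately have "exec n A (While b P) s = spmf_of_pmf (map_pmf (\<lambda>(s', t). (s', 1 + bcost b + t)) r)"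
    by (simp only: add_cost_def map_spmf_of_pmf)
  moreover have "rel_pmf (\<lambda>(s', t) a. R s' t a) (map_pmf (\<lambda>(s', t). (s', 1 + bcost b + t)) r) M"
    using r(2) by (simp add: pmf.rel_map case_prod_unfold)
  ultimately show ?thesis unfolding sim_def by blast
qed

text \<open>\<open>tm\<close> is a potential for amortized time. It may depend on the abstract
  state, so the number of refreshments so far can pay for the oracle calls.\<close>

lemma sim_While:
  assumes guard: "\<And>i s a. i \<le> N \<Longrightarrow> Inv i s a \<Longrightarrow> bval b s \<longleftrightarrow> i < N"
    and step: "\<And>i s a. i < N \<Longrightarrow> Inv i s a \<Longrightarrow> sim n A P s (K i a)
      (\<lambda>s' t a'. Inv (Suc i) s' a' \<and> t + 1 + bcost b + tm i a \<le> tm (Suc i) a')"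
    and M: "\<And>i a. i < N \<Longrightarrow> M i a = K i a \<bind> M (Suc i)" "\<And>a. M N a = return_pmf a"
    and "i \<le> N" "Inv i s a"
  shows "sim n A (While b P) s (M i a)
    (\<lambda>s' t a'. Inv N s' a' \<and> t + tm i a \<le> tm N a' + 1 + bcost b)"
  using assms(5,6)
proof (induction i arbitrary: s a rule: inc_induct)
  case base
  then show ?case using guard[of N s a] by (auto simp: M(2) intro!: sim_While_False)
next
  case (step i)
  show ?case unfolding M(1)[OF step(2)]
  proof (rule sim_While_True)
    show "bval b s" using guard[of i s a] step by simp
    show "sim n A (Seq P (While b P)) s (K i a \<bind> M (Suc i))
       (\<lambda>s' t a'. Inv N s' a' \<and> 1 + bcost b + t + tm i a \<le> tm N a' + 1 + bcost b)"
      by (rule sim_bind[OF assms(2)[OF step(2) step.prems]], rule sim_mono[OF step.IH]) auto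
  qed
qed

lemma memory_eqI: "(\<And>a. nats s a = nats s' a) \<Longrightarrow> (\<And>a. reals s a = reals s' a) \<Longrightarrow> s = (s' :: memory)"
  by (intro memory.equality) auto

section \<open>The program\<close>

text \<open>Array \<open>S\<close> holds the characteristic vectors of the current sets row by row, \<open>row\<close> the offsets
  of the rows (there is no multiplication of naturals), and \<open>ord\<close> the priority list. For every
  item, \<open>p\<close> is its mean worth under the prefix of the priority list that has been processed, and
  \<open>x \<mapsto> E + P * x\<close> is the affine map given by the rest of the list. The scalars \<open>y\<close> and \<open>z\<close> are the
  old and the new activation probability.\<close>

abbreviation item :: "name \<Rightarrow> rexp" where "item a \<equiv> RCell a (var ''j'')"
abbreviation entry :: nexp where "entry \<equiv> NAdd (var ''o'') (var ''j'')"
abbreviation worth_exp :: rexp where "worth_exp \<equiv> RCell ''v'' entry"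
abbreviation one :: rexp where "one \<equiv> OfNat (Lit 1)"
abbreviation rvar :: "name \<Rightarrow> rexp" where "rvar a \<equiv> RCell a (Lit 0)"
abbreviation member :: bexp where "member \<equiv> NLess (Lit 0) (NCell ''S'' entry)"

definition mix_exp :: "name \<Rightarrow> name \<Rightarrow> rexp" where
  "mix_exp y x = RAdd (RMul (RSub one (rvar y)) (item x)) (RMul (rvar y) worth_exp)"

definition clear_body :: com where
  "clear_body = Seq (RStore ''p'' (var ''j'') (OfNat (Lit 0)))
     (Seq (RStore ''P'' (var ''j'') one) (RStore ''E'' (var ''j'') (OfNat (Lit 0))))"

definition append_body :: "name \<Rightarrow> com" where
  "append_body y = Seq (RStore ''E'' (var ''j'') (mix_exp y ''E''))
     (RStore ''P'' (var ''j'') (RMul (RSub one (rvar y)) (item ''P'')))"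

definition scan_body :: com where
  "scan_body = Cond member (append_body ''y'') Skip"

text \<open>Removes the first bin of the stored list. In front of a map with slope P, the step x ->
  (1 - y) x + y v multiplies the slope by 1 - y and adds P y v to the constant; both changes are
  reversed, the constant with the restored slope.\<close>

definition peel_body :: com where
  "peel_body = Cond member
     (Seq (RStore ''P'' (var ''j'') (RDiv (item ''P'') (RSub one (rvar ''y''))))
        (RStore ''E'' (var ''j'')
          (RSub (item ''E'') (RMul (item ''P'') (RMul (rvar ''y'') worth_exp)))))
     Skip"

definition rest_exp :: rexp where
  "rest_exp = RAdd (item ''E'') (RMul (item ''P'') (item ''p''))"

definition weigh_body :: com where
  "weigh_body = Cond (RLess rest_exp worth_exp)
     (RStore ''w'' (var ''j'') (RSub worth_exp rest_exp))
     (RStore ''w'' (var ''j'') (OfNat (Lit 0)))"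

definition insert_body :: com where
  "insert_body = Cond (Conj (NLess (Lit 0) (NCell ''T'' (var ''j''))) (RLess (OfNat (Lit 0)) (item ''w'')))
     (Seq (NStore ''S'' entry (Lit 1)) (append_body ''z''))
     (NStore ''S'' entry (Lit 0))"

definition keep_body :: com where
  "keep_body = Cond member
     (Cond (RLess worth_exp (item ''p''))
        (NStore ''S'' entry (Lit 0))
        (RStore ''p'' (var ''j'') (mix_exp ''z'' ''p'')))
     Skip"

definition out_body :: com where
  "out_body = Cond member (NStore ''out'' (var ''j'') (NAdd (var ''i'') (Lit 1))) Skip"

definition fetch :: com where
  "fetch = Seq (NStore ''i'' (Lit 0) (NCell ''ord'' (var ''r'')))
     (NStore ''o'' (Lit 0) (NCell ''row'' (var ''i'')))"

abbreviation items_loop :: "com \<Rightarrow> com" where "items_loop \<equiv> For ''j'' ''n''"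

definition incr :: "name \<Rightarrow> com" where
  "incr a = NStore a (Lit 0) (NAdd (var a) (Lit 1))"

definition refresh_com :: com where
  "refresh_com = Seq (items_loop weigh_body)
     (Seq (CallPack (var ''i'') ''w'' ''T'')
     (Seq (items_loop insert_body)
     (Seq (incr ''cnt'')
     (Seq (NStore ''app'' (var ''b'') (var ''i'')) (incr ''b'')))))"

definition keep_com :: com where
  "keep_com = Seq (items_loop keep_body)
     (Seq (NStore ''ord'' (var ''a'') (var ''i'')) (incr ''a''))"

definition bin_com :: com where
  "bin_com = Seq (Seq fetch (items_loop peel_body))
     (Seq (Random ''x'' (Lit 0) (var ''k''))
       (Cond (Conj (NLess (var ''x'') (Lit 1)) (NLess (var ''cnt'') (var ''cap'')))
         refresh_com keep_com))"

definition append_com :: com where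
  "append_com = NStore ''ord'' (NAdd (var ''a'') (var ''r'')) (NCell ''app'' (var ''r''))"

definition round_com :: "nat \<Rightarrow> com" where
  "round_com L =
     Seq (Seq (RStore ''y'' (Lit 0) (RDiv (OfNat (var ''k'')) (OfNat (Lit L))))
       (Seq (incr ''k'')
       (Seq (RStore ''z'' (Lit 0) (RDiv (OfNat (var ''k'')) (OfNat (Lit L))))
       (Seq (NStore ''a'' (Lit 0) (Lit 0)) (NStore ''b'' (Lit 0) (Lit 0))))))
     (Seq (items_loop clear_body)
     (Seq (For ''r'' ''m'' (Seq fetch (items_loop scan_body)))
     (Seq (For ''r'' ''m'' bin_com)
       (For ''r'' ''b'' append_com))))"

definition init_body :: "nat \<Rightarrow> com" where
  "init_body b = Seq (NStore ''row'' (NAdd (var ''r'') (Lit 1)) (NAdd (NCell ''row'' (var ''r'')) (var ''n'')))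
     (Seq (NStore ''ord'' (var ''r'') (var ''r''))
        (NStore ''cap'' (Lit 0) (NAdd (var ''cap'') (Lit b))))"

text \<open>\<open>L\<close> and \<open>b\<close> depend on \<epsilon> only and are literals, since
  reals cannot be rounded on the machine. Without items the program has to stop at once: the time
  bound then has no term in 1/\<epsilon>, and \<open>L\<close> rounds over all bins could exceed
  it.\<close>

definition sap_com :: "nat \<Rightarrow> nat \<Rightarrow> com" where
  "sap_com L b =
     Cond (NLess (Lit 0) (var ''n''))
       (Seq (For ''r'' ''m'' (init_body b))
       (Seq (While (NLess (var ''k'') (Lit L)) (round_com L))
         (For ''r'' ''m'' (Seq fetch (items_loop out_body)))))
       Skip"

section \<open>The loops over all items\<close>

lemmas write_defs = write_nat_def write_real_def

text \<open>The final memory, read as a function of \<open>N\<close>, gives the memory after any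
  number of iterations. It therefore serves as its own loop invariant, here and in the next six
  lemmas.\<close>

lemma steps_clear:
  assumes "nats s ''n'' 0 = N"
  shows "steps n A (items_loop clear_body) s
    (s\<lparr>nats := (nats s)(''j'' := (nats s ''j'')(0 := N)),
       reals := (reals s)(''p'' := \<lambda>l. if l < N then 0 else reals s ''p'' l,
         ''P'' := \<lambda>l. if l < N then 1 else reals s ''P'' l,
         ''E'' := \<lambda>l. if l < N then 0 else reals s ''E'' l)\<rparr>) (100 * N + 9)"
    (is "steps n A _ s (?G N) _")
proof -
  have "steps n A (items_loop clear_body) s (?G N) ((wc clear_body + 12) * N + 9)"
    by (rule steps_For_straight[where G = ?G])
      (use assms in \<open>auto simp: clear_body_def write_defs less_Suc_eq fun_eq_iff intro!: memory_eqI\<close>)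
  then show ?thesis by (rule steps_weaken) (simp add: clear_body_def)
qed

lemma steps_scan:
  assumes "nats s ''n'' 0 = N"
  defines "J \<equiv> \<lambda>l. 0 < nats s ''S'' (nats s ''o'' 0 + l)"
  shows "steps n A (items_loop scan_body) s
    (s\<lparr>nats := (nats s)(''j'' := (nats s ''j'')(0 := N)),
       reals := (reals s)(
         ''P'' := \<lambda>l. if l < N \<and> J l then (1 - reals s ''y'' 0) * reals s ''P'' l else reals s ''P'' l,
         ''E'' := \<lambda>l. if l < N \<and> J l then (1 - reals s ''y'' 0) * reals s ''E'' l
            + reals s ''y'' 0 * reals s ''v'' (nats s ''o'' 0 + l) else reals s ''E'' l)\<rparr>) (100 * N + 9)"
    (is "steps n A _ s (?G N) _")
proof -
  have "steps n A (items_loop scan_body) s (?G N) ((wc scan_body + 12) * N + 9)"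
    by (rule steps_For_straight[where G = ?G])
      (use assms in \<open>auto simp: scan_body_def append_body_def mix_exp_def write_defs less_Suc_eq fun_eq_iff intro!: memory_eqI\<close>)
  then show ?thesis by (rule steps_weaken) (simp add: scan_body_def append_body_def mix_exp_def)
qed

lemma steps_peel:
  assumes "nats s ''n'' 0 = N"
  defines "J \<equiv> \<lambda>l. 0 < nats s ''S'' (nats s ''o'' 0 + l)"
  shows "steps n A (items_loop peel_body) s
    (s\<lparr>nats := (nats s)(''j'' := (nats s ''j'')(0 := N)),
       reals := (reals s)(
         ''P'' := \<lambda>l. if l < N \<and> J l then reals s ''P'' l / (1 - reals s ''y'' 0) else reals s ''P'' l,
         ''E'' := \<lambda>l. if l < N \<and> J l then reals s ''E'' l - reals s ''P'' l / (1 - reals s ''y'' 0)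
            * (reals s ''y'' 0 * reals s ''v'' (nats s ''o'' 0 + l)) else reals s ''E'' l)\<rparr>) (100 * N + 9)"
    (is "steps n A _ s (?G N) _")
proof -
  have "steps n A (items_loop peel_body) s (?G N) ((wc peel_body + 12) * N + 9)"
    by (rule steps_For_straight[where G = ?G])
      (use assms in \<open>auto simp: peel_body_def write_defs less_Suc_eq fun_eq_iff intro!: memory_eqI\<close>)
  then show ?thesis by (rule steps_weaken) (simp add: peel_body_def)
qed

lemma steps_weigh:
  assumes "nats s ''n'' 0 = N"
  shows "steps n A (items_loop weigh_body) s
    (s\<lparr>nats := (nats s)(''j'' := (nats s ''j'')(0 := N)),
       reals := (reals s)(''w'' := \<lambda>l. if l < N
         then max 0 (reals s ''v'' (nats s ''o'' 0 + l) - (reals s ''E'' l + reals s ''P'' l * reals s ''p'' l))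
         else reals s ''w'' l)\<rparr>) (100 * N + 9)"
    (is "steps n A _ s (?G N) _")
proof -
  have "steps n A (items_loop weigh_body) s (?G N) ((wc weigh_body + 12) * N + 9)"
    by (rule steps_For_straight[where G = ?G])
      (use assms in \<open>auto simp: weigh_body_def rest_exp_def write_defs less_Suc_eq fun_eq_iff intro!: memory_eqI\<close>)
  then show ?thesis by (rule steps_weaken) (simp add: weigh_body_def rest_exp_def)
qed

lemma steps_insert:
  assumes "nats s ''n'' 0 = N"
  defines "J \<equiv> \<lambda>l. 0 < nats s ''T'' l \<and> 0 < reals s ''w'' l"
  shows "steps n A (items_loop insert_body) s
    (s\<lparr>nats := (nats s)(''j'' := (nats s ''j'')(0 := N),
         ''S'' := \<lambda>q. if nats s ''o'' 0 \<le> q \<and> q < nats s ''o'' 0 + N then of_bool (J (q - nats s ''o'' 0)) else nats s ''S'' q),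
       reals := (reals s)(
         ''P'' := \<lambda>l. if l < N \<and> J l then (1 - reals s ''z'' 0) * reals s ''P'' l else reals s ''P'' l,
         ''E'' := \<lambda>l. if l < N \<and> J l then (1 - reals s ''z'' 0) * reals s ''E'' l
            + reals s ''z'' 0 * reals s ''v'' (nats s ''o'' 0 + l) else reals s ''E'' l)\<rparr>) (100 * N + 9)"
    (is "steps n A _ s (?G N) _")
proof -
  have "steps n A (items_loop insert_body) s (?G N) ((wc insert_body + 12) * N + 9)"
    by (rule steps_For_straight[where G = ?G])
      (use assms in \<open>auto simp: insert_body_def append_body_def mix_exp_def write_defs less_Suc_eq fun_eq_iff intro!: memory_eqI\<close>)
  then show ?thesis by (rule steps_weaken) (simp add: insert_body_def append_body_def mix_exp_def)
qed

lemma steps_keep: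
  assumes "nats s ''n'' 0 = N"
  defines "J \<equiv> \<lambda>l. 0 < nats s ''S'' (nats s ''o'' 0 + l)"
  shows "steps n A (items_loop keep_body) s
    (s\<lparr>nats := (nats s)(''j'' := (nats s ''j'')(0 := N),
         ''S'' := \<lambda>q. if nats s ''o'' 0 \<le> q \<and> q < nats s ''o'' 0 + N \<and> reals s ''v'' q < reals s ''p'' (q - nats s ''o'' 0)
            then 0 else nats s ''S'' q),
       reals := (reals s)(
         ''p'' := \<lambda>l. if l < N \<and> J l \<and> \<not> reals s ''v'' (nats s ''o'' 0 + l) < reals s ''p'' l
            then (1 - reals s ''z'' 0) * reals s ''p'' l + reals s ''z'' 0 * reals s ''v'' (nats s ''o'' 0 + l)
            else reals s ''p'' l)\<rparr>) (100 * N + 9)"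
    (is "steps n A _ s (?G N) _")
proof -
  have "steps n A (items_loop keep_body) s (?G N) ((wc keep_body + 12) * N + 9)"
    by (rule steps_For_straight[where G = ?G])
      (use assms in \<open>auto simp: keep_body_def mix_exp_def write_defs less_Suc_eq fun_eq_iff intro!: memory_eqI\<close>)
  then show ?thesis by (rule steps_weaken) (simp add: keep_body_def mix_exp_def)
qed

lemma steps_out:
  assumes "nats s ''n'' 0 = N"
  defines "J \<equiv> \<lambda>l. 0 < nats s ''S'' (nats s ''o'' 0 + l)"
  shows "steps n A (items_loop out_body) s
    (s\<lparr>nats := (nats s)(''j'' := (nats s ''j'')(0 := N),
         ''out'' := \<lambda>l. if l < N \<and> J l then nats s ''i'' 0 + 1 else nats s ''out'' l)\<rparr>) (100 * N + 9)"
    (is "steps n A _ s (?G N) _")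
proof -
  have "steps n A (items_loop out_body) s (?G N) ((wc out_body + 12) * N + 9)"
    by (rule steps_For_straight[where G = ?G])
      (use assms in \<open>auto simp: out_body_def write_defs less_Suc_eq fun_eq_iff intro!: memory_eqI\<close>)
  then show ?thesis by (rule steps_weaken) (simp add: out_body_def)
qed

section \<open>The program simulates the process\<close>

text \<open>Rows of length \<open>n\<close> do not overlap, so rewriting the row of one bin leaves
  the sets of the other bins intact.\<close>

lemma row_index:
  fixes i :: nat
  assumes "j < n"
  shows "i * n \<le> i' * n + j \<and> i' * n + j < i * n + n \<longleftrightarrow> i' = i"
proof
  assume a: "i * n \<le> i' * n + j \<and> i' * n + j < i * n + n"
  have "i' * n < Suc i * n" using a by simp
  then have "i' \<le> i" by (simp only: mult_less_cancel2) simp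
  moreover have "i * n < Suc i' * n" using a assms by simp
  then have "i \<le> i'" by (simp only: mult_less_cancel2) simp
  ultimately show "i' = i" by simp
qed (use assms in simp)

context lazy_greedy
begin

section \<open>Memory invariants during a round\<close>

definition data :: "(nat \<Rightarrow> nat set) \<Rightarrow> nat \<Rightarrow> memory \<Rightarrow> bool" where
  "data S c s \<longleftrightarrow> nats s ''n'' 0 = items I \<and> nats s ''m'' 0 = bins I \<and>
     nats s ''cap'' 0 = cap \<and> nats s ''cnt'' 0 = c \<and> nats s ''out'' = (\<lambda>_. 0) \<and>
     (\<forall>i<bins I. nats s ''row'' i = i * items I \<and> (\<forall>j<items I.
       reals s ''v'' (i * items I + j) = worth I i j \<and>
       (0 < nats s ''S'' (i * items I + j) \<longleftrightarrow> j \<in> S i)))"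

text \<open>Kept bins are written back to the front of \<open>ord\<close> while it is still being
  read: the write position \<open>length A\<close> never passes the read position
  \<open>length A + length B\<close>. Refreshed bins wait in \<open>app\<close>.\<close>

definition lists :: "nat list \<Rightarrow> nat list \<Rightarrow> memory \<Rightarrow> bool" where
  "lists A B s \<longleftrightarrow> nats s ''a'' 0 = length A \<and> nats s ''b'' 0 = length B \<and>
     nats s ''r'' 0 = length A + length B \<and>
     (\<forall>l<length A. nats s ''ord'' l = A ! l) \<and> (\<forall>l<length B. nats s ''app'' l = B ! l)"

definition probs :: "nat \<Rightarrow> memory \<Rightarrow> bool" where
  "probs k s \<longleftrightarrow> nats s ''k'' 0 = Suc k \<and> reals s ''y'' 0 = level k \<and> reals s ''z'' 0 = level (Suc k)"

definition maps ::
  "nat \<Rightarrow> nat list \<Rightarrow> nat list \<Rightarrow> nat list \<Rightarrow> (nat \<Rightarrow> nat set) \<Rightarrow> memory \<Rightarrow> bool" where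
  "maps k A Q B S s \<longleftrightarrow> (\<forall>j<items I.
     reals s ''p'' j = mean_worth (worth I) S j (level (Suc k)) A 0 \<and>
     reals s ''P'' j = miss_prob S j (level k) Q * miss_prob S j (level (Suc k)) B \<and>
     reals s ''E'' j = mean_worth (worth I) S j (level (Suc k)) B (mean_worth (worth I) S j (level k) Q 0))"

definition pass_inv ::
  "nat \<Rightarrow> nat list \<Rightarrow> nat list \<times> nat list \<times> (nat \<Rightarrow> nat set) \<times> nat \<Rightarrow> memory \<Rightarrow> bool" where
  "pass_inv k Q = (\<lambda>(A, B, S, c) s. ok Q (A, B, S, c) \<and> data S c s \<and> lists A B s \<and> probs k s \<and>
     maps k A Q B S s \<and> (\<forall>l<length Q. nats s ''ord'' (length A + length B + l) = Q ! l))"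

definition peeled ::
  "nat \<Rightarrow> nat \<Rightarrow> nat list \<Rightarrow> nat list \<times> nat list \<times> (nat \<Rightarrow> nat set) \<times> nat \<Rightarrow> memory \<Rightarrow> bool" where
  "peeled k i Q = (\<lambda>(A, B, S, c) s. ok (i # Q) (A, B, S, c) \<and> data S c s \<and> lists A B s \<and>
     probs k s \<and> maps k A Q B S s \<and>
     (\<forall>l<length Q. nats s ''ord'' (Suc (length A + length B + l)) = Q ! l) \<and>
     nats s ''i'' 0 = i \<and> nats s ''o'' 0 = i * items I)"

text \<open>Splitting at the processed bin gives the constant \<open>E\<close>, the slope
  \<open>P\<close> and the prefix value \<open>p\<close> of the program; this is the number that
  \<open>rest_exp\<close> computes.\<close>

lemma mixed_affine:
  "mixed k A Q B S j = mean_worth (worth I) S j (level (Suc k)) B (mean_worth (worth I) S j (level k) Q 0)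
     + miss_prob S j (level k) Q * miss_prob S j (level (Suc k)) B
        * mean_worth (worth I) S j (level (Suc k)) A 0"
  unfolding mixed_def
  by (subst (2) mean_worth_affine, subst mean_worth_shift) (simp add: mult_ac)

lemma steps_fetch_peel:
  assumes k: "k < L" and inv: "pass_inv k (i # Q) (A, B, S, c) s"
  shows "\<exists>s'. steps n pk (Seq fetch (items_loop peel_body)) s s' (100 * items I + 30)
    \<and> peeled k i Q (A, B, S, c) s'"
proof -
  let ?N = "items I"
  have i: "i < bins I" using inv by (auto simp: pass_inv_def ok_def)
  have ord: "nats s ''ord'' (nats s ''r'' 0) = i"
    using inv by (fastforce simp: pass_inv_def lists_def)
  have row: "nats s ''row'' i = i * ?N" using inv i by (auto simp: pass_inv_def data_def)
  define s1 where "s1 = s\<lparr>nats := (nats s)(''i'' := (nats s ''i'')(0 := i), ''o'' := (nats s ''o'')(0 := i * ?N))\<rparr>"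
  have "eff fetch s = s1"
    unfolding fetch_def s1_def using ord row
    by (auto simp: write_defs fun_eq_iff intro!: memory_eqI)
  then have 1: "steps n pk fetch s s1 20"
    using steps_straight[of fetch n pk s] by (auto simp: fetch_def elim: steps_weaken)
  have n: "nats s1 ''n'' 0 = ?N" using inv by (simp add: s1_def pass_inv_def data_def)
  note 2 = steps_peel[OF n, of n pk]
  define s2 where "s2 = s1\<lparr>nats := (nats s1)(''j'' := (nats s1 ''j'')(0 := ?N)),
       reals := (reals s1)(
         ''P'' := \<lambda>l. if l < ?N \<and> 0 < nats s1 ''S'' (nats s1 ''o'' 0 + l)
            then reals s1 ''P'' l / (1 - reals s1 ''y'' 0) else reals s1 ''P'' l,
         ''E'' := \<lambda>l. if l < ?N \<and> 0 < nats s1 ''S'' (nats s1 ''o'' 0 + l)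
            then reals s1 ''E'' l - reals s1 ''P'' l / (1 - reals s1 ''y'' 0)
            * (reals s1 ''y'' 0 * reals s1 ''v'' (nats s1 ''o'' 0 + l)) else reals s1 ''E'' l)\<rparr>"
  \<comment> \<open>Peeling divides by \<open>1 - level k\<close>, which is nonzero because the old
    activation probability is below 1 in every round.\<close>
  have "level k < 1" using k by simp
  have maps: "maps k A Q B S s2"
    unfolding maps_def
  proof (intro allI impI)
    fix j assume j: "j < ?N"
    define w where "w = level k * worth I i j"
    define mQ mB where "mQ = miss_prob S j (level k) Q" and "mB = miss_prob S j (level (Suc k)) B"
    define E where "E = mean_worth (worth I) S j (level (Suc k)) B (mean_worth (worth I) S j (level k) Q 0)"
    have S: "0 < nats s ''S'' (i * ?N + j) \<longleftrightarrow> j \<in> S i" "reals s ''v'' (i * ?N + j) = worth I i j"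
      and y: "reals s ''y'' 0 = level k"
      using inv i j by (auto simp: pass_inv_def data_def probs_def)
    have p: "reals s ''p'' j = mean_worth (worth I) S j (level (Suc k)) A 0"
      and P: "reals s ''P'' j = (if j \<in> S i then 1 - level k else 1) * (mQ * mB)"
      and E': "reals s ''E'' j = mean_worth (worth I) S j (level (Suc k)) B
        (mean_worth (worth I) S j (level k) Q (0 + (if j \<in> S i then w else 0)))"
      using inv j by (auto simp: pass_inv_def maps_def mQ_def mB_def w_def)
    have E: "reals s ''E'' j = E + mB * (mQ * (if j \<in> S i then w else 0))"
      unfolding E' mean_worth_shift E_def mQ_def mB_def ..
    have "reals s2 ''p'' j = reals s ''p'' j" "reals s2 ''P'' j = mQ * mB" "reals s2 ''E'' j = E"
      using j S y P E \<open>level k < 1\<close> by (simp_all add: s2_def s1_def w_def)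
    then show "reals s2 ''p'' j = mean_worth (worth I) S j (level (Suc k)) A 0 \<and>
       reals s2 ''P'' j = miss_prob S j (level k) Q * miss_prob S j (level (Suc k)) B \<and>
       reals s2 ''E'' j = mean_worth (worth I) S j (level (Suc k)) B (mean_worth (worth I) S j (level k) Q 0)"
      using p by (simp add: mQ_def mB_def E_def)
  qed
  have "peeled k i Q (A, B, S, c) s2"
    using inv maps unfolding peeled_def pass_inv_def
    by (auto simp: s1_def s2_def data_def lists_def probs_def nth_Cons split: nat.splits)
  moreover have "steps n pk (Seq fetch (items_loop peel_body)) s s2 (100 * ?N + 30)"
    unfolding s2_def by (rule steps_weaken[OF steps_Seq[OF 1 2]]) simp
  ultimately show ?thesis by blast
qed

text \<open>The invariant speaks of the memory with \<open>r\<close> already advanced, because the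
  enclosing loop increments \<open>r\<close> after its body and \<open>lists\<close> ties
  \<open>r\<close> to the lengths of the lists.\<close>

lemma steps_keep_com:
  assumes inv: "peeled k i Q (A, B, S, c) s"
  shows "\<exists>s'. steps n pk keep_com s s' (100 * items I + 30) \<and> pass_inv k Q (keep k i (A, B, S, c)) (write_nat ''r'' 0 (Suc (length A + length B)) s')
     \<and> nats s' ''r'' 0 = length A + length B"
proof -
  let ?N = "items I"
  let ?S = "S(i := pruned k A S i)"
  have i: "i < bins I" "i \<notin> set A" "i \<notin> set Q" "i \<notin> set B" using inv by (auto simp: peeled_def ok_def)
  have n: "nats s ''n'' 0 = ?N" using inv by (simp add: peeled_def data_def)
  note 1 = steps_keep[OF n, of n pk]
  define s1 where "s1 = s\<lparr>nats := (nats s)(''j'' := (nats s ''j'')(0 := ?N),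
         ''S'' := \<lambda>q. if nats s ''o'' 0 \<le> q \<and> q < nats s ''o'' 0 + ?N \<and> reals s ''v'' q < reals s ''p'' (q - nats s ''o'' 0)
            then 0 else nats s ''S'' q),
       reals := (reals s)(
         ''p'' := \<lambda>l. if l < ?N \<and> 0 < nats s ''S'' (nats s ''o'' 0 + l)
              \<and> \<not> reals s ''v'' (nats s ''o'' 0 + l) < reals s ''p'' l
            then (1 - reals s ''z'' 0) * reals s ''p'' l + reals s ''z'' 0 * reals s ''v'' (nats s ''o'' 0 + l)
            else reals s ''p'' l)\<rparr>"
  let ?P = "Seq (NStore ''ord'' (var ''a'') (var ''i'')) (incr ''a'')"
  define s2 where "s2 = eff ?P s1"
  have 2: "steps n pk ?P s1 s2 20"
    unfolding s2_def by (rule steps_weaken[OF steps_straight]) (auto simp: incr_def)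
  have s2: "s2 = s1\<lparr>nats := (nats s1)(''ord'' := (nats s1 ''ord'')(nats s1 ''a'' 0 := nats s1 ''i'' 0),
      ''a'' := (nats s1 ''a'')(0 := Suc (nats s1 ''a'' 0)))\<rparr>"
    unfolding s2_def incr_def by (auto simp: write_defs fun_eq_iff intro!: memory_eqI)
  define s3 where "s3 = write_nat ''r'' 0 (Suc (length A + length B)) s2"
  have s3: "s3 = s2\<lparr>nats := (nats s2)(''r'' := (nats s2 ''r'')(0 := Suc (length A + length B)))\<rparr>"
    by (simp add: s3_def write_defs)
  have ok: "ok Q (keep k i (A, B, S, c))" using inv by (intro keep_ok) (auto simp: peeled_def)
  have data: "data ?S c s3"
    unfolding data_def
  proof (intro conjI allI impI)
    fix i' j assume "i' < bins I" "j < ?N"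
    moreover from this have "0 < nats s ''S'' (i' * ?N + j) \<longleftrightarrow> j \<in> S i'"
      "reals s ''v'' (i' * ?N + j) = worth I i' j"
      "reals s ''p'' j = mean_worth (worth I) S j (level (Suc k)) A 0"
      using inv by (auto simp: peeled_def data_def maps_def)
    ultimately show "0 < nats s3 ''S'' (i' * ?N + j) \<longleftrightarrow> j \<in> ?S i'"
      using inv row_index[of j ?N i i'] by (auto simp: s1_def s2 s3 peeled_def pruned_def)
  qed (use inv in \<open>auto simp: s1_def s2 s3 peeled_def data_def\<close>)
  have maps: "maps k (A @ [i]) Q B ?S s3"
    unfolding maps_def
  proof (intro allI impI)
    fix j assume j: "j < ?N"
    have S: "0 < nats s ''S'' (i * ?N + j) \<longleftrightarrow> j \<in> S i" "reals s ''v'' (i * ?N + j) = worth I i j"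
      and z: "reals s ''z'' 0 = level (Suc k)" and o: "nats s ''o'' 0 = i * ?N"
      using inv i j by (auto simp: peeled_def data_def probs_def)
    have m: "reals s ''p'' j = mean_worth (worth I) S j (level (Suc k)) A 0"
      "reals s ''P'' j = miss_prob S j (level k) Q * miss_prob S j (level (Suc k)) B"
      "reals s ''E'' j = mean_worth (worth I) S j (level (Suc k)) B (mean_worth (worth I) S j (level k) Q 0)"
      using inv j by (auto simp: peeled_def maps_def)
    show "reals s3 ''p'' j = mean_worth (worth I) ?S j (level (Suc k)) (A @ [i]) 0 \<and>
       reals s3 ''P'' j = miss_prob ?S j (level k) Q * miss_prob ?S j (level (Suc k)) B \<and>
       reals s3 ''E'' j = mean_worth (worth I) ?S j (level (Suc k)) B (mean_worth (worth I) ?S j (level k) Q 0)"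
      using i j S z o m by (simp add: s1_def s2 s3 pruned_def)
  qed
  have "pass_inv k Q (keep k i (A, B, S, c)) s3"
    using inv ok data maps unfolding pass_inv_def keep_def
    by (auto simp: s1_def s2 s3 peeled_def lists_def probs_def nth_append less_Suc_eq)
  moreover have "nats s2 ''r'' 0 = length A + length B"
    using inv by (simp add: s2 s1_def peeled_def lists_def)
  moreover have "steps n pk keep_com s s2 (100 * ?N + 30)"
    unfolding keep_com_def
    by (rule steps_weaken[OF steps_Seq[OF 1[folded s1_def] 2]]) simp
  ultimately show ?thesis unfolding s3_def by blast
qed


text \<open>The oracle call is paid for by the count: passing from \<open>c\<close> to
  \<open>Suc c\<close> releases one more \<open>items I + nat \<lfloor>\<tau>\<rfloor>\<close> on
  the right. The floor is harmless as reported times are natural numbers.\<close>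

lemma sim_refresh_com:
  assumes inv: "peeled k i Q (A, B, S, c) s" and "c < cap"
  shows "sim (items I) pack refresh_com s (refresh k i Q (A, B, S, c))
    (\<lambda>s' t st. pass_inv k Q st (write_nat ''r'' 0 (Suc (length A + length B)) s') \<and>
       nats s' ''r'' 0 = length A + length B \<and>
       t + (items I + nat \<lfloor>\<tau>\<rfloor>) * c \<le> 200 * items I + 60 + (items I + nat \<lfloor>\<tau>\<rfloor>) * snd (snd (snd st)))"
proof -
  let ?N = "items I"
  have okc: "ok (i # Q) (A, B, S, c)" using inv by (simp add: peeled_def)
  have i: "i < bins I" "i \<notin> set A" "i \<notin> set Q" "i \<notin> set B" using okc by (auto simp: ok_def)
  have n: "nats s ''n'' 0 = ?N" using inv by (simp add: peeled_def data_def)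
  define s1 where "s1 = s\<lparr>nats := (nats s)(''j'' := (nats s ''j'')(0 := ?N)),
       reals := (reals s)(''w'' := \<lambda>l. if l < ?N
         then max 0 (reals s ''v'' (nats s ''o'' 0 + l) - (reals s ''E'' l + reals s ''P'' l * reals s ''p'' l))
         else reals s ''w'' l)\<rparr>"
  note 1 = steps_weigh[OF n, of ?N pack, folded s1_def]
  have w: "reals s1 ''w'' j = gain k A Q B S i j" if "j < ?N" for j
    using that inv i by (simp add: s1_def peeled_def data_def maps_def gain_def mixed_affine)
  let ?w = "\<lambda>j. if j < items I then gain k A Q B S i j else 0"
  have i1: "nval (var ''i'') s1 = i" using inv by (simp add: s1_def peeled_def)
  have W: "(\<lambda>j. if j < items I then reals s1 ''w'' j else 0) = ?w"
    using w by (auto simp: fun_eq_iff)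
  let ?rest = "Seq (items_loop insert_body) (Seq (incr ''cnt'')
     (Seq (NStore ''app'' (var ''b'') (var ''i'')) (incr ''b'')))"
  define st where "st T = (A, B @ [i], S(i := {j \<in> T. 0 < gain k A Q B S i j}), Suc c)" for T
  define R where "R s' t st' \<longleftrightarrow> pass_inv k Q st' (write_nat ''r'' 0 (Suc (length A + length B)) s') \<and>
       nats s' ''r'' 0 = length A + length B \<and>
       t + (?N + nat \<lfloor>\<tau>\<rfloor>) * c \<le> 200 * ?N + 60 + (?N + nat \<lfloor>\<tau>\<rfloor>) * snd (snd (snd st'))" for s' t st'
  have call: "sim ?N pack (CallPack (var ''i'') ''w'' ''T'') s1 (map_pmf fst (pack i ?w))
      (\<lambda>s2 t T. s2 = write_set ?N ''T'' T s1 \<and> t \<le> 3 + ?N + nat \<lfloor>\<tau>\<rfloor> \<and> T \<in> set_pmf (map_pmf fst (pack i ?w)))"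
  proof -
    have "sim ?N pack (CallPack (var ''i'') ''w'' ''T'') s1
      (map_pmf fst (pack (nval (var ''i'') s1) (\<lambda>j. if j < items I then reals s1 ''w'' j else 0)))
      (\<lambda>s2 t T. s2 = write_set ?N ''T'' T s1 \<and> t \<le> 3 + ?N + nat \<lfloor>\<tau>\<rfloor> \<and> T \<in> set_pmf (map_pmf fst (pack i ?w)))"
    proof (rule sim_CallPack, unfold W i1)
      fix T t assume T: "(T, t) \<in> set_pmf (pack i ?w)"
      then have "real t \<le> \<tau>" using pack_support(2)[OF i(1), of ?w] by (auto simp: gain_nonneg)
      then have "t \<le> nat \<lfloor>\<tau>\<rfloor>" by (simp add: le_nat_iff le_floor_iff)
      then show "write_set ?N ''T'' T s1 = write_set ?N ''T'' T s1 \<and>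
          1 + ncost (var ''i'') + ?N + t \<le> 3 + ?N + nat \<lfloor>\<tau>\<rfloor> \<and> T \<in> set_pmf (map_pmf fst (pack i ?w))"
        using T by force
    qed
    then show ?thesis unfolding W i1 .
  qed
  have rest: "\<exists>s'. steps ?N pack ?rest (write_set ?N ''T'' T s1) s' (100 * ?N + 40)
      \<and> pass_inv k Q (st T) (write_nat ''r'' 0 (Suc (length A + length B)) s')
      \<and> nats s' ''r'' 0 = length A + length B"
    if T: "T \<in> set_pmf (map_pmf fst (pack i ?w))" for T
  proof -
    define s2 where "s2 = write_set ?N ''T'' T s1"
    have n2: "nats s2 ''n'' 0 = ?N" using n by (simp add: s2_def s1_def write_set_def)
    let ?S = "S(i := {j \<in> T. 0 < gain k A Q B S i j})"
    define s3 where "s3 = s2\<lparr>nats := (nats s2)(''j'' := (nats s2 ''j'')(0 := ?N),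
         ''S'' := \<lambda>q. if nats s2 ''o'' 0 \<le> q \<and> q < nats s2 ''o'' 0 + ?N
            then of_bool (0 < nats s2 ''T'' (q - nats s2 ''o'' 0) \<and> 0 < reals s2 ''w'' (q - nats s2 ''o'' 0))
            else nats s2 ''S'' q),
       reals := (reals s2)(
         ''P'' := \<lambda>l. if l < ?N \<and> 0 < nats s2 ''T'' l \<and> 0 < reals s2 ''w'' l
            then (1 - reals s2 ''z'' 0) * reals s2 ''P'' l else reals s2 ''P'' l,
         ''E'' := \<lambda>l. if l < ?N \<and> 0 < nats s2 ''T'' l \<and> 0 < reals s2 ''w'' l
            then (1 - reals s2 ''z'' 0) * reals s2 ''E'' l
            + reals s2 ''z'' 0 * reals s2 ''v'' (nats s2 ''o'' 0 + l) else reals s2 ''E'' l)\<rparr>"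
    note 3 = steps_insert[OF n2, of ?N pack, folded s3_def]
    let ?P = "Seq (incr ''cnt'') (Seq (NStore ''app'' (var ''b'') (var ''i'')) (incr ''b''))"
    define s4 where "s4 = eff ?P s3"
    have 4: "steps ?N pack ?P s3 s4 30"
      unfolding s4_def by (rule steps_weaken[OF steps_straight]) (auto simp: incr_def)
    have s4: "s4 = s3\<lparr>nats := (nats s3)(''cnt'' := (nats s3 ''cnt'')(0 := Suc (nats s3 ''cnt'' 0)),
        ''app'' := (nats s3 ''app'')(nats s3 ''b'' 0 := nats s3 ''i'' 0),
        ''b'' := (nats s3 ''b'')(0 := Suc (nats s3 ''b'' 0)))\<rparr>"
      unfolding s4_def incr_def by (auto simp: write_defs fun_eq_iff intro!: memory_eqI)
    define s5 where "s5 = write_nat ''r'' 0 (Suc (length A + length B)) s4"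
    have s5: "s5 = s4\<lparr>nats := (nats s4)(''r'' := (nats s4 ''r'')(0 := Suc (length A + length B)))\<rparr>"
      by (simp add: s5_def write_defs)
    have ok: "ok Q (st T)"
      using T by (intro refresh_support(2)[OF okc \<open>c < cap\<close>]) (auto simp: refresh_def st_def)
    note mem = s1_def s2_def s3_def s4 s5 write_set_def
    have w2: "reals s2 ''w'' j = gain k A Q B S i j" if "j < ?N" for j
      using w[OF that] by (simp add: s2_def write_set_def)
    have T2: "0 < nats s2 ''T'' j \<longleftrightarrow> j \<in> T" if "j < ?N" for j
      using that by (simp add: s2_def write_set_def)
    have o2: "nats s2 ''o'' 0 = i * ?N" using inv by (simp add: s2_def s1_def write_set_def peeled_def)
    have data: "data ?S (Suc c) s5"
      unfolding data_def
    proof (intro conjI allI impI)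
      fix i' j assume ij: "i' < bins I" "j < ?N"
      have "0 < nats s ''S'' (i' * ?N + j) \<longleftrightarrow> j \<in> S i'"
        using inv ij by (auto simp: peeled_def data_def)
      moreover have "nats s5 ''S'' (i' * ?N + j) = nats s3 ''S'' (i' * ?N + j)"
        "nats s2 ''S'' (i' * ?N + j) = nats s ''S'' (i' * ?N + j)"
        by (simp_all add: mem)
      moreover have "nats s3 ''S'' (i' * ?N + j) = (if i' = i
          then of_bool (j \<in> T \<and> 0 < gain k A Q B S i j) else nats s2 ''S'' (i' * ?N + j))"
        unfolding s3_def using row_index[of j ?N i i'] ij w2[of j] T2[of j] o2 by simp
      ultimately show "0 < nats s5 ''S'' (i' * ?N + j) \<longleftrightarrow> j \<in> ?S i'" by simp
    qed (use inv in \<open>auto simp: mem peeled_def data_def\<close>)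
    have maps: "maps k A Q (B @ [i]) ?S s5"
      unfolding maps_def
    proof (intro allI impI)
      fix j assume j: "j < ?N"
      have v: "reals s2 ''v'' (i * ?N + j) = worth I i j" "reals s2 ''z'' 0 = level (Suc k)"
        using inv i j by (auto simp: mem peeled_def data_def probs_def)
      have m: "reals s2 ''p'' j = mean_worth (worth I) S j (level (Suc k)) A 0"
        "reals s2 ''P'' j = miss_prob S j (level k) Q * miss_prob S j (level (Suc k)) B"
        "reals s2 ''E'' j = mean_worth (worth I) S j (level (Suc k)) B (mean_worth (worth I) S j (level k) Q 0)"
        using inv j by (auto simp: mem peeled_def maps_def)
      show "reals s5 ''p'' j = mean_worth (worth I) ?S j (level (Suc k)) A 0 \<and>
         reals s5 ''P'' j = miss_prob ?S j (level k) Q * miss_prob ?S j (level (Suc k)) (B @ [i]) \<and>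
         reals s5 ''E'' j = mean_worth (worth I) ?S j (level (Suc k)) (B @ [i])
            (mean_worth (worth I) ?S j (level k) Q 0)"
        using i j v m w2[OF j] T2[OF j] o2 by (simp add: s3_def s4 s5)
    qed
    have "pass_inv k Q (st T) s5"
      using inv ok data maps unfolding pass_inv_def st_def
      by (auto simp: mem peeled_def lists_def probs_def nth_append less_Suc_eq)
    moreover have "nats s4 ''r'' 0 = length A + length B"
      using inv by (simp add: mem peeled_def lists_def)
    moreover have "steps ?N pack ?rest s2 s4 (100 * ?N + 40)"
      by (rule steps_weaken[OF steps_Seq[OF 3 4]]) simp
    ultimately show ?thesis unfolding s5_def s2_def by blast
  qed
  \<comment> \<open>The extra \<open>100 * ?N + 9\<close> reserves time for the weighing loop, which
    precedes this part.\<close>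
  have "sim ?N pack (Seq (CallPack (var ''i'') ''w'' ''T'') ?rest) s1
      (map_pmf fst (pack i ?w) \<bind> (\<lambda>T. return_pmf (st T))) (\<lambda>s' t st'. R s' (t + (100 * ?N + 9)) st')"
  proof (rule sim_bind[OF call], elim conjE)
    fix s2 t T
    assume s2: "s2 = write_set ?N ''T'' T s1" and t: "t \<le> 3 + ?N + nat \<lfloor>\<tau>\<rfloor>"
      and T: "T \<in> set_pmf (map_pmf fst (pack i ?w))"
    obtain s' where s': "steps ?N pack ?rest s2 s' (100 * ?N + 40)"
      "pass_inv k Q (st T) (write_nat ''r'' 0 (Suc (length A + length B)) s')"
      "nats s' ''r'' 0 = length A + length B" using rest[OF T] s2 by blast
    show "sim ?N pack ?rest s2 (return_pmf (st T)) (\<lambda>s'' t'. R s'' (t + t' + (100 * ?N + 9)))"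
      by (rule sim_steps[OF s'(1)]) (use s' t in \<open>auto simp: R_def st_def\<close>)
  qed
  then have "sim ?N pack refresh_com s (map_pmf fst (pack i ?w) \<bind> (\<lambda>T. return_pmf (st T))) R"
    unfolding refresh_com_def
    by (intro sim_steps_Seq[OF 1]) (auto elim!: sim_mono simp: R_def)
  moreover have "refresh k i Q (A, B, S, c) = map_pmf fst (pack i ?w) \<bind> (\<lambda>T. return_pmf (st T))"
    unfolding refresh_def st_def prod.case map_pmf_def ..
  ultimately show ?thesis unfolding R_def by simp
qed


abbreviation "call_time \<equiv> items I + nat \<lfloor>\<tau>\<rfloor>"

lemma sim_bin_com:
  assumes k: "k < L" and inv: "pass_inv k (i # Q) st s"
  shows "sim (items I) pack bin_com s (bin_step k i Q st)
    (\<lambda>s' t st'. pass_inv k Q st' (write_nat ''r'' 0 (Suc (nats s ''r'' 0)) s') \<and>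
       nats s' ''r'' 0 = nats s ''r'' 0 \<and>
       t + call_time * snd (snd (snd st)) \<le> 300 * items I + 150 + call_time * snd (snd (snd st')))"
proof -
  obtain A B S c where st: "st = (A, B, S, c)" by (cases st) auto
  have r: "nats s ''r'' 0 = length A + length B"
    using inv by (simp add: st pass_inv_def lists_def)
  obtain s1 where s1: "steps (items I) pack (Seq fetch (items_loop peel_body)) s s1 (100 * items I + 30)"
    "peeled k i Q (A, B, S, c) s1"
    using steps_fetch_peel[OF k inv[unfolded st]] by blast
  \<comment> \<open>The counter was incremented at the start of the round, so the draw is from
    \<open>Suc k\<close> values and a refresh has probability \<open>1 / Suc k\<close>.\<close>
  have k1: "nval (var ''k'') s1 = Suc k" using s1 by (simp add: peeled_def probs_def)
  let ?R = "\<lambda>s' t st'. pass_inv k Q st' (write_nat ''r'' 0 (Suc (length A + length B)) s') \<and>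
       nats s' ''r'' 0 = length A + length B \<and>
       t + call_time * c \<le> 300 * items I + 150 + call_time * snd (snd (snd st'))"
  show ?thesis unfolding bin_com_def r st prod.sel
  proof (rule sim_steps_Seq[OF s1(1)])
    fix t0 assume t0: "t0 \<le> 100 * items I + 30"
    have "sim (items I) pack (Random ''x'' (Lit 0) (var ''k'')) s1
        (pmf_of_set {..<max 1 (nval (var ''k'') s1)})
        (\<lambda>s2 t x. s2 = write_nat ''x'' 0 x s1 \<and> t = 4)"
      by (rule sim_Random) simp
    then have 2: "sim (items I) pack (Random ''x'' (Lit 0) (var ''k'')) s1 (pmf_of_set {..<Suc k})
        (\<lambda>s2 t x. s2 = write_nat ''x'' 0 x s1 \<and> t = 4)"
      unfolding k1 by simp
    show "sim (items I) pack (Seq (Random ''x'' (Lit 0) (var ''k''))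
         (Cond (Conj (NLess (var ''x'') (Lit 1)) (NLess (var ''cnt'') (var ''cap''))) refresh_com keep_com))
       s1 (bin_step k i Q (A, B, S, c)) (\<lambda>s'' t'. ?R s'' (t0 + t'))"
      unfolding bin_step_def prod.sel
    proof (rule sim_bind[OF 2], rule sim_Cond, elim conjE)
      fix s2 t x assume s2: "s2 = write_nat ''x'' 0 x s1" and t: "t = (4::nat)"
      let ?b = "Conj (NLess (var ''x'') (Lit 1)) (NLess (var ''cnt'') (var ''cap''))"
      have p2: "peeled k i Q (A, B, S, c) s2"
        using s1(2) by (simp add: s2 peeled_def data_def lists_def probs_def maps_def write_nat_def)
      have b: "bval ?b s2 \<longleftrightarrow> x = 0 \<and> c < cap"
        using s1(2) by (simp add: s2 peeled_def data_def write_nat_def)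
      show "sim (items I) pack (if bval ?b s2 then refresh_com else keep_com) s2
          (if x = 0 \<and> c < cap then refresh k i Q (A, B, S, c) else return_pmf (keep k i (A, B, S, c)))
          (\<lambda>s' t'. ?R s' (t0 + (t + (1 + bcost ?b + t'))))"
      proof (cases "x = 0 \<and> c < cap")
        case True
        then have "c < cap" by simp
        from sim_refresh_com[OF p2 this] show ?thesis
          unfolding b using True t0 t by (auto elim!: sim_mono)
      next
        case False
        obtain s' where s': "steps (items I) pack keep_com s2 s' (100 * items I + 30)"
          "pass_inv k Q (keep k i (A, B, S, c)) (write_nat ''r'' 0 (Suc (length A + length B)) s')"
          "nats s' ''r'' 0 = length A + length B"
          using steps_keep_com[OF p2] by blast
        have "sim (items I) pack keep_com s2 (return_pmf (keep k i (A, B, S, c)))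
            (\<lambda>s' t'. ?R s' (t0 + (t + (1 + bcost ?b + t'))))"
          by (rule sim_steps[OF s'(1)]) (use s' t0 t in \<open>auto simp: keep_def\<close>)
        then show ?thesis unfolding b if_not_P[OF False] .
      qed
    qed
  qed
qed

lemma sim_pass:
  assumes k: "k < L" and inv: "pass_inv k R ([], [], S, c) (write_nat ''r'' 0 0 s)"
  shows "sim (items I) pack (For ''r'' ''m'' bin_com) s (pass k R ([], [], S, c))
    (\<lambda>s' t st. pass_inv k [] st s' \<and>
       t + call_time * c \<le> bins I * (300 * items I + 170) + 20 + call_time * snd (snd (snd st)))"
proof -
  let ?b = "NLess (var ''r'') (var ''m'')"
  let ?P = "Seq bin_com (NStore ''r'' (Lit 0) (NAdd (var ''r'') (Lit 1)))"
  define Inv where "Inv i s st \<longleftrightarrow> pass_inv k (drop i R) st s \<and> nats s ''r'' 0 = i" for i s st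
  \<comment> \<open>170 covers the 150 of a bin step and 12 for guard and increment of the
    loop.\<close>
  define tm where "tm i st = i * (300 * items I + 170) + call_time * snd (snd (snd st))"
    for i and st :: "nat list \<times> nat list \<times> (nat \<Rightarrow> nat set) \<times> nat"
  have m: "length R = bins I"
    using inv by (auto simp: pass_inv_def ok_def dest: distinct_card)
  have "sim (items I) pack (While ?b ?P) (write_nat ''r'' 0 0 s) (pass k (drop 0 R) ([], [], S, c))
    (\<lambda>s' t st. Inv (bins I) s' st \<and> t + tm 0 ([], [], S, c) \<le> tm (bins I) st + 1 + bcost ?b)"
  proof (rule sim_While[where M = "\<lambda>i. pass k (drop i R)"
        and K = "\<lambda>i. bin_step k (R ! i) (drop (Suc i) R)"])
    show "bval ?b s \<longleftrightarrow> i < bins I" if "Inv i s st" for i s st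
      using that by (cases st) (auto simp: Inv_def pass_inv_def data_def)
    fix i s st assume i: "i < bins I" and Inv: "Inv i s st"
    have dr: "drop i R = R ! i # drop (Suc i) R" using i m by (simp add: Cons_nth_drop_Suc)
    have inv': "pass_inv k (R ! i # drop (Suc i) R) st s" and r: "nats s ''r'' 0 = i"
      using Inv by (simp_all add: Inv_def dr)
    show "sim (items I) pack ?P s (bin_step k (R ! i) (drop (Suc i) R) st)
        (\<lambda>s' t st'. Inv (Suc i) s' st' \<and> t + 1 + bcost ?b + tm i st \<le> tm (Suc i) st')"
    proof (rule sim_Seq_steps[OF sim_bin_com[OF k inv']], unfold r, elim conjE)
      fix s' t st'
      assume s': "pass_inv k (drop (Suc i) R) st' (write_nat ''r'' 0 (Suc i) s')" "nats s' ''r'' 0 = i"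
        and t: "t + call_time * snd (snd (snd st)) \<le> 300 * items I + 150 + call_time * snd (snd (snd st'))"
      have "steps (items I) pack (NStore ''r'' (Lit 0) (NAdd (var ''r'') (Lit 1))) s'
          (write_nat ''r'' 0 (Suc i) s') 6"
        using steps_straight[of "NStore ''r'' (Lit 0) (NAdd (var ''r'') (Lit 1))" "items I" pack s'] s'(2)
        by (simp add: numeral_eq_Suc)
      moreover have "Inv (Suc i) (write_nat ''r'' 0 (Suc i) s') st'"
        using s' by (simp add: Inv_def write_nat_def)
      ultimately show "\<exists>s'' c. steps (items I) pack (NStore ''r'' (Lit 0) (NAdd (var ''r'') (Lit 1))) s' s'' c \<and>
          (\<forall>t'\<le>c. Inv (Suc i) s'' st' \<and> t + t' + 1 + bcost ?b + tm i st \<le> tm (Suc i) st')"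
        using t by (intro exI conjI allI impI) (auto simp: tm_def)
    qed
  next
    show "pass k (drop i R) a = bin_step k (R ! i) (drop (Suc i) R) a \<bind> pass k (drop (Suc i) R)"
      if "i < bins I" for i a
      using that m by (simp flip: Cons_nth_drop_Suc)
  next
    show "pass k (drop (bins I) R) a = return_pmf a" for a by (simp add: m)
    show "Inv 0 (write_nat ''r'' 0 0 s) ([], [], S, c)"
      using inv by (simp add: Inv_def write_nat_def)
  qed simp
  then have loop: "sim (items I) pack (While ?b ?P) (write_nat ''r'' 0 0 s) (pass k R ([], [], S, c))
    (\<lambda>s' t st. Inv (bins I) s' st \<and> t + tm 0 ([], [], S, c) \<le> tm (bins I) st + 1 + bcost ?b)"
    by simp
  have 0: "steps (items I) pack (NStore ''r'' (Lit 0) (Lit 0)) s (write_nat ''r'' 0 0 s) 3"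
    using steps_straight[of "NStore ''r'' (Lit 0) (Lit 0)" "items I" pack s] by (simp add: numeral_eq_Suc)
  show ?thesis unfolding For_def
    by (rule sim_steps_Seq[OF 0], rule sim_mono[OF loop]) (auto simp: Inv_def tm_def m)
qed

text \<open>Starting from the identity map, appending the bins in list order builds the affine map
  of the whole list, which the next loop consumes from the front by peeling.\<close>

lemma steps_scan_com:
  assumes R: "set R \<subseteq> {..<bins I}" "length R = bins I"
    and s: "data S c s" "probs k s" "nats s ''a'' 0 = 0" "nats s ''b'' 0 = 0" "\<forall>l<bins I. nats s ''ord'' l = R ! l"
      "\<forall>j<items I. reals s ''p'' j = 0 \<and> reals s ''P'' j = 1 \<and> reals s ''E'' j = 0"
  shows "\<exists>s'. steps n pk (For ''r'' ''m'' (Seq fetch (items_loop scan_body))) s s'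
      ((100 * items I + 45) * bins I + 9) \<and> data S c s' \<and> probs k s' \<and> nats s' ''a'' 0 = 0 \<and> nats s' ''b'' 0 = 0 \<and>
      (\<forall>l<bins I. nats s' ''ord'' l = R ! l) \<and> maps k [] R [] S s'"
proof -
  let ?N = "items I"
  define Inv where "Inv r s' \<longleftrightarrow> data S c s' \<and> probs k s' \<and> nats s' ''a'' 0 = 0 \<and> nats s' ''b'' 0 = 0 \<and>
    (\<forall>l<bins I. nats s' ''ord'' l = R ! l) \<and> nats s' ''r'' 0 = r \<and>
    maps k [] (take r R) [] S s'" for r s'
  have "\<exists>s'. steps n pk (For ''r'' ''m'' (Seq fetch (items_loop scan_body))) s s'
      (((100 * ?N + 33) + 12) * bins I + 9) \<and> Inv (bins I) s'"
  proof (rule steps_For)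
    show "Inv 0 (write_nat ''r'' 0 0 s)"
      using s by (simp add: Inv_def data_def probs_def maps_def write_nat_def)
    show "nats s ''r'' 0 = r \<and> nats s ''m'' 0 = bins I" if "Inv r s" for r s
      using that by (simp add: Inv_def data_def)
    fix r s assume r: "r < bins I" and inv: "Inv r s"
    define i where "i = R ! r"
    have i: "i < bins I" using r R unfolding i_def by (metis lessThan_iff nth_mem subsetD)
    have row: "nats s ''row'' i = i * ?N" using inv i by (simp add: Inv_def data_def)
    define s1 where "s1 = s\<lparr>nats := (nats s)(''i'' := (nats s ''i'')(0 := i), ''o'' := (nats s ''o'')(0 := i * ?N))\<rparr>"
    have "eff fetch s = s1"
      unfolding fetch_def s1_def using inv row r
      by (auto simp: write_defs fun_eq_iff Inv_def i_def intro!: memory_eqI)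
    then have 1: "steps n pk fetch s s1 20"
      using steps_straight[of fetch n pk s] by (auto simp: fetch_def elim: steps_weaken)
    have "nats s1 ''n'' 0 = ?N" using inv by (simp add: s1_def Inv_def data_def)
    note 2 = steps_scan[OF this, of n pk]
    define s2 where "s2 = s1\<lparr>nats := (nats s1)(''j'' := (nats s1 ''j'')(0 := ?N)),
       reals := (reals s1)(
         ''P'' := \<lambda>l. if l < ?N \<and> 0 < nats s1 ''S'' (nats s1 ''o'' 0 + l)
            then (1 - reals s1 ''y'' 0) * reals s1 ''P'' l else reals s1 ''P'' l,
         ''E'' := \<lambda>l. if l < ?N \<and> 0 < nats s1 ''S'' (nats s1 ''o'' 0 + l)
            then (1 - reals s1 ''y'' 0) * reals s1 ''E'' l
            + reals s1 ''y'' 0 * reals s1 ''v'' (nats s1 ''o'' 0 + l) else reals s1 ''E'' l)\<rparr>"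
    have take: "take (Suc r) R = take r R @ [i]"
      using r R by (simp add: take_Suc_conv_app_nth i_def)
    have "maps k [] (take (Suc r) R) [] S s2"
      unfolding maps_def
    proof (intro allI impI)
      fix j assume j: "j < ?N"
      have S: "0 < nats s ''S'' (i * ?N + j) \<longleftrightarrow> j \<in> S i" "reals s ''v'' (i * ?N + j) = worth I i j"
        and y: "reals s ''y'' 0 = level k"
        using inv i j by (auto simp: Inv_def data_def probs_def)
      have "reals s ''p'' j = 0" "reals s ''P'' j = miss_prob S j (level k) (take r R)"
        "reals s ''E'' j = mean_worth (worth I) S j (level k) (take r R) 0"
        using inv j by (auto simp: Inv_def maps_def)
      then show "reals s2 ''p'' j = mean_worth (worth I) S j (level (Suc k)) [] 0 \<and>
         reals s2 ''P'' j = miss_prob S j (level k) (take (Suc r) R) * miss_prob S j (level (Suc k)) [] \<and>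
         reals s2 ''E'' j = mean_worth (worth I) S j (level (Suc k)) []
            (mean_worth (worth I) S j (level k) (take (Suc r) R) 0)"
        using j S y by (simp add: take s2_def s1_def)
    qed
    then have "Inv (Suc r) (write_nat ''r'' 0 (Suc r) s2)"
      using inv unfolding Inv_def
      by (simp add: s2_def s1_def data_def probs_def maps_def write_nat_def)
    moreover have "nats s2 ''r'' 0 = r" using inv by (simp add: s2_def s1_def Inv_def)
    moreover have "steps n pk (Seq fetch (items_loop scan_body)) s s2 (100 * ?N + 33)"
      unfolding s2_def by (rule steps_weaken[OF steps_Seq[OF 1 2]]) simp
    ultimately show "\<exists>s'. steps n pk (Seq fetch (items_loop scan_body)) s s' (100 * ?N + 33) \<and>
        nats s' ''r'' 0 = r \<and> Inv (Suc r) (write_nat ''r'' 0 (Suc r) s')" by blast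
  qed
  then obtain s' where s': "Inv (bins I) s'"
    "steps n pk (For ''r'' ''m'' (Seq fetch (items_loop scan_body))) s s' (((100 * ?N + 33) + 12) * bins I + 9)"
    by blast
  have "steps n pk (For ''r'' ''m'' (Seq fetch (items_loop scan_body))) s s' ((100 * ?N + 45) * bins I + 9)"
    by (rule steps_weaken[OF s'(2)]) simp
  then show ?thesis using s'(1) R(2) by (auto simp: Inv_def)
qed

definition round_inv :: "nat \<Rightarrow> memory \<Rightarrow> nat list \<times> (nat \<Rightarrow> nat set) \<times> nat \<Rightarrow> bool" where
  "round_inv k s = (\<lambda>(R, S, c). ok [] (R, [], S, c) \<and> data S c s \<and> nats s ''k'' 0 = k \<and>
     (\<forall>l<bins I. nats s ''ord'' l = R ! l))"

lemma steps_append_com: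
  assumes inv: "pass_inv k [] (A, B, S, c) s"
  shows "\<exists>s'. steps n pk (For ''r'' ''b'' append_com) s s' (32 * bins I + 9)
    \<and> round_inv (Suc k) s' (A @ B, S, c)"
proof -
  have "distinct (A @ B)" "set (A @ B) = {..<bins I}" using inv by (simp_all add: pass_inv_def ok_def)
  then have len: "length A + length B = bins I" by (metis card_lessThan distinct_card length_append)
  define Inv where "Inv r s' \<longleftrightarrow> data S c s' \<and> nats s' ''k'' 0 = Suc k \<and> nats s' ''a'' 0 = length A \<and>
     nats s' ''b'' 0 = length B \<and> nats s' ''r'' 0 = r \<and> (\<forall>l<length B. nats s' ''app'' l = B ! l) \<and>
     (\<forall>l<length A + r. nats s' ''ord'' l = (A @ B) ! l)" for r s'
  have "\<exists>s'. steps n pk (For ''r'' ''b'' append_com) s s' ((20 + 12) * length B + 9) \<and> Inv (length B) s'"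
  proof (rule steps_For)
    show "Inv 0 (write_nat ''r'' 0 0 s)"
      using inv by (auto simp: Inv_def pass_inv_def data_def probs_def lists_def write_nat_def nth_append)
    show "nats s ''r'' 0 = r \<and> nats s ''b'' 0 = length B" if "Inv r s" for r s
      using that by (simp add: Inv_def)
    fix r s assume r: "r < length B" and inv: "Inv r s"
    define s' where "s' = eff append_com s"
    have "s' = s\<lparr>nats := (nats s)(''ord'' := (nats s ''ord'')(length A + r := B ! r))\<rparr>"
      using inv r unfolding s'_def append_com_def
      by (auto simp: write_defs fun_eq_iff Inv_def intro!: memory_eqI)
    then have "nats s' ''r'' 0 = r \<and> Inv (Suc r) (write_nat ''r'' 0 (Suc r) s')"
      using inv by (auto simp: Inv_def data_def write_nat_def nth_append less_Suc_eq)
    moreover have "steps n pk append_com s s' 20"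
      unfolding s'_def by (rule steps_weaken[OF steps_straight]) (auto simp: append_com_def)
    ultimately show "\<exists>s'. steps n pk append_com s s' 20 \<and> nats s' ''r'' 0 = r \<and>
        Inv (Suc r) (write_nat ''r'' 0 (Suc r) s')" by blast
  qed
  then obtain s' where s': "Inv (length B) s'"
    "steps n pk (For ''r'' ''b'' append_com) s s' ((20 + 12) * length B + 9)" by blast
  have "steps n pk (For ''r'' ''b'' append_com) s s' (32 * bins I + 9)"
    by (rule steps_weaken[OF s'(2)]) (use len in simp)
  moreover have "round_inv (Suc k) s' (A @ B, S, c)"
    using s'(1) inv len by (auto simp: round_inv_def Inv_def pass_inv_def ok_def)
  ultimately show ?thesis by blast
qed

lemma sim_round_com:
  assumes k: "k < L" and inv: "round_inv k s (R, S, c)"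
  shows "sim (items I) pack (round_com L) s (round k (R, S, c))
    (\<lambda>s' t st. round_inv (Suc k) s' st \<and> t + call_time * c \<le>
       bins I * (400 * items I + 250) + 100 * items I + 110 + call_time * snd (snd st))"
proof -
  let ?N = "items I"
  let ?H = "Seq (RStore ''y'' (Lit 0) (RDiv (OfNat (var ''k'')) (OfNat (Lit L))))
       (Seq (incr ''k'')
       (Seq (RStore ''z'' (Lit 0) (RDiv (OfNat (var ''k'')) (OfNat (Lit L))))
       (Seq (NStore ''a'' (Lit 0) (Lit 0)) (NStore ''b'' (Lit 0) (Lit 0)))))"
  have R: "set R = {..<bins I}" "length R = bins I" and ok: "ok R ([], [], S, c)"
    using inv by (auto simp: round_inv_def ok_def dest: distinct_card)
  define s1 where "s1 = eff ?H s"
  have 1: "steps ?N pack ?H s s1 40"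
    unfolding s1_def by (rule steps_weaken[OF steps_straight]) (auto simp: incr_def)
  have s1: "data S c s1" "probs k s1" "nats s1 ''a'' 0 = 0" "nats s1 ''b'' 0 = 0"
    "\<forall>l<bins I. nats s1 ''ord'' l = R ! l"
    using inv by (auto simp: s1_def incr_def write_defs round_inv_def data_def probs_def level_def)
  have n1: "nats s1 ''n'' 0 = ?N" using s1 by (simp add: data_def)
  define s2 where "s2 = s1\<lparr>nats := (nats s1)(''j'' := (nats s1 ''j'')(0 := ?N)),
       reals := (reals s1)(''p'' := \<lambda>l. if l < ?N then 0 else reals s1 ''p'' l,
         ''P'' := \<lambda>l. if l < ?N then 1 else reals s1 ''P'' l,
         ''E'' := \<lambda>l. if l < ?N then 0 else reals s1 ''E'' l)\<rparr>"
  note 2 = steps_clear[OF n1, of ?N pack, folded s2_def]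
  have s2: "data S c s2" "probs k s2" "nats s2 ''a'' 0 = 0" "nats s2 ''b'' 0 = 0"
    "\<forall>l<bins I. nats s2 ''ord'' l = R ! l"
    "\<forall>j<?N. reals s2 ''p'' j = 0 \<and> reals s2 ''P'' j = 1 \<and> reals s2 ''E'' j = 0"
    using s1 by (simp_all add: s2_def data_def probs_def)
  obtain s3 where 3: "steps ?N pack (For ''r'' ''m'' (Seq fetch (items_loop scan_body))) s2 s3
      ((100 * ?N + 45) * bins I + 9)"
    and s3: "data S c s3" "probs k s3" "nats s3 ''a'' 0 = 0" "nats s3 ''b'' 0 = 0"
    "\<forall>l<bins I. nats s3 ''ord'' l = R ! l" "maps k [] R [] S s3"
    using steps_scan_com[OF _ R(2) s2] R by blast
  have "pass_inv k R ([], [], S, c) (write_nat ''r'' 0 0 s3)"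
    using s3 ok R(2) by (simp add: pass_inv_def data_def probs_def lists_def maps_def write_nat_def)
  note 4 = sim_pass[OF k this]
  show ?thesis
    unfolding round_com_def round_def prod.case
  proof (rule sim_map, rule sim_steps_Seq[OF 1], rule sim_steps_Seq[OF 2], rule sim_steps_Seq[OF 3],
      rule sim_Seq_steps[OF 4], elim conjE)
    fix t1 t2 t3 t :: nat and s' st
    assume t: "t1 \<le> 40" "t2 \<le> 100 * ?N + 9" "t3 \<le> (100 * ?N + 45) * bins I + 9"
      "t + call_time * c \<le> bins I * (300 * ?N + 170) + 20 + call_time * snd (snd (snd st))"
      and s': "pass_inv k [] st s'"
    obtain A B S' c' where st: "st = (A, B, S', c')" by (cases st) auto
    obtain s'' where s'': "steps ?N pack (For ''r'' ''b'' append_com) s' s'' (32 * bins I + 9)"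
      "round_inv (Suc k) s'' (A @ B, S', c')"
      using steps_append_com[OF s'[unfolded st]] by blast
    show "\<exists>s'' c'. steps ?N pack (For ''r'' ''b'' append_com) s' s'' c' \<and>
      (\<forall>t'\<le>c'. round_inv (Suc k) s'' (case st of (A, B, S, c) \<Rightarrow> (A @ B, S, c)) \<and>
         t1 + (t2 + (t3 + (t + t'))) + call_time * c \<le> bins I * (400 * ?N + 250) + 100 * ?N + 110
           + call_time * snd (snd (case st of (A, B, S, c) \<Rightarrow> (A @ B, S, c))))"
    proof (intro exI conjI allI impI)
      fix t' assume "t' \<le> 32 * bins I + 9"
      then show "t1 + (t2 + (t3 + (t + t'))) + call_time * c \<le> bins I * (400 * ?N + 250) + 100 * ?N + 110
           + call_time * snd (snd (case st of (A, B, S, c) \<Rightarrow> (A @ B, S, c)))"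
        using t unfolding st by (simp add: algebra_simps)
    qed (use s'' in \<open>simp_all add: st\<close>)
  qed
qed

end

section \<open>The returned solution and the running time\<close>

primrec label :: "(nat \<Rightarrow> nat set) \<Rightarrow> nat \<Rightarrow> nat list \<Rightarrow> nat \<Rightarrow> nat" where
  "label S j [] x = x"
| "label S j (i # is) x = label S j is (if j \<in> S i then Suc i else x)"

lemma label_append [simp]: "label S j (is @ is') x = label S j is' (label S j is x)"
  by (induction "is" arbitrary: x) auto

lemma label_cases: "label S j is x = x \<or> (\<exists>i\<in>set is. label S j is x = Suc i \<and> j \<in> S i)"
proof (induction "is" arbitrary: x)
  case (Cons i "is")
  from Cons[of "if j \<in> S i then Suc i else x"] show ?case by auto
qed simp

text \<open>At activation probability 1 every bin containing the item overwrites its value, so the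
  mean is the worth in the last such bin. Label 0 stands for an unassigned item of value 0.\<close>

lemma mean_worth_1:
  "mean_worth v S j 1 is (case x of 0 \<Rightarrow> 0 | Suc i \<Rightarrow> v i j)
     = (case label S j is x of 0 \<Rightarrow> 0 | Suc i \<Rightarrow> v i j)"
proof (induction "is" arbitrary: x)
  case (Cons i "is")
  from Cons[of x] Cons[of "Suc i"] show ?case by simp
qed simp

text \<open>Exchange of the sums over bins and items. The assumption excludes labels of nonexistent
  bins, which only the right side would count.\<close>

lemma assigned_worth:
  assumes "\<And>j. j < items I \<Longrightarrow> nats s ''out'' j \<le> bins I"
  shows "solution_worth I (assigned I s)
    = (\<Sum>j<items I. case nats s ''out'' j of 0 \<Rightarrow> 0 | Suc i \<Rightarrow> worth I i j)"
proof -
  have "solution_worth I (assigned I s)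
      = (\<Sum>i<bins I. \<Sum>j<items I. if nats s ''out'' j = Suc i then worth I i j else 0)"
    unfolding solution_worth_def assigned_def
    by (rule sum.cong[OF refl]) (simp flip: sum.inter_filter)
  also have "\<dots> = (\<Sum>j<items I. \<Sum>i<bins I. if nats s ''out'' j = Suc i then worth I i j else 0)"
    by (rule sum.swap)
  also have "\<dots> = (\<Sum>j<items I. case nats s ''out'' j of 0 \<Rightarrow> 0 | Suc i \<Rightarrow> worth I i j)"
  proof (intro sum.cong refl)
    fix j assume "j \<in> {..<items I}"
    then have "nats s ''out'' j \<le> bins I" using assms by simp
    then show "(\<Sum>i<bins I. if nats s ''out'' j = Suc i then worth I i j else 0)
        = (case nats s ''out'' j of 0 \<Rightarrow> 0 | Suc i \<Rightarrow> worth I i j)"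
      by (cases "nats s ''out'' j") auto
  qed
  finally show ?thesis .
qed

context lazy_greedy
begin

primrec rounds_from ::
  "nat \<Rightarrow> nat \<Rightarrow> nat list \<times> (nat \<Rightarrow> nat set) \<times> nat \<Rightarrow> (nat list \<times> (nat \<Rightarrow> nat set) \<times> nat) pmf" where
  "rounds_from 0 k a = return_pmf a"
| "rounds_from (Suc d) k a = round k a \<bind> rounds_from d (Suc k)"

text \<open>\<open>rounds\<close> grows at the end, whereas a loop unfolds from the front as
  \<open>rounds_from\<close> does; associativity of bind reconciles the two.\<close>

lemma rounds_add: "rounds (k + d) = rounds k \<bind> rounds_from d k"
proof (induction d arbitrary: k)
  case 0
  have "rounds_from 0 k = return_pmf" by (rule ext) simp
  then show ?case by (simp add: bind_return_pmf')
next
  case (Suc d)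
  have "rounds_from (Suc d) k = (\<lambda>a. round k a \<bind> rounds_from d (Suc k))" by (rule ext) simp
  then show ?case using Suc[of "Suc k"] by (simp add: bind_assoc_pmf)
qed

lemma steps_init:
  assumes "cap = bins I * b"
  shows "\<exists>s'. steps n pk (For ''r'' ''m'' (init_body b)) (initial I \<epsilon>) s' (52 * bins I + 9)
    \<and> round_inv 0 s' ([0..<bins I], (\<lambda>_. {}), 0)"
proof -
  let ?N = "items I"
  define Inv where "Inv r s \<longleftrightarrow> nats s ''n'' 0 = ?N \<and> nats s ''m'' 0 = bins I \<and> nats s ''r'' 0 = r \<and>
    (\<forall>l\<le>r. nats s ''row'' l = l * ?N) \<and> (\<forall>l<r. nats s ''ord'' l = l) \<and> nats s ''cap'' 0 = r * b \<and>
    nats s ''S'' = (\<lambda>_. 0) \<and> nats s ''k'' 0 = 0 \<and> nats s ''cnt'' 0 = 0 \<and> nats s ''out'' = (\<lambda>_. 0) \<and>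
    reals s ''v'' = reals (initial I \<epsilon>) ''v''" for r and s :: memory
  have "\<exists>s'. steps n pk (For ''r'' ''m'' (init_body b)) (initial I \<epsilon>) s' ((40 + 12) * bins I + 9)
      \<and> Inv (bins I) s'"
  proof (rule steps_For)
    show "Inv 0 (write_nat ''r'' 0 0 (initial I \<epsilon>))"
      by (simp add: Inv_def write_nat_def initial_def fun_eq_iff)
    show "nats s ''r'' 0 = r \<and> nats s ''m'' 0 = bins I" if "Inv r s" for r s
      using that by (simp add: Inv_def)
    fix r s assume inv: "Inv r s"
    define s' where "s' = eff (init_body b) s"
    have "nats s' ''r'' 0 = r \<and> Inv (Suc r) (write_nat ''r'' 0 (Suc r) s')"
      using inv unfolding s'_def init_body_def
      by (auto simp: Inv_def write_nat_def less_Suc_eq le_Suc_eq)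
    moreover have "steps n pk (init_body b) s s' 40"
      unfolding s'_def by (rule steps_weaken[OF steps_straight]) (auto simp: init_body_def)
    ultimately show "\<exists>s'. steps n pk (init_body b) s s' 40 \<and> nats s' ''r'' 0 = r \<and>
        Inv (Suc r) (write_nat ''r'' 0 (Suc r) s')" by blast
  qed
  then obtain s' where s': "Inv (bins I) s'"
    "steps n pk (For ''r'' ''m'' (init_body b)) (initial I \<epsilon>) s' ((40 + 12) * bins I + 9)" by blast
  have v: "reals (initial I \<epsilon>) ''v'' (i * ?N + j) = worth I i j" if "i < bins I" "j < ?N" for i j
  proof -
    have "i * ?N + j < Suc i * ?N" using that by simp
    also have "\<dots> \<le> bins I * ?N" using that by (intro mult_le_mono1) simp
    finally show ?thesis using that by (simp add: initial_def)
  qed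
  have "ok [] ([0..<bins I], [], (\<lambda>_. {}), 0)"
    using sap_instanceD(7)[OF inst] by (auto simp: ok_def)
  moreover have "data (\<lambda>_. {}) 0 s'"
    unfolding data_def using s'(1) v assms by (simp add: Inv_def)
  ultimately have "round_inv 0 s' ([0..<bins I], (\<lambda>_. {}), 0)"
    using s'(1) by (simp add: round_inv_def Inv_def)
  moreover have "steps n pk (For ''r'' ''m'' (init_body b)) (initial I \<epsilon>) s' (52 * bins I + 9)"
    by (rule steps_weaken[OF s'(2)]) simp
  ultimately show ?thesis by blast
qed

lemma sim_rounds:
  assumes inv: "round_inv 0 s ([0..<bins I], (\<lambda>_. {}), 0)"
  shows "sim (items I) pack (While (NLess (var ''k'') (Lit L)) (round_com L)) s (rounds L)
    (\<lambda>s' t st. round_inv L s' st \<and> t \<le> L * (bins I * (400 * items I + 250) + 100 * items I + 120)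
       + call_time * snd (snd st) + 10)"
proof -
  let ?b = "NLess (var ''k'') (Lit L)"
  define tm where "tm i st = i * (bins I * (400 * items I + 250) + 100 * items I + 120) + call_time * snd (snd st)"
    for i and st :: "nat list \<times> (nat \<Rightarrow> nat set) \<times> nat"
  have "sim (items I) pack (While ?b (round_com L)) s (rounds_from (L - 0) 0 ([0..<bins I], (\<lambda>_. {}), 0))
    (\<lambda>s' t st. round_inv L s' st \<and> t + tm 0 ([0..<bins I], (\<lambda>_. {}), 0) \<le> tm L st + 1 + bcost ?b)"
  proof (rule sim_While[where M = "\<lambda>k. rounds_from (L - k) k" and K = round and Inv = round_inv])
    show "bval ?b s \<longleftrightarrow> k < L" if "round_inv k s a" for k s a
      using that by (auto simp: round_inv_def)
    fix k s a assume k: "k < L" "round_inv k s a"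
    obtain R S c where a: "a = (R, S, c)" by (cases a) auto
    show "sim (items I) pack (round_com L) s (round k a)
        (\<lambda>s' t a'. round_inv (Suc k) s' a' \<and> t + 1 + bcost ?b + tm k a \<le> tm (Suc k) a')"
      using sim_round_com[OF k(1) k(2)[unfolded a]] unfolding a
      by (rule sim_mono) (auto simp: tm_def)
  next
    show "rounds_from (L - k) k a = round k a \<bind> rounds_from (L - Suc k) (Suc k)" if "k < L" for k a
    proof -
      have "L - k = Suc (L - Suc k)" using that by simp
      then show ?thesis by (simp only: rounds_from.simps)
    qed
  qed (use inv in auto)
  moreover have "rounds_from (L - 0) 0 ([0..<bins I], (\<lambda>_. {}), 0) = rounds L"
    using rounds_add[of 0 L] by (simp add: bind_return_pmf)
  ultimately have "sim (items I) pack (While ?b (round_com L)) s (rounds L)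
    (\<lambda>s' t st. round_inv L s' st \<and> t + tm 0 ([0..<bins I], (\<lambda>_. {}), 0) \<le> tm L st + 1 + bcost ?b)" by simp
  then show ?thesis by (rule sim_mono) (auto simp: tm_def)
qed

lemma steps_out_com:
  assumes inv: "round_inv k s (R, S, c)"
  shows "\<exists>s'. steps n pk (For ''r'' ''m'' (Seq fetch (items_loop out_body))) s s' ((100 * items I + 45) * bins I + 9)
    \<and> (\<forall>j<items I. nats s' ''out'' j = label S j R 0)"
proof -
  let ?N = "items I"
  have "distinct R" "set R = {..<bins I}" using inv by (simp_all add: round_inv_def ok_def)
  then have R: "length R = bins I" by (metis card_lessThan distinct_card)
  define Inv where "Inv r s \<longleftrightarrow> nats s ''n'' 0 = ?N \<and> nats s ''m'' 0 = bins I \<and> nats s ''r'' 0 = r \<and>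
    (\<forall>i<bins I. nats s ''row'' i = i * ?N \<and> (\<forall>j<?N. 0 < nats s ''S'' (i * ?N + j) \<longleftrightarrow> j \<in> S i)) \<and>
    (\<forall>l<bins I. nats s ''ord'' l = R ! l) \<and> (\<forall>j<?N. nats s ''out'' j = label S j (take r R) 0)" for r and s :: memory
  have "\<exists>s'. steps n pk (For ''r'' ''m'' (Seq fetch (items_loop out_body))) s s'
      (((100 * ?N + 33) + 12) * bins I + 9) \<and> Inv (bins I) s'"
  proof (rule steps_For)
    show "Inv 0 (write_nat ''r'' 0 0 s)"
      using inv by (simp add: Inv_def round_inv_def data_def write_nat_def)
    show "nats s ''r'' 0 = r \<and> nats s ''m'' 0 = bins I" if "Inv r s" for r s
      using that by (simp add: Inv_def)
    fix r s assume r: "r < bins I" and inv: "Inv r s"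
    define i where "i = R ! r"
    have i: "i < bins I" using r R \<open>set R = {..<bins I}\<close> unfolding i_def by (metis lessThan_iff nth_mem)
    have row: "nats s ''row'' i = i * ?N" using inv i by (simp add: Inv_def)
    define s1 where "s1 = s\<lparr>nats := (nats s)(''i'' := (nats s ''i'')(0 := i), ''o'' := (nats s ''o'')(0 := i * ?N))\<rparr>"
    have "eff fetch s = s1"
      unfolding fetch_def s1_def using inv row r
      by (auto simp: write_defs fun_eq_iff Inv_def i_def intro!: memory_eqI)
    then have 1: "steps n pk fetch s s1 20"
      using steps_straight[of fetch n pk s] by (auto simp: fetch_def elim: steps_weaken)
    have "nats s1 ''n'' 0 = ?N" using inv by (simp add: s1_def Inv_def)
    note 2 = steps_out[OF this, of n pk]
    define s2 where "s2 = s1\<lparr>nats := (nats s1)(''j'' := (nats s1 ''j'')(0 := ?N),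
         ''out'' := \<lambda>l. if l < ?N \<and> 0 < nats s1 ''S'' (nats s1 ''o'' 0 + l) then nats s1 ''i'' 0 + 1
            else nats s1 ''out'' l)\<rparr>"
    have take: "take (Suc r) R = take r R @ [i]"
      using r R by (simp add: take_Suc_conv_app_nth i_def)
    have "Inv (Suc r) (write_nat ''r'' 0 (Suc r) s2)"
      using inv i unfolding Inv_def by (simp add: s2_def s1_def write_nat_def take)
    moreover have "nats s2 ''r'' 0 = r" using inv by (simp add: s2_def s1_def Inv_def)
    moreover have "steps n pk (Seq fetch (items_loop out_body)) s s2 (100 * ?N + 33)"
      unfolding s2_def by (rule steps_weaken[OF steps_Seq[OF 1 2]]) simp
    ultimately show "\<exists>s'. steps n pk (Seq fetch (items_loop out_body)) s s' (100 * ?N + 33) \<and>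
        nats s' ''r'' 0 = r \<and> Inv (Suc r) (write_nat ''r'' 0 (Suc r) s')" by blast
  qed
  then obtain s' where s': "Inv (bins I) s'"
    "steps n pk (For ''r'' ''m'' (Seq fetch (items_loop out_body))) s s' (((100 * ?N + 33) + 12) * bins I + 9)"
    by blast
  have "steps n pk (For ''r'' ''m'' (Seq fetch (items_loop out_body))) s s' ((100 * ?N + 45) * bins I + 9)"
    by (rule steps_weaken[OF s'(2)]) simp
  then show ?thesis using s'(1) R by (auto simp: Inv_def)
qed

text \<open>The sets of different bins may overlap. The labels select one bin per item, and
  down-closedness keeps what remains of each set feasible.\<close>

lemma label_solution:
  assumes ok: "ok [] (R, [], S, c)" and out: "\<And>j. j < items I \<Longrightarrow> nats s ''out'' j = label S j R 0"
  shows "feasible_solution I (assigned I s)" "solution_worth I (assigned I s) = total L R S"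
proof -
  have R: "set R = {..<bins I}" using ok by (simp add: ok_def)
  show "feasible_solution I (assigned I s)"
    unfolding feasible_solution_def
  proof (intro conjI allI impI)
    fix i assume i: "i < bins I"
    have "assigned I s i \<subseteq> S i"
    proof
      fix j assume "j \<in> assigned I s i"
      then have "j < items I" "nats s ''out'' j = Suc i" by (simp_all add: assigned_def)
      then have "label S j R 0 = Suc i" by (metis out)
      with label_cases[of S j R 0] show "j \<in> S i" by (metis nat.distinct(1) nat.inject)
    qed
    moreover have "S i \<in> feas I i" using ok i by (simp add: ok_def)
    ultimately show "assigned I s i \<in> feas I i" using sap_instanceD(4)[OF inst i] by blast
  qed (auto simp: assigned_def)
  have "nats s ''out'' j \<le> bins I" if "j < items I" for j
    unfolding out[OF that] using label_cases[of S j R 0] R by (metis Suc_leI le0 lessThan_iff)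
  from assigned_worth[OF this]
  have "solution_worth I (assigned I s)
      = (\<Sum>j<items I. case label S j R 0 of 0 \<Rightarrow> 0 | Suc i \<Rightarrow> worth I i j)"
    by (simp add: out)
  also have "\<dots> = total L R S"
    unfolding total_def
  proof (rule sum.cong[OF refl])
    fix j
    show "(case label S j R 0 of 0 \<Rightarrow> 0 | Suc i \<Rightarrow> worth I i j) = mean_worth (worth I) S j (level L) R 0"
      using mean_worth_1[of "worth I" S j R 0] by simp
  qed
  finally show "solution_worth I (assigned I s) = total L R S" .
qed

lemma sim_sap_com:
  assumes "cap = bins I * b" "0 < items I"
  shows "sim (items I) pack (sap_com L b) (initial I \<epsilon>) (rounds L)
    (\<lambda>s t (R, S, c). feasible_solution I (assigned I s) \<and> solution_worth I (assigned I s) = total L R S \<and>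
       t \<le> 1100 * (L * bins I * items I) + call_time * (bins I * b))"
proof -
  obtain s0 where 0: "steps (items I) pack (For ''r'' ''m'' (init_body b)) (initial I \<epsilon>) s0 (52 * bins I + 9)"
    and inv: "round_inv 0 s0 ([0..<bins I], (\<lambda>_. {}), 0)"
    using steps_init[OF assms(1)] by blast
  have guard: "bval (NLess (Lit 0) (var ''n'')) (initial I \<epsilon>)"
    using assms(2) by (simp add: initial_def)
  show ?thesis
    unfolding sap_com_def
  proof (rule sim_Cond, unfold if_P[OF guard], rule sim_steps_Seq[OF 0],
      rule sim_Seq_steps[OF sim_rounds[OF inv]], elim conjE)
    fix t0 t1 s1 st
    assume t0: "t0 \<le> 52 * bins I + 9" and inv: "round_inv L s1 st"
      and t1: "t1 \<le> L * (bins I * (400 * items I + 250) + 100 * items I + 120) + call_time * snd (snd st) + 10"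
    obtain R S c where st: "st = (R, S, c)" by (cases st) auto
    have ok: "ok [] (R, [], S, c)" using inv by (simp add: st round_inv_def)
    obtain s2 where s2: "steps (items I) pack (For ''r'' ''m'' (Seq fetch (items_loop out_body))) s1 s2
        ((100 * items I + 45) * bins I + 9)" and out: "\<And>j. j < items I \<Longrightarrow> nats s2 ''out'' j = label S j R 0"
      using steps_out_com[OF inv[unfolded st]] by blast
    have "1 \<le> bins I" "1 \<le> L" using L_pos sap_instanceD(1)[OF inst] by auto
    then have "bins I * 1 \<le> bins I * (L * items I)" "L * items I * 1 \<le> L * items I * bins I" "L * 1 \<le> L * (bins I * items I)"
      "1 * (bins I * items I) \<le> L * (bins I * items I)" "L * bins I * 1 \<le> L * bins I * items I"
      "1 * 1 \<le> (L * bins I) * items I"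
      using assms(2) by (intro mult_le_mono; simp)+
    then have bounds: "bins I \<le> L * bins I * items I" "L * items I \<le> L * bins I * items I" "L \<le> L * bins I * items I"
      "bins I * items I \<le> L * bins I * items I" "L * bins I \<le> L * bins I * items I" "1 \<le> L * bins I * items I"
      by (simp_all add: mult_ac)
    have "c \<le> cap" using ok by (simp add: ok_def)
    then have calls: "call_time * c \<le> call_time * (bins I * b)" using assms(1) by (metis mult_le_mono2)
    have t1': "t1 \<le> 400 * (L * bins I * items I) + 250 * (L * bins I) + 100 * (L * items I) + 120 * L
        + call_time * c + 10"
      using t1 by (simp add: st algebra_simps)
    have "(100 * items I + 45) * bins I + 9 = 100 * (bins I * items I) + 45 * bins I + 9"
      by (simp add: algebra_simps)
    note out_time = this
    have time: "1 + bcost (NLess (Lit 0) (var ''n'')) + (t0 + (t1 + t'))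
        \<le> 1100 * (L * bins I * items I) + call_time * (bins I * b)"
      if "t' \<le> (100 * items I + 45) * bins I + 9" for t'
    proof -
      \<comment> \<open>61 + 880 + 154 + 5 = 1100. Each partial product of \<open>L\<close>,
        \<open>bins I\<close> and \<open>items I\<close> is at most the full one, as all three are
        positive.\<close>
      have sum: "5 + (x + (y + z)) \<le> 1100 * M + K"
        if "x \<le> 52 * a + 9" "y \<le> 400 * M + 250 * d + 100 * e + 120 * f + g + 10" "z \<le> 100 * h + 45 * a + 9"
          "a \<le> M" "e \<le> M" "f \<le> M" "h \<le> M" "d \<le> M" "1 \<le> M" "g \<le> K"
        for x y z a d e f g h M K :: nat
      proof -
        have "x \<le> 61 * M" using that(1,4,9) by linarith
        moreover have "z \<le> 154 * M" using that(3,4,7,9) by linarith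
        moreover have "400 * M + 250 * d + 100 * e + 120 * f + 10 \<le> 880 * M" using that(5,6,8,9) by linarith
        then have "y \<le> 880 * M + K" using that(2,10) by linarith
        ultimately show ?thesis using that(9) by linarith
      qed
      have "5 + (t0 + (t1 + t')) \<le> 1100 * (L * bins I * items I) + call_time * (bins I * b)"
        by (rule sum[OF t0 t1' that[unfolded out_time] bounds calls])
      moreover have "1 + bcost (NLess (Lit 0) (var ''n'')) = 5" by simp
      ultimately show ?thesis by (simp only:)
    qed
    show "\<exists>s2 c'. steps (items I) pack (For ''r'' ''m'' (Seq fetch (items_loop out_body))) s1 s2 c' \<and>
        (\<forall>t'\<le>c'. case st of (R, S, c) \<Rightarrow> feasible_solution I (assigned I s2) \<and>
           solution_worth I (assigned I s2) = total L R S \<and>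
           1 + bcost (NLess (Lit 0) (var ''n'')) + (t0 + (t1 + t'))
             \<le> 1100 * (L * bins I * items I) + call_time * (bins I * b))"
      unfolding st prod.case using s2 label_solution[OF ok out] time by blast
  qed
qed

lemma run_sap_com:
  assumes b: "cap = bins I * b" "2 * (L + 1) * L \<le> 2 ^ b" and "0 < items I"
    and \<rho>: "\<rho> \<le> (1 - 5 / L) * (1 - exp (- \<alpha>))"
    and T: "real (1100 * (L * bins I * items I) + call_time * (bins I * b)) \<le> T"
  shows "approximates \<rho> I (run (sap_com L b) pack I \<epsilon>) \<and> runs_within T (run (sap_com L b) pack I \<epsilon>)"
proof -
  let ?ok = "\<lambda>s t (R, S, c). feasible_solution I (assigned I s) \<and>
    solution_worth I (assigned I s) = total L R S \<and>
    t \<le> 1100 * (L * bins I * items I) + call_time * (bins I * b)"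
  obtain r where r: "run (sap_com L b) pack I \<epsilon> = spmf_of_pmf r"
    "rel_pmf (\<lambda>(s, t). ?ok s t) r (rounds L)"
    using sim_sap_com[OF b(1) \<open>0 < items I\<close>] unfolding run_def sim_def by blast
  \<comment> \<open>The coupling itself: its marginals are the run and the process, so the value of
    the run and \<open>total L\<close> have the same expectation.\<close>
  obtain q where q: "\<And>x y. (x, y) \<in> set_pmf q \<Longrightarrow> case x of (s, t) \<Rightarrow> ?ok s t y"
    "map_pmf fst q = r" "map_pmf snd q = rounds L"
    using r(2) by (auto elim!: rel_pmf.cases)
  have out: "feasible_solution I (assigned I s) \<and> real t \<le> T" if "(s, t) \<in> set_pmf r" for s t
  proof -
    obtain y where "((s, t), y) \<in> set_pmf q" using \<open>(s, t) \<in> set_pmf r\<close> q(2) by auto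
    then have "?ok s t y" using q(1) by fastforce
    then have "feasible_solution I (assigned I s)"
      "t \<le> 1100 * (L * bins I * items I) + call_time * (bins I * b)" by (auto split: prod.splits)
    then show ?thesis using T by linarith
  qed
  have "(LINT st|measure_pmf r. solution_worth I (assigned I (fst st)))
      = (LINT st|measure_pmf q. solution_worth I (assigned I (fst (fst st))))"
    unfolding q(2)[symmetric] by simp
  also have "\<dots> = (LINT st|measure_pmf q. (case snd st of (R, S, c) \<Rightarrow> total L R S))"
    using q(1) by (intro integral_cong_AE) (fastforce simp: AE_measure_pmf_iff)+
  also have "\<dots> = measure_pmf.expectation (rounds L) (\<lambda>(R, S, c). total L R S)"
    unfolding q(3)[symmetric] by simp
  finally have E: "(LINT st|measure_pmf r. solution_worth I (assigned I (fst st)))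
      = measure_pmf.expectation (rounds L) (\<lambda>(R, S, c). total L R S)" .
  have "2 * (L + 1) \<le> 2 * (L + 1) * L" using L_pos by (cases L) auto
  then have "2 * (L + 1) \<le> 2 ^ b" using b(2) by (rule order_trans)
  from rounds_expectation[OF b(1) this b(2)]
  have "\<rho> * opt I \<le> (LINT st|measure_pmf r. solution_worth I (assigned I (fst st)))"
    unfolding E using mult_right_mono[OF \<rho> opt_nonneg] by linarith
  then show ?thesis
    unfolding approximates_def runs_within_def r(1) using out by auto
qed

end

section \<open>Idle runs and the choice of the parameters\<close>

lemma idle_run:
  assumes "sap_instance I" "run P A I \<epsilon> = return_spmf (s, t)" "nats s ''out'' = (\<lambda>_. 0)"
    and "\<rho> * opt I \<le> 0" "real t \<le> T"
  shows "approximates \<rho> I (run P A I \<epsilon>) \<and> runs_within T (run P A I \<epsilon>)"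
proof -
  have "assigned I s = (\<lambda>_. {})" using assms(3) by (auto simp: assigned_def)
  moreover have "feasible_solution I (\<lambda>_. {})"
    using sap_instanceD(7)[OF assms(1)] by (auto simp: feasible_solution_def)
  moreover have "(LINT st|measure_spmf (return_spmf (s, t)). solution_worth I (assigned I (fst st)))
      = solution_worth I (assigned I s)"
    unfolding spmf_of_pmf_return_pmf[symmetric] measure_spmf_spmf_of_pmf by simp
  ultimately show ?thesis
    using assms by (simp add: approximates_def runs_within_def solution_worth_def)
qed

text \<open>From \<open>1 \<le> 1 / \<epsilon>\<close> follow \<open>L \<le> 6 / \<epsilon>\<close>
  and \<open>L + 1 \<le> 7 / \<epsilon>\<close>, hence \<open>X\<close> is at most 84/\<epsilon>^2,
  below 2^7/\<epsilon>^2. Base-2 logarithms of numbers above 1 are at most twice the natural ones,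
  which gives 7 + 4 ln (1/\<epsilon>); 15 leaves room for rounding up.\<close>

lemma refreshment_bound:
  fixes \<epsilon> :: real
  assumes "0 < \<epsilon>" "\<epsilon> < 1"
  defines "L \<equiv> nat \<lceil>5 / \<epsilon>\<rceil>"
  obtains b where "2 * (L + 1) * L \<le> 2 ^ b" "real b \<le> 15 + 4 * ln (1 / \<epsilon>)" "5 / \<epsilon> \<le> L" "L \<le> 6 / \<epsilon>"
proof -
  define X where "X = real (2 * (L + 1) * L)"
  have e: "1 \<le> 1 / \<epsilon>" using assms by simp
  have "0 \<le> 5 / \<epsilon>" using assms by simp
  then have L: "5 / \<epsilon> \<le> L" "L \<le> 5 / \<epsilon> + 1" unfolding L_def by linarith+
  then have L6: "L \<le> 6 / \<epsilon>" using e by simp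
  have L7: "real L + 1 \<le> 7 / \<epsilon>" using L6 e by simp
  have L1: "1 \<le> L" using L(1) e by simp
  have "X = 2 * (real L + 1) * L" by (simp add: X_def algebra_simps)
  also have "\<dots> \<le> 2 * (7 / \<epsilon>) * (6 / \<epsilon>)"
    by (intro mult_mono mult_left_mono L7 L6) (use assms(1) in auto)
  also have "\<dots> \<le> 2 ^ 7 * (1 / \<epsilon>) ^ 2"
    using assms by (simp add: power2_eq_square divide_right_mono)
  finally have "X \<le> 2 ^ 7 * (1 / \<epsilon>) ^ 2" .
  have "1 * (1 * 1) \<le> 2 * (L + 1) * L" using L1 by (intro mult_le_mono) auto
  then have X1: "1 \<le> X" unfolding X_def by linarith
  have "log 2 X \<le> log 2 (2 ^ 7 * (1 / \<epsilon>) ^ 2)"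
    using X1 \<open>X \<le> _\<close> by (intro log_mono) auto
  also have "\<dots> = 7 + 2 * log 2 (1 / \<epsilon>)"
  proof -
    have "log 2 (2 ^ 7 * (1 / \<epsilon>) ^ 2) = log 2 (2 ^ 7) + log 2 ((1 / \<epsilon>) ^ 2)"
      using assms(1) by (intro log_mult_pos) auto
    moreover have "log 2 (2 ^ 7 :: real) = real 7" by (rule log_pow_cancel) auto
    moreover have "log 2 ((1 / \<epsilon>) ^ 2) = real 2 * log 2 (1 / \<epsilon>)"
      using assms(1) by (intro log_nat_power) auto
    ultimately show ?thesis by linarith
  qed
  also have "log 2 (1 / \<epsilon>) \<le> 2 * ln (1 / \<epsilon>)"
  proof -
    have "1 / 2 \<le> ln (2 :: real)" using ln2_ge_two_thirds by simp
    then have "ln (1 / \<epsilon>) \<le> 2 * ln (1 / \<epsilon>) * ln 2"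
      using e mult_left_mono[of "1/2" "ln 2" "2 * ln (1 / \<epsilon>)"] by simp
    then show ?thesis by (simp add: log_def field_simps)
  qed
  finally have lg: "log 2 X \<le> 7 + 4 * ln (1 / \<epsilon>)" by simp
  define b where "b = nat \<lceil>log 2 X\<rceil>"
  have "0 \<le> log 2 X" using X1 by simp
  then have b: "log 2 X \<le> b" "b \<le> log 2 X + 1" unfolding b_def by linarith+
  have "X = 2 powr (log 2 X)" using X1 by simp
  also have "\<dots> \<le> 2 powr b" using b by (intro powr_mono) auto
  finally have "X \<le> 2 ^ b" by (simp add: powr_realpow)
  then have "real (2 * (L + 1) * L) \<le> real (2 ^ b)" by (simp add: X_def)
  then have "2 * (L + 1) * L \<le> 2 ^ b" by (simp only: of_nat_le_iff)
  moreover have "real b \<le> 15 + 4 * ln (1 / \<epsilon>)" using b lg by linarith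
  ultimately show ?thesis using that L L6 by blast
qed

theorem theorem1p5:
  shows "\<exists>(C::real) (k::nat).
    \<forall>(\<alpha>::real) (p :: nat \<Rightarrow> real \<Rightarrow> real) (\<I> :: sap set) (ApproxPack :: sap \<Rightarrow> packer).
      0 < \<alpha> \<and> \<alpha> \<le> 1 \<and>
      (\<forall>I\<in>\<I>. sap_instance I \<and> approx_pack I \<alpha> (p (items I) \<alpha>) (ApproxPack I))
      \<longrightarrow>
      (\<forall>\<epsilon>>0. \<exists>P::com. \<forall>I\<in>\<I>.
         approximates ((1 - \<epsilon>) * (1 - exp (- \<alpha>))) I (run P (ApproxPack I) I \<epsilon>) \<and>
         runs_within
           (C * ((real (items I) / \<epsilon> + p (items I) \<alpha>) * real (bins I))
              * ln (2 + real (items I) * real (bins I) / \<epsilon>) ^ k)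
           (run P (ApproxPack I) I \<epsilon>))"
\<comment> \<open>The local work needs \<open>1100 * 6 = 6600\<close> and the oracle calls 19, from
  \<open>b \<le> 19 * l\<close>; 7000 exceeds the sum 6619. The logarithm stems from
  \<open>b\<close> alone, so the exponent 1 suffices.\<close>
proof (rule exI[of _ 7000], rule exI[of _ 1], intro allI impI, elim conjE)
  fix \<alpha> \<epsilon> :: real and p :: "nat \<Rightarrow> real \<Rightarrow> real" and \<I> :: "sap set" and ApproxPack :: "sap \<Rightarrow> packer"
  assume \<alpha>: "0 < \<alpha>" "\<alpha> \<le> 1" and \<epsilon>: "0 < \<epsilon>"
    and \<I>: "\<forall>I\<in>\<I>. sap_instance I \<and> approx_pack I \<alpha> (p (items I) \<alpha>) (ApproxPack I)"
  define T where "T I = 7000 * ((real (items I) / \<epsilon> + p (items I) \<alpha>) * real (bins I))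
    * ln (2 + real (items I) * real (bins I) / \<epsilon>) ^ 1" for I :: sap
  define L where "L = nat \<lceil>5 / \<epsilon>\<rceil>"
  \<comment> \<open>Every call reports at least one time unit; the call for bin 0 with zero weights
    serves as witness.\<close>
  have p1: "1 \<le> p (items I) \<alpha>" if "I \<in> \<I>" for I
  proof -
    have "0 < bins I" using \<I> that sap_instanceD(1) by blast
    then have "\<forall>(T, t) \<in> set_pmf (ApproxPack I 0 (\<lambda>_. 0)). 1 \<le> t \<and> real t \<le> p (items I) \<alpha>"
      using \<I> that unfolding approx_pack_def by fastforce
    moreover obtain Tt where "Tt \<in> set_pmf (ApproxPack I 0 (\<lambda>_. 0))"
      by (metis all_not_in_conv set_pmf_not_empty)
    ultimately show ?thesis by (fastforce split: prod.splits)
  qed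
  \<comment> \<open>Covers the idle runs of 1 and 6 time units. Without items the logarithm is only
    ln 2, hence the bound 1/2 here.\<close>
  have T: "10 \<le> T I" if "I \<in> \<I>" for I
  proof -
    have "1 \<le> real (bins I)" using \<I> that sap_instanceD(1) by (metis Suc_leI of_nat_1 of_nat_mono One_nat_def)
    then have "1 * 1 \<le> (real (items I) / \<epsilon> + p (items I) \<alpha>) * real (bins I)"
      using p1[OF that] \<epsilon> by (intro mult_mono) (auto simp: add_increasing)
    moreover have "1 / 2 \<le> ln (2 + real (items I) * real (bins I) / \<epsilon>)"
    proof -
      have "1 / 2 \<le> ln (2 :: real)" using ln2_ge_two_thirds by simp
      also have "\<dots> \<le> ln (2 + real (items I) * real (bins I) / \<epsilon>)" using \<epsilon> by (intro ln_mono) auto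
      finally show ?thesis .
    qed
    ultimately have "7000 * 1 * (1 / 2) \<le> T I"
      unfolding T_def power_one_right by (intro mult_mono) auto
    then show ?thesis by simp
  qed
  show "\<exists>P. \<forall>I\<in>\<I>. approximates ((1 - \<epsilon>) * (1 - exp (- \<alpha>))) I (run P (ApproxPack I) I \<epsilon>) \<and>
      runs_within (7000 * ((real (items I) / \<epsilon> + p (items I) \<alpha>) * real (bins I))
        * ln (2 + real (items I) * real (bins I) / \<epsilon>) ^ 1) (run P (ApproxPack I) I \<epsilon>)"
    unfolding T_def[symmetric]
  proof (cases "\<epsilon> < 1")
    case False
    have "approximates ((1 - \<epsilon>) * (1 - exp (- \<alpha>))) I (run Skip (ApproxPack I) I \<epsilon>) \<and>
        runs_within (T I) (run Skip (ApproxPack I) I \<epsilon>)" if I: "I \<in> \<I>" for I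
    proof (rule idle_run[where s = "initial I \<epsilon>" and t = 1])
      \<comment> \<open>The factor 1 - \<epsilon> is not positive, so doing nothing is good enough.
        Placeholder parameters give access to the nonnegativity of the optimum.\<close>
      interpret lazy_greedy I \<alpha> "p (items I) \<alpha>" "ApproxPack I" 1 0
        using \<I> I \<alpha> by unfold_locales auto
      show "(1 - \<epsilon>) * (1 - exp (- \<alpha>)) * opt I \<le> 0"
        using False \<alpha> opt_nonneg by (intro mult_nonpos_nonneg) auto
    qed (use \<I> I T[OF I] in \<open>auto simp: run_def initial_def\<close>)
    then show "\<exists>P. \<forall>I\<in>\<I>. approximates ((1 - \<epsilon>) * (1 - exp (- \<alpha>))) I (run P (ApproxPack I) I \<epsilon>) \<and>
        runs_within (T I) (run P (ApproxPack I) I \<epsilon>)" by blast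
  next
    case True
    obtain b where b: "2 * (L + 1) * L \<le> 2 ^ b" "real b \<le> 15 + 4 * ln (1 / \<epsilon>)"
      and L: "5 / \<epsilon> \<le> L" "L \<le> 6 / \<epsilon>"
      using refreshment_bound[OF \<epsilon> True] unfolding L_def by blast
    have L_pos: "0 < L" using L(1) \<epsilon> by (metis divide_pos_pos of_nat_0_less_iff order_less_le_trans zero_less_numeral)
    have "approximates ((1 - \<epsilon>) * (1 - exp (- \<alpha>))) I (run (sap_com L b) (ApproxPack I) I \<epsilon>) \<and>
        runs_within (T I) (run (sap_com L b) (ApproxPack I) I \<epsilon>)" if I: "I \<in> \<I>" for I
    proof (cases "items I = 0")
      case no_items: True
      show ?thesis
      proof (rule idle_run[where s = "initial I \<epsilon>" and t = 6])
        show inst: "sap_instance I" using \<I> I by blast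
        show "run (sap_com L b) (ApproxPack I) I \<epsilon> = return_spmf (initial I \<epsilon>, 6)"
          using no_items by (simp add: run_def sap_com_def initial_def add_cost_def)
        obtain S where S: "feasible_solution I S" "solution_worth I S = opt I"
          using opt_attained[OF inst] .
        have "S i = {}" if "i < bins I" for i
          using S(1) that sap_instanceD(3)[OF inst that] no_items by (auto simp: feasible_solution_def)
        then show "(1 - \<epsilon>) * (1 - exp (- \<alpha>)) * opt I \<le> 0"
          using S(2) by (simp add: solution_worth_def)
      qed (use T[OF I] in \<open>auto simp: initial_def\<close>)
    next
      case False
      interpret lazy_greedy I \<alpha> "p (items I) \<alpha>" "ApproxPack I" L "bins I * b"
        using \<I> I \<alpha> L_pos by unfold_locales auto
      define m n where "m = real (bins I)" and "n = real (items I)"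
      define l where "l = ln (2 + n * m / \<epsilon>)"
      have mn: "1 \<le> m" "1 \<le> n"
        using False sap_instanceD(1)[OF inst] by (auto simp: m_def n_def)
      have "5 / L \<le> \<epsilon>" using L(1) L_pos \<epsilon> by (simp add: field_simps)
      then have \<rho>: "(1 - \<epsilon>) * (1 - exp (- \<alpha>)) \<le> (1 - 5 / L) * (1 - exp (- \<alpha>))"
        using \<alpha> by (intro mult_right_mono) auto
      have nm: "1 / \<epsilon> \<le> n * m / \<epsilon>"
        using mn \<epsilon> mult_mono[of 1 n 1 m] by (intro divide_right_mono) auto
      moreover have "1 \<le> 1 / \<epsilon>" using \<epsilon> True by simp
      \<comment> \<open>As 1/\<epsilon> is at least 1, the argument of the logarithm is at least 3;
        then \<open>1 \<le> l\<close>, and additive constants can be absorbed into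
        \<open>l\<close>.\<close>
      ultimately have "exp 1 \<le> 2 + n * m / \<epsilon>" using exp_le by linarith
      then have l1: "1 \<le> l" unfolding l_def by (metis exp_gt_zero ln_exp ln_mono order_less_le_trans)
      have "ln (1 / \<epsilon>) \<le> l" unfolding l_def using nm \<epsilon> by (intro ln_mono) auto
      then have b': "real b \<le> 19 * l" using b(2) l1 by linarith
      have "real (1100 * (L * bins I * items I) + call_time * (bins I * b))
          = 1100 * (L * m * n) + (n + real (nat \<lfloor>p (items I) \<alpha>\<rfloor>)) * (m * b)"
        by (simp add: m_def n_def)
      also have "\<dots> \<le> 1100 * (6 / \<epsilon> * m * n) + (n / \<epsilon> + p (items I) \<alpha>) * (m * (19 * l))"
      proof (intro add_mono mult_mono)
        show "n \<le> n / \<epsilon>" using mn \<epsilon> True by (simp add: field_simps mult_left_le)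
        show "real (nat \<lfloor>p (items I) \<alpha>\<rfloor>) \<le> p (items I) \<alpha>" using p1[OF I] by simp
      qed (use L b' mn \<epsilon> p1[OF I] in auto)
      also have "1100 * (6 / \<epsilon> * m * n) = 6600 * (n / \<epsilon> * m) * 1" by simp
      also have "\<dots> \<le> 6600 * ((n / \<epsilon> + p (items I) \<alpha>) * m) * l"
        using l1 mn \<epsilon> p1[OF I] by (intro mult_mono) auto
      finally have "real (1100 * (L * bins I * items I) + call_time * (bins I * b))
          \<le> 6619 * ((n / \<epsilon> + p (items I) \<alpha>) * m * l)"
        by (simp add: algebra_simps)
      also have "\<dots> \<le> 7000 * ((n / \<epsilon> + p (items I) \<alpha>) * m * l)"
        using l1 mn \<epsilon> p1[OF I] by (intro mult_right_mono) auto
      also have "\<dots> = T I" by (simp add: T_def m_def n_def l_def)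
      finally show ?thesis using run_sap_com[OF refl b(1) _ \<rho>] False by blast
    qed
    then show "\<exists>P. \<forall>I\<in>\<I>. approximates ((1 - \<epsilon>) * (1 - exp (- \<alpha>))) I (run P (ApproxPack I) I \<epsilon>) \<and>
        runs_within (T I) (run P (ApproxPack I) I \<epsilon>)" by blast
  qed
qed

end
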